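(* Let $\widetilde L$ be a link diagram and let $L$ be its link universe. Suppose there exist a distinguished segment $s$ and an ordered labeling $l$ such that the link configuration $L_{s;l}$ is admissible. Then the Kauffman bracket polynomial of $\widetilde L$ admits the perfect matching expansion $$\langle \widetilde L\rangle=\sum_{\mathcal P}\ \prod_{h\in\mathcal P}\widetilde\alpha(h)\big|_K ,$$ where the sum is over all perfect matchings $\mathcal P$ of the balanced overlaid checkerboard graph $G^b_{L,s}$, $\widetilde\alpha(h)=\operatorname{sign}(h)\,\alpha(h)$, and the activity letter $\alpha(h)\in\{L,D\}$ of a half-edge $h=h_{(c_j,R)}$ is: $\alpha(h_{(c_j,R)})=L$ if $c_j$ is the crossing with the lowest label among all crossings incident to $R$, and $\alpha(h_{(c_j,R)})=D$ otherwise.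
   Context: Universes. A link diagram $\widetilde L$ is a planar projection of a link, injective except at finitely many double points (crossings), with over/under information at each crossing; the link universe $L$ is $\widetilde L$ with the over/under information forgotten. $L$ is viewed as a 4-valent plane graph whose vertices are the crossings; its edges are called segments and its complementary faces regions. Standing assumption: $L$ is connected and has no curls (regions with a single corner) and no nugatory crossings (crossings at which one region occupies two opposite corners). Regions are checkerboard coloured (adjacent regions have different colours) with the unbounded region white. Bracket. $\langle\cdot\rangle\in\mathbb Z[A^{\pm1}]$ is the Kauffman bracket of unoriented diagrams: $\langle \widetilde L\rangle=A\langle \widetilde L_A\rangle+A^{-1}\langle \widetilde L_B\rangle$ at any crossing, $\langle \widetilde L\sqcup\bigcirc\rangle=(-A^2-A^{-2})\langle \widetilde L\rangle$, $\langle\bigcirc\rangle=1$. Here the $A$-smoothing $\widetilde L_A$ merges the two corners swept out when the over-strand is rotated counterclockwise to the under-strand, and the $B$-smoothing $\widetilde L_B$ merges the other two. Signs. $\operatorname{sign}(c)=+$ if the $A$-smoothing at $c$ merges the two black regions at $c$, and $\operatorname{sign}(c)=-$ otherwise. $\operatorname{sign}(R)=+$ for black and $-$ for white regions. $\operatorname{sign}(h_{(c,R)})=\operatorname{sign}(c)\operatorname{sign}(R)$. Evaluations: $(+L)|_K=-A^{-3}$, $(+D)|_K=A$, $(-L)|_K=-A^{3}$, $(-D)|_K=A^{-1}$. Graphs. The checkerboard graph $G_L$ has a vertex in each black region and, for each crossing $c$, an edge $e_c$ joining the two black regions at $c$; $\overline G_L$ is its planar dual, with vertices the white regions and edges $\overline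 e_c$. An ordered labeling $l$ labels the $n$ crossings bijectively by $1,\dots,n$ (write $c_j$ for the crossing labelled $j$), and linearly orders the edges $e_j$ and $\overline e_j$. The overlaid checkerboard graph has a crossing vertex $v_c$ for each crossing, a round vertex $v_R$ for each region, and a half-edge $h_{(c,R)}$ joining them iff $c$ is incident to $R$. For a distinguished segment $s$, the balanced overlaid checkerboard graph $G^b_{L,s}$ is obtained by deleting the two round vertices $v^W_s,v^B_s$ (the omitted vertices) of the white and black regions adjacent to $s$, together with all incident half-edges. EI-property. A link configuration $L_{s;l}$ is a universe with a distinguished segment and an ordered labeling. A spanning tree $T\subset G_L$ has the dual spanning tree $\overline T=\{\overline e_i: e_i\notin T\}$ of $\overline G_L$; $\widehat T=T\sqcup\overline T$ is a double spanning tree. An edge $\widehat e$ of $T$ (or of $\overline T$) gets letter $\alpha_{\widehat T}(\widehat e)=L$ if it is the lowest-ordered edge in its fundamental cocycle (the edges reconnecting the two components of that tree minus $\widehat e$), and $D$ otherwise. For a half-edge $h=h_{(c,R)}$, let $\eta(h)$ be $e_c$ if $R$ is black and $\overline e_c$ if $R$ is white; for a perfect matching $\mathcal P$ of $G^b_{L,s}$, $\eta(\mathcal P)=\{\eta(h):h\in\mathcal P\}$ is a double spanning tree. A half-edge $h$ satisfies the EI-property if $\alpha_{\eta(\mathcal P)}(\eta(h))$ is the same for all perfect matchings $\mathcal P\ni h$; $L_{s;l}$ satisfies the EI-property if all half-edges of $G^b_{L,s}$ do. Admissible configurations. A bigon extension $E_{c_i}$ at $c_i$ replaces $c_i$ by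 two crossings with a new bigon region between them, separating two opposite corners of $c_i$: one new crossing is incident to each of these two corner regions, and both new crossings are incident to the bigon and to the other two corner regions at $c_i$ (so the bigon has the colour of the two separated corners; type A if black, type B if white). The segment corresponding to $s$ is again called $s$. A natural ordered labeling $l'$ of the resulting universe $L'$ keeps labels $j<i$, raises labels $j>i$ by $1$, and gives the two new crossings labels $i,i+1$ in one of the two orders. If $L_{s;l}$ satisfies the EI-property, $E_{c_i}$ is admissible if for some natural labeling $l'$ the configuration $L'_{s;l'}$ satisfies the EI-property (and $L'_{s;l'}$ is then said to be obtained by the admissible bigon extension). The Hopf link universe $H$ is two circles crossing at two points. $L_{s;l}$ is admissible if it can be obtained from some $H_{s;l_H}$ ($s$ any segment, $l_H$ any ordered labeling of $H$) by a sequence of admissible bigon extensions. *)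

theory Defs
  imports
    "HOL-Library.Numeral_Type"
    "HOL-Library.Poly_Mapping"
    "HOL-Combinatorics.Orbits"
begin

section \<open>Link universes as plane maps\<close>

text \<open>
  A 4-valent plane graph, up to isotopy of the plane, is given by its rotation system. The four
  segment ends (darts) at a crossing \<open>c\<close> are \<open>(c, 0), \<dots>, (c, 3)\<close> in
  counterclockwise order, indices being read modulo 4, and \<open>glue\<close> exchanges the two ends of each
  segment. The pair \<open>(c, i)\<close> also names the corner at \<open>c\<close> that lies between the darts
  \<open>(c, i)\<close> and \<open>(c, i + 1)\<close>; so \<open>(c, i)\<close> and \<open>(c, i + 2)\<close>
  are opposite corners. A region is identified with the set of its corners. The rotation system
  determines a map on the sphere, and \<open>outer\<close> says which region is unbounded.
\<close>

type_synonym 'c dart = "'c \<times> 4"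
type_synonym 'c region = "'c dart set"

record 'c link_universe =
  crossings :: "'c set"
  glue :: "'c dart \<Rightarrow> 'c dart"
  outer :: "'c region"

definition darts :: "'c link_universe \<Rightarrow> 'c dart set" where
  "darts U = crossings U \<times> UNIV"

definition segments :: "'c link_universe \<Rightarrow> 'c dart set set" where
  "segments U = (\<lambda>d. {d, glue U d}) ` darts U"

text \<open>
  The corner \<open>(c, i)\<close> lies to the left of the dart \<open>(c, i)\<close>. Walking along this dart with
  the region on the left, one arrives along some dart \<open>(c', j)\<close> and the next corner of the
  region lies clockwise of that dart.
\<close>

definition next_corner :: "'c link_universe \<Rightarrow> 'c dart \<Rightarrow> 'c dart" where
  "next_corner U d = (case glue U d of (c, j) \<Rightarrow> (c, j - 1))"

definition region :: "'c link_universe \<Rightarrow> 'c dart \<Rightarrow> 'c region" where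
  "region U d = orbit (next_corner U) d"

definition regions :: "'c link_universe \<Rightarrow> 'c region set" where
  "regions U = region U ` darts U"

definition incident :: "'c link_universe \<Rightarrow> 'c \<Rightarrow> 'c region \<Rightarrow> bool" where
  "incident U c R \<longleftrightarrow> (\<exists>i. R = region U (c, i))"

definition connected_universe :: "'c link_universe \<Rightarrow> bool" where
  "connected_universe U \<longleftrightarrow>
     (\<forall>c\<in>crossings U. \<forall>c'\<in>crossings U.
        (c, c') \<in> {(fst d, fst (glue U d)) | d. d \<in> darts U}\<^sup>*)"

definition has_curl :: "'c link_universe \<Rightarrow> bool" where
  "has_curl U \<longleftrightarrow> (\<exists>R\<in>regions U. card R = 1)"

definition nugatory :: "'c link_universe \<Rightarrow> 'c \<Rightarrow> bool" where
  "nugatory U c \<longleftrightarrow> (\<exists>i. region U (c, i) = region U (c, i + 2))"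

text \<open>The cardinality condition is Euler's formula; for connected maps it expresses planarity.\<close>

definition universe :: "'c link_universe \<Rightarrow> bool" where
  "universe U \<longleftrightarrow>
     finite (crossings U) \<and>
     glue U permutes darts U \<and>
     (\<forall>d\<in>darts U. glue U d \<noteq> d \<and> glue U (glue U d) = d) \<and>
     connected_universe U \<and>
     card (crossings U) + card (regions U) = card (segments U) + 2 \<and>
     outer U \<in> regions U \<and>
     \<not> has_curl U \<and>
     (\<forall>c\<in>crossings U. \<not> nugatory U c)"

text \<open>
  The regions on the two sides of the dart \<open>(c, i)\<close> are those of the corners \<open>(c, i)\<close>
  and \<open>(c, i - 1)\<close>. A connected plane universe has exactly one such colouring.
\<close>

definition checkerboard :: "'c link_universe \<Rightarrow> 'c region set \<Rightarrow> bool" where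
  "checkerboard U B \<longleftrightarrow>
     B \<subseteq> regions U \<and> outer U \<notin> B \<and>
     (\<forall>(c, i)\<in>darts U. region U (c, i) \<in> B \<longleftrightarrow> region U (c, i - 1) \<notin> B)"

definition black_regions :: "'c link_universe \<Rightarrow> 'c region set" where
  "black_regions U = (THE B. checkerboard U B)"

definition white_regions :: "'c link_universe \<Rightarrow> 'c region set" where
  "white_regions U = regions U - black_regions U"


section \<open>Link diagrams and the Kauffman bracket\<close>

text \<open>
  The over-strand at \<open>c\<close> runs through the darts \<open>(c, over K c)\<close> and
  \<open>(c, over K c + 2)\<close>.
\<close>

record 'c link_diagram = "'c link_universe" +
  over :: "'c \<Rightarrow> 4"

definition universe_of :: "'c link_diagram \<Rightarrow> 'c link_universe" where
  "universe_of K = link_universe.truncate K"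

text \<open>Finitely supported functions under convolution: the ring of Laurent polynomials in \<open>A\<close>.\<close>

type_synonym laurent = "int \<Rightarrow>\<^sub>0 int"

abbreviation A_pow :: "int \<Rightarrow> laurent" where
  "A_pow n \<equiv> Poly_Mapping.single n 1"

text \<open>
  The diagrams occurring in the recursion for the bracket may be disconnected and may have
  components without crossings. They are given by a set of crossings, a gluing of their darts and
  the number of components without crossings; the bracket does not depend on how the components
  are placed relative to each other. Here \<open>splice x y\<close> removes the darts \<open>x\<close> and \<open>y\<close>
  and joins the strands ending there; this closes up a circle if \<open>x\<close> and \<open>y\<close> were
  glued to each other.
\<close>

fun splice :: "'c dart \<Rightarrow> 'c dart \<Rightarrow> ('c dart \<Rightarrow> 'c dart) \<times> nat \<Rightarrow> ('c dart \<Rightarrow> 'c dart) \<times> nat" where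
  "splice x y (g, k) =
     (g(g x := g y, g y := g x, x := x, y := y), if g x = y then Suc k else k)"

text \<open>
  Merging the opposite corners \<open>(c, i)\<close> and \<open>(c, i + 2)\<close> leaves one strand around each of
  the other two corners, the corner \<open>(c, i + 1)\<close> lying between the darts \<open>(c, i + 1)\<close> and
  \<open>(c, i + 2)\<close>.
\<close>

definition merge_corners ::
    "'c \<Rightarrow> 4 \<Rightarrow> ('c dart \<Rightarrow> 'c dart) \<times> nat \<Rightarrow> ('c dart \<Rightarrow> 'c dart) \<times> nat" where
  "merge_corners c i = splice (c, i + 3) (c, i) \<circ> splice (c, i + 1) (c, i + 2)"

text \<open>
  Rotating the over-strand \<open>(c, v c), (c, v c + 2)\<close> counterclockwise to the under-strand
  sweeps out the corners \<open>(c, v c)\<close> and \<open>(c, v c + 2)\<close>.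
\<close>

definition A_smoothing ::
    "('c \<Rightarrow> 4) \<Rightarrow> 'c \<Rightarrow> ('c dart \<Rightarrow> 'c dart) \<times> nat \<Rightarrow> ('c dart \<Rightarrow> 'c dart) \<times> nat" where
  "A_smoothing v c = merge_corners c (v c)"

definition B_smoothing ::
    "('c \<Rightarrow> 4) \<Rightarrow> 'c \<Rightarrow> ('c dart \<Rightarrow> 'c dart) \<times> nat \<Rightarrow> ('c dart \<Rightarrow> 'c dart) \<times> nat" where
  "B_smoothing v c = merge_corners c (v c + 1)"

inductive bracket_value ::
    "('c \<Rightarrow> 4) \<Rightarrow> 'c set \<Rightarrow> ('c dart \<Rightarrow> 'c dart) \<times> nat \<Rightarrow> laurent \<Rightarrow> bool" for v where
  circle: "bracket_value v {} (g, 1) 1"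
| disjoint_circle: "bracket_value v C (g, k) p \<Longrightarrow>
    bracket_value v C (g, Suc k) ((- A_pow 2 - A_pow (- 2)) * p)"
| skein: "c \<in> C \<Longrightarrow>
    bracket_value v (C - {c}) (A_smoothing v c (g, k)) p \<Longrightarrow>
    bracket_value v (C - {c}) (B_smoothing v c (g, k)) q \<Longrightarrow>
    bracket_value v C (g, k) (A_pow 1 * p + A_pow (- 1) * q)"

definition bracket :: "'c link_diagram \<Rightarrow> laurent" where
  "bracket K = (THE p. bracket_value (over K) (crossings K) (glue K, 0) p)"


section \<open>The balanced overlaid checkerboard graph\<close>

text \<open>
  The half-edge joining the vertices of \<open>c\<close> and \<open>R\<close> is the pair \<open>(c, R)\<close>. The regions
  adjacent to a segment \<open>s\<close> lie to the left of its two darts, so they form the set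
  \<open>region U ` s\<close>.
\<close>

type_synonym 'c half_edge = "'c \<times> 'c region"

definition round_vertices :: "'c link_universe \<Rightarrow> 'c dart set \<Rightarrow> 'c region set" where
  "round_vertices U s = regions U - region U ` s"

definition half_edges :: "'c link_universe \<Rightarrow> 'c dart set \<Rightarrow> 'c half_edge set" where
  "half_edges U s = {(c, R). c \<in> crossings U \<and> R \<in> round_vertices U s \<and> incident U c R}"

definition perfect_matching :: "'c link_universe \<Rightarrow> 'c dart set \<Rightarrow> 'c half_edge set \<Rightarrow> bool" where
  "perfect_matching U s P \<longleftrightarrow>
     P \<subseteq> half_edges U s \<and>
     (\<forall>c\<in>crossings U. \<exists>!h. h \<in> P \<and> fst h = c) \<and>
     (\<forall>R\<in>round_vertices U s. \<exists>!h. h \<in> P \<and> snd h = R)"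


section \<open>Activity letters and the EI-property\<close>

text \<open>
  \<open>Edge c\<close> is the edge of the checkerboard graph at \<open>c\<close>, with vertices the black regions;
  \<open>Dual_Edge c\<close> is the dual edge, with vertices the white regions. Below, \<open>V\<close> is one of
  these two vertex sets and \<open>T\<close> the set of crossings whose edges form a tree on \<open>V\<close>.
  A double spanning tree is a set of edges of both kinds; \<open>eta U ` P\<close> is one for every
  perfect matching \<open>P\<close>.
\<close>

datatype 'c edge = Edge 'c | Dual_Edge 'c

datatype letter = L | D

definition edge_ends :: "'c link_universe \<Rightarrow> 'c region set \<Rightarrow> 'c \<Rightarrow> 'c region set" where
  "edge_ends U V c = {R \<in> V. incident U c R}"

definition joined_by :: "'c link_universe \<Rightarrow> 'c region set \<Rightarrow> 'c set \<Rightarrow> ('c region \<times> 'c region) set" where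
  "joined_by U V T = {(Q, R). \<exists>c\<in>T. edge_ends U V c = {Q, R}}\<^sup>*"

definition fundamental_cocycle :: "'c link_universe \<Rightarrow> 'c region set \<Rightarrow> 'c set \<Rightarrow> 'c \<Rightarrow> 'c set" where
  "fundamental_cocycle U V T c =
     {c' \<in> crossings U. \<exists>Q R. edge_ends U V c' = {Q, R} \<and> (Q, R) \<notin> joined_by U V (T - {c})}"

definition tree_letter ::
    "'c link_universe \<Rightarrow> ('c \<Rightarrow> nat) \<Rightarrow> 'c region set \<Rightarrow> 'c set \<Rightarrow> 'c \<Rightarrow> letter" where
  "tree_letter U l V T c =
     (if \<forall>c'\<in>fundamental_cocycle U V T c. l c \<le> l c' then L else D)"

fun double_tree_letter ::
    "'c link_universe \<Rightarrow> ('c \<Rightarrow> nat) \<Rightarrow> 'c edge set \<Rightarrow> 'c edge \<Rightarrow> letter" where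
  "double_tree_letter U l TT (Edge c) =
     tree_letter U l (black_regions U) {c'. Edge c' \<in> TT} c"
| "double_tree_letter U l TT (Dual_Edge c) =
     tree_letter U l (white_regions U) {c'. Dual_Edge c' \<in> TT} c"

definition eta :: "'c link_universe \<Rightarrow> 'c half_edge \<Rightarrow> 'c edge" where
  "eta U = (\<lambda>(c, R). if R \<in> black_regions U then Edge c else Dual_Edge c)"

definition EI_half_edge ::
    "'c link_universe \<Rightarrow> 'c dart set \<Rightarrow> ('c \<Rightarrow> nat) \<Rightarrow> 'c half_edge \<Rightarrow> bool" where
  "EI_half_edge U s l h \<longleftrightarrow>
     (\<forall>P P'. perfect_matching U s P \<and> h \<in> P \<and> perfect_matching U s P' \<and> h \<in> P' \<longrightarrow>
        double_tree_letter U l (eta U ` P) (eta U h) =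
        double_tree_letter U l (eta U ` P') (eta U h))"

definition link_configuration ::
    "'c link_universe \<Rightarrow> 'c dart set \<Rightarrow> ('c \<Rightarrow> nat) \<Rightarrow> bool" where
  "link_configuration U s l \<longleftrightarrow>
     universe U \<and> s \<in> segments U \<and> bij_betw l (crossings U) {1..card (crossings U)}"

definition EI_property :: "'c link_universe \<Rightarrow> 'c dart set \<Rightarrow> ('c \<Rightarrow> nat) \<Rightarrow> bool" where
  "EI_property U s l \<longleftrightarrow> (\<forall>h\<in>half_edges U s. EI_half_edge U s l h)"


section \<open>Admissible configurations\<close>

text \<open>
  A bigon extension at \<open>c\<close> separating the corners \<open>(c, k)\<close> and \<open>(c, k + 2)\<close>: the
  crossing that stays incident to the region of \<open>(c, k)\<close> is again called \<open>c\<close>, the other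
  one is a new crossing \<open>c'\<close>, which takes over the segment ends \<open>k + 2\<close> and \<open>k + 3\<close>.
  The darts of \<open>c'\<close> are numbered with an arbitrary shift \<open>m\<close>, so that all universes isomorphic
  to the extended one are obtained.

  The new bigon has the corners \<open>(c, k + 2)\<close> and \<open>(c', k + m)\<close>. The map \<open>transfer\<close> sends
  each dart of the old universe to its new name; it also sends each corner of a region to a corner
  of the corresponding region.
\<close>

definition transfer :: "'c \<Rightarrow> 'c \<Rightarrow> 4 \<Rightarrow> 4 \<Rightarrow> 'c dart \<Rightarrow> 'c dart" where
  "transfer c c' k m = (\<lambda>(x, i). if x = c \<and> (i = k + 2 \<or> i = k + 3) then (c', i + m) else (x, i))"

definition bigon_extension ::
    "'c link_universe \<Rightarrow> 'c dart set \<Rightarrow> 'c \<Rightarrow> 'c \<Rightarrow> 'c link_universe \<Rightarrow> 'c dart set \<Rightarrow> bool" where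
  "bigon_extension U s c c' U' s' \<longleftrightarrow>
     universe U' \<and> c \<in> crossings U \<and> c' \<notin> crossings U \<and>
     crossings U' = insert c' (crossings U) \<and>
     (\<exists>k m.
        (\<forall>d\<in>darts U. glue U' (transfer c c' k m d) = transfer c c' k m (glue U d)) \<and>
        glue U' (c, k + 2) = (c', k + 1 + m) \<and>
        glue U' (c, k + 3) = (c', k + m) \<and>
        transfer c c' k m ` outer U \<subseteq> outer U' \<and>
        s' = transfer c c' k m ` s)"

definition natural_labeling ::
    "'c link_universe \<Rightarrow> ('c \<Rightarrow> nat) \<Rightarrow> 'c \<Rightarrow> 'c \<Rightarrow> ('c \<Rightarrow> nat) \<Rightarrow> bool" where
  "natural_labeling U l c c' l' \<longleftrightarrow>
     (\<forall>x\<in>crossings U. l x < l c \<longrightarrow> l' x = l x) \<and>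
     (\<forall>x\<in>crossings U. l x > l c \<longrightarrow> l' x = l x + 1) \<and>
     (l' c = l c \<and> l' c' = l c + 1 \<or> l' c = l c + 1 \<and> l' c' = l c)"

definition admissible_extension ::
    "'c link_universe \<Rightarrow> 'c dart set \<Rightarrow> ('c \<Rightarrow> nat) \<Rightarrow>
     'c link_universe \<Rightarrow> 'c dart set \<Rightarrow> ('c \<Rightarrow> nat) \<Rightarrow> bool" where
  "admissible_extension U s l U' s' l' \<longleftrightarrow>
     EI_property U s l \<and>
     (\<exists>c c'. bigon_extension U s c c' U' s' \<and> natural_labeling U l c c' l') \<and>
     EI_property U' s' l'"

text \<open>
  Two circles crossing at \<open>a\<close> and \<open>b\<close>: the segments at \<open>a\<close>, in counterclockwise order,
  arrive at \<open>b\<close> in clockwise order.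
\<close>

definition hopf_universe :: "'c link_universe \<Rightarrow> bool" where
  "hopf_universe U \<longleftrightarrow>
     universe U \<and>
     (\<exists>a b k. a \<noteq> b \<and> crossings U = {a, b} \<and> (\<forall>i. glue U (a, i) = (b, k - i)))"

inductive admissible :: "'c link_universe \<Rightarrow> 'c dart set \<Rightarrow> ('c \<Rightarrow> nat) \<Rightarrow> bool" where
  hopf: "hopf_universe U \<Longrightarrow> link_configuration U s l \<Longrightarrow> admissible U s l"
| extend: "admissible U s l \<Longrightarrow> admissible_extension U s l U' s' l' \<Longrightarrow> admissible U' s' l'"


section \<open>Weights of half-edges\<close>

definition crossing_sign :: "'c link_diagram \<Rightarrow> 'c \<Rightarrow> int" where
  "crossing_sign K c =
     (if region (universe_of K) (c, over K c) \<in> black_regions (universe_of K) \<and>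
         region (universe_of K) (c, over K c + 2) \<in> black_regions (universe_of K)
      then 1 else - 1)"

definition region_sign :: "'c link_universe \<Rightarrow> 'c region \<Rightarrow> int" where
  "region_sign U R = (if R \<in> black_regions U then 1 else - 1)"

definition half_edge_sign :: "'c link_diagram \<Rightarrow> 'c half_edge \<Rightarrow> int" where
  "half_edge_sign K = (\<lambda>(c, R). crossing_sign K c * region_sign (universe_of K) R)"

definition activity_letter :: "'c link_universe \<Rightarrow> ('c \<Rightarrow> nat) \<Rightarrow> 'c half_edge \<Rightarrow> letter" where
  "activity_letter U l =
     (\<lambda>(c, R). if \<forall>c'\<in>crossings U. incident U c' R \<longrightarrow> l c \<le> l c' then L else D)"

definition signed_letter ::
    "'c link_diagram \<Rightarrow> ('c \<Rightarrow> nat) \<Rightarrow> 'c half_edge \<Rightarrow> int \<times> letter" where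
  "signed_letter K l h = (half_edge_sign K h, activity_letter (universe_of K) l h)"

fun eval_K :: "int \<times> letter \<Rightarrow> laurent" where
  "eval_K (\<sigma>, L) = (if \<sigma> = 1 then - A_pow (- 3) else - A_pow 3)"
| "eval_K (\<sigma>, D) = (if \<sigma> = 1 then A_pow 1 else A_pow (- 1))"

end

theory Submission
  imports Defs
begin

text \<open>
  The bracket is a sum over states, in which every crossing carries the weights of its two
  smoothings. With arbitrary weights at all crossings, the claimed expansion is proved by induction
  over bigon extensions. A bigon extension replaces a crossing by a twist of two crossings, and such
  a twist acts in the state sum like a single crossing with other weights. On the side of the
  matchings, a matching \<open>P\<close> lifts to two matchings if \<open>P\<close> matches the split crossing to a region along
  the twist, and to one otherwise. The weights of the lifts add up to the right value for regions
  along the twist; for the other two corner regions they do so only if the letter of the half-edge is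
  prescribed by the order of the two new labels. This is what the EI-property of the extended
  universe yields, applied to the half-edges at the bigon, once the letters given by fundamental
  cocycles are known to agree with those given by the lowest label at a region; the latter is carried
  along in the induction. No expansion over spanning trees is needed.
\<close>


text \<open>The weights must be arbitrary because the crossing that stands for a twist no longer has
  weights A and A^-1. In this generality letter D at a region of colour \<open>b\<close> means the
  weight of merging the corners of colour \<open>b\<close>, and L means this weight plus -A^2 - A^-2
  times the other one. For the Kauffman weights this is A - (A^2 + A^-2) A^-1 = -A^-3, and likewise
  with A inverted. The obstacle is a half-edge at one of the two separated corners P. It has a
  single lift, which matches the far crossing to the bigon, and the two new weights multiply to the
  right value only if both new letters agree. One letter compares the two new labels, the other
  compares the old label with all labels around P, and nothing in the labels alone relates them. The
  relation comes from a second matching, which sends the split crossing to the other colour and has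
  a lift through the same half-edge at the bigon. Hence the invariant has to supply, for each
  crossing, matchings in both colours.\<close>

section \<open>Indices modulo four\<close>

lemma four_cases: "(i::4) = k \<or> i = k + 1 \<or> i = k + 2 \<or> i = k + 3"
proof -
  obtain z where z: "i - k = of_int z" "0 \<le> z" "z < int CARD(2 bit0)"
    by (cases "i - k" rule: bit0_cases) auto
  then have "z = 0 \<or> z = 1 \<or> z = 2 \<or> z = 3" by auto
  with z(1) have "i - k = 0 \<or> i - k = 1 \<or> i - k = 2 \<or> i - k = 3" by auto
  then show ?thesis by (auto simp: algebra_simps)
qed

lemma four_shift: "(i::4) - 1 = i + 3" "(i::4) - 2 = i + 2" "(i::4) - 3 = i + 1"
  by (simp_all add: eq_diff_eq diff_eq_eq)

text \<open>Opposite corners have indices of equal parity, so a parity selects a smoothing of the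
  crossing and, under a checkerboard colouring, a colour at that crossing.\<close>

definition odd4 :: "4 \<Rightarrow> bool" where
  "odd4 i \<longleftrightarrow> i = 1 \<or> i = 3"

lemma odd4_add: "odd4 (i + 1) \<longleftrightarrow> \<not> odd4 i" "odd4 (i + 2) \<longleftrightarrow> odd4 i" "odd4 (i + 3) \<longleftrightarrow> \<not> odd4 i"
  using four_cases[of i 0] by (auto simp: odd4_def)

section \<open>Counting circles of a state\<close>

definition pairing :: "'a set \<Rightarrow> ('a \<Rightarrow> 'a) \<Rightarrow> bool" where
  "pairing A g \<longleftrightarrow> (\<forall>x\<in>A. g x \<in> A \<and> g x \<noteq> x \<and> g (g x) = x)"

text \<open>For two fixed-point-free involutions on a finite set this graph is a disjoint union of
  cycles that alternate between segments (\<open>g\<close>) and smoothing arcs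
  (\<open>\<mu>\<close>): its components are the circles of a state.\<close>

definition strands :: "('a \<Rightarrow> 'a) \<Rightarrow> ('a \<Rightarrow> 'a) \<Rightarrow> 'a set \<Rightarrow> 'a rel" where
  "strands g \<mu> A = {(x, g x) | x. x \<in> A} \<union> {(x, \<mu> x) | x. x \<in> A}"

definition components :: "'a rel \<Rightarrow> 'a set \<Rightarrow> 'a set set" where
  "components r A = (\<lambda>x. r\<^sup>* `` {x}) ` A"

lemma strandsI: "x \<in> A \<Longrightarrow> (x, g x) \<in> strands g \<mu> A" "x \<in> A \<Longrightarrow> (x, \<mu> x) \<in> strands g \<mu> A"
  unfolding strands_def by auto

lemma strands_edge:
  assumes "x \<in> A"
  shows "(x, g x) \<in> (strands g \<mu> A)\<^sup>*" "(x, \<mu> x) \<in> (strands g \<mu> A)\<^sup>*"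
  using assms by (intro r_into_rtrancl strandsI; simp)+

lemma strands_cong:
  "(\<And>x. x \<in> A \<Longrightarrow> g x = g' x) \<Longrightarrow> (\<And>x. x \<in> A \<Longrightarrow> \<mu> x = \<mu>' x) \<Longrightarrow> strands g \<mu> A = strands g' \<mu>' A"
  unfolding strands_def by auto

lemma sym_strands: "pairing A g \<Longrightarrow> pairing A \<mu> \<Longrightarrow> sym (strands g \<mu> A)"
  unfolding pairing_def strands_def sym_def by auto

lemma rtrancl_class_eq:
  assumes "sym r" "(x, y) \<in> r\<^sup>*"
  shows "r\<^sup>* `` {x} = r\<^sup>* `` {y}"
proof -
  have "(y, x) \<in> r\<^sup>*" using assms by (meson sym_rtrancl symD)
  with assms(2) show ?thesis by (auto intro: rtrancl_trans)
qed

lemma rtrancl_map: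
  assumes "\<And>x y. (x, y) \<in> r \<Longrightarrow> (f x, f y) \<in> q\<^sup>*" "(x, y) \<in> r\<^sup>*"
  shows "(f x, f y) \<in> q\<^sup>*"
  using assms(2) by induction (auto intro: assms(1) rtrancl_trans)

text \<open>Two maps that send edges to paths and are mutually inverse up to paths induce inverse
  bijections between the components. Neither map has to be injective, which allows darts to be
  removed and segments to be collapsed.\<close>

lemma card_components_eq:
  assumes sym: "sym r" "sym q"
    and f: "\<And>x y. (x, y) \<in> q \<Longrightarrow> (f x, f y) \<in> r\<^sup>*" "\<And>y. y \<in> B \<Longrightarrow> f y \<in> A"
    and h: "\<And>x y. (x, y) \<in> r \<Longrightarrow> (h x, h y) \<in> q\<^sup>*" "\<And>x. x \<in> A \<Longrightarrow> h x \<in> B"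
    and fh: "\<And>x. x \<in> A \<Longrightarrow> (f (h x), x) \<in> r\<^sup>*"
    and hf: "\<And>y. y \<in> B \<Longrightarrow> (h (f y), y) \<in> q\<^sup>*"
  shows "card (components r A) = card (components q B)"
proof -
  define F where "F X = q\<^sup>* `` (h ` X)" for X
  have F: "F (r\<^sup>* `` {x}) = q\<^sup>* `` {h x}" for x
  proof
    show "F (r\<^sup>* `` {x}) \<subseteq> q\<^sup>* `` {h x}"
      unfolding F_def using rtrancl_map[of r h q, OF h(1)] by (auto intro: rtrancl_trans)
    show "q\<^sup>* `` {h x} \<subseteq> F (r\<^sup>* `` {x})" unfolding F_def by auto
  qed
  have "bij_betw F (components r A) (components q B)"
    unfolding bij_betw_def
  proof
    show "inj_on F (components r A)"
    proof (rule inj_onI, unfold components_def, elim imageE, simp only: F)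
      fix x y assume "x \<in> A" "y \<in> A" "q\<^sup>* `` {h x} = q\<^sup>* `` {h y}"
      then have "(h x, h y) \<in> q\<^sup>*" by auto
      from rtrancl_map[of q f r, OF f(1) this] have "(f (h x), f (h y)) \<in> r\<^sup>*" .
      moreover have "(x, f (h x)) \<in> r\<^sup>*" using fh[OF \<open>x \<in> A\<close>] sym by (meson sym_rtrancl symD)
      ultimately have "(x, y) \<in> r\<^sup>*" using fh[OF \<open>y \<in> A\<close>] by (meson rtrancl_trans)
      then show "r\<^sup>* `` {x} = r\<^sup>* `` {y}" using rtrancl_class_eq sym by metis
    qed
    show "F ` components r A = components q B"
    proof
      show "F ` components r A \<subseteq> components q B"
        unfolding components_def using F h(2) by auto
      show "components q B \<subseteq> F ` components r A"
      proof (unfold components_def, rule subsetI, elim imageE)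
        fix X y assume "y \<in> B" "X = q\<^sup>* `` {y}"
        then have "X = F (r\<^sup>* `` {f y})"
          using F hf rtrancl_class_eq[OF sym(2)] by metis
        then show "X \<in> F ` (\<lambda>x. r\<^sup>* `` {x}) ` A" using f(2)[OF \<open>y \<in> B\<close>] by blast
      qed
    qed
  qed
  then show ?thesis by (rule bij_betw_same_card)
qed

lemma rtrancl_closed:
  assumes "(x, y) \<in> r\<^sup>*" "x \<in> A" "\<And>x y. x \<in> A \<Longrightarrow> (x, y) \<in> r \<Longrightarrow> y \<in> A \<and> (x, y) \<in> q"
  shows "y \<in> A \<and> (x, y) \<in> q\<^sup>*"
  using assms(1,2)
proof induction
  case (step y z)
  then have "y \<in> A" "(x, y) \<in> q\<^sup>*" by auto
  with assms(3)[OF _ \<open>(y, z) \<in> r\<close>] show ?case by (auto intro: rtrancl_into_rtrancl)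
qed auto

lemma pairing_diff:
  assumes "pairing A g" "B \<subseteq> A" "\<And>x. x \<in> B \<Longrightarrow> g x \<in> B"
  shows "pairing (A - B) g"
  unfolding pairing_def
proof (intro ballI conjI)
  fix x assume x: "x \<in> A - B"
  then have p: "g x \<in> A" "g x \<noteq> x" "g (g x) = x" using assms(1) unfolding pairing_def by auto
  then show "g x \<noteq> x" "g (g x) = x" by auto
  show "g x \<in> A - B" using p x assms(3)[of "g x"] by auto
qed

text \<open>No edge leaves or enters a set closed under both involutions; being connected as well,
  it is a single component and can be split off.\<close>

lemma card_components_split:
  assumes "finite A" "B \<subseteq> A" "x \<in> B" "pairing A g" "pairing A \<mu>"
    and closed: "\<And>x. x \<in> B \<Longrightarrow> g x \<in> B" "\<And>x. x \<in> B \<Longrightarrow> \<mu> x \<in> B"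
    and conn: "\<And>y. y \<in> B \<Longrightarrow> (x, y) \<in> (strands g \<mu> B)\<^sup>*"
  shows "card (components (strands g \<mu> A) A) = Suc (card (components (strands g \<mu> (A - B)) (A - B)))"
proof -
  let ?r = "strands g \<mu> A"
  have sym: "sym ?r" using assms by (intro sym_strands)
  have "strands g \<mu> B \<subseteq> ?r" unfolding strands_def using assms(2) by auto
  then have mono: "(strands g \<mu> B)\<^sup>* \<subseteq> ?r\<^sup>*" by (rule rtrancl_mono)
  have pr: "pairing (A - B) g" "pairing (A - B) \<mu>" using assms by (auto intro: pairing_diff)
  have cB: "?r\<^sup>* `` {y} = B" if "y \<in> B" for y
  proof
    show "?r\<^sup>* `` {y} \<subseteq> B"
    proof
      fix z assume "z \<in> ?r\<^sup>* `` {y}"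
      then show "z \<in> B"
        using rtrancl_closed[of y z ?r B UNIV] that closed by (auto simp: strands_def)
    qed
    have "(y, x) \<in> ?r\<^sup>*" using conn[OF that] mono sym by (meson sym_rtrancl symD subsetD)
    then show "B \<subseteq> ?r\<^sup>* `` {y}" using conn mono by (auto intro: rtrancl_trans)
  qed
  have cA: "?r\<^sup>* `` {y} = (strands g \<mu> (A - B))\<^sup>* `` {y} \<and> ?r\<^sup>* `` {y} \<subseteq> A - B" if "y \<in> A - B" for y
  proof -
    have "strands g \<mu> (A - B) \<subseteq> ?r" unfolding strands_def by auto
    then have 1: "(strands g \<mu> (A - B))\<^sup>* \<subseteq> ?r\<^sup>*" by (rule rtrancl_mono)
    have 2: "z \<in> A - B \<and> (y, z) \<in> (strands g \<mu> (A - B))\<^sup>*" if "(y, z) \<in> ?r\<^sup>*" for z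
    proof (rule rtrancl_closed[OF that \<open>y \<in> A - B\<close>])
      fix u v assume "u \<in> A - B" "(u, v) \<in> ?r"
      then show "v \<in> A - B \<and> (u, v) \<in> strands g \<mu> (A - B)"
        using pr unfolding strands_def pairing_def by auto
    qed
    show ?thesis using 1 2 by auto
  qed
  have "components ?r A = components ?r (A - B) \<union> components ?r B"
    unfolding components_def using assms(2) by auto
  moreover have "components ?r B = {B}" unfolding components_def using cB assms(3) by auto
  moreover have "components ?r (A - B) = components (strands g \<mu> (A - B)) (A - B)"
    unfolding components_def using cA by (intro image_cong) auto
  moreover have "B \<notin> components ?r (A - B)" unfolding components_def using cA assms(3) by auto
  moreover have "finite (components ?r (A - B))" unfolding components_def using assms(1) by auto
  ultimately show ?thesis by simp
qed

text \<open>Splicing along a smoothing arc contracts the path \<open>g x\<close>, \<open>x\<close>,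
  \<open>y\<close>, \<open>g y\<close> to one segment and keeps the number of circles. If
  \<open>g x = y\<close>, the arc and its segment already form a circle; it leaves the dart set and
  is recorded in the counter instead.\<close>

lemma splice_circles:
  assumes "finite A" "pairing A g" "pairing A \<mu>" "x \<in> A" "\<mu> x = y"
    and sp: "splice x y (g, k) = (g', k')"
  shows "pairing (A - {x, y}) g' \<and> pairing (A - {x, y}) \<mu> \<and>
    k' + card (components (strands g' \<mu> (A - {x, y})) (A - {x, y})) = k + card (components (strands g \<mu> A) A)"
proof -
  have y: "y \<in> A" "y \<noteq> x" "\<mu> y = x" using assms unfolding pairing_def by auto
  have g: "\<And>z. z \<in> A \<Longrightarrow> g z \<in> A" "\<And>z. z \<in> A \<Longrightarrow> g z \<noteq> z" "\<And>z. z \<in> A \<Longrightarrow> g (g z) = z"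
    using assms(2) unfolding pairing_def by auto
  have mu: "\<And>z. z \<in> A \<Longrightarrow> \<mu> z \<in> A" "\<And>z. z \<in> A \<Longrightarrow> \<mu> z \<noteq> z" "\<And>z. z \<in> A \<Longrightarrow> \<mu> (\<mu> z) = z"
    using assms(3) unfolding pairing_def by auto
  have pm: "pairing (A - {x, y}) \<mu>" using y assms(3-5) by (intro pairing_diff) auto
  show ?thesis
  proof (cases "g x = y")
    case True
    then have gy: "g y = x" using g(3)[OF \<open>x \<in> A\<close>] by auto
    have g': "g' z = g z" if "z \<in> A - {x, y}" for z
      using sp True gy that by auto
    have "pairing (A - {x, y}) g" using y assms(2,4) True gy by (intro pairing_diff) auto
    then have pg': "pairing (A - {x, y}) g'" using g' unfolding pairing_def by auto
    have conn: "(x, z) \<in> (strands g \<mu> {x, y})\<^sup>*" if "z \<in> {x, y}" for z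
      using that True r_into_rtrancl[of "(x, g x)" "strands g \<mu> {x, y}"] unfolding strands_def by blast
    have "card (components (strands g \<mu> A) A) = Suc (card (components (strands g \<mu> (A - {x,y})) (A - {x,y})))"
    proof (rule card_components_split[OF assms(1) _ _ assms(2,3) _ _ conn])
      show "{x, y} \<subseteq> A" using y(1) assms(4) by auto
      show "z \<in> {x, y} \<Longrightarrow> g z \<in> {x, y}" "z \<in> {x, y} \<Longrightarrow> \<mu> z \<in> {x, y}" for z
        using True gy y(3) assms(5) by (elim insertE emptyE; simp)+
    qed simp
    moreover have "strands g \<mu> (A - {x, y}) = strands g' \<mu> (A - {x, y})"
      using g' by (intro strands_cong) auto
    moreover have "k' = Suc k" using sp True by auto
    ultimately show ?thesis using pg' pm by simp
  next
    case False
    then have gy: "g y \<noteq> x" using g(3)[OF y(1)] by auto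
    have k': "k' = k" using sp False by auto
    have gxy: "g x \<noteq> g y" using g(3)[OF \<open>x \<in> A\<close>] g(3)[OF y(1)] y(2) by metis
    have "g' = g(g x := g y, g y := g x, x := x, y := y)" using sp by simp
    then have g': "g' z = (if z = x then x else if z = y then y else if z = g x then g y else if z = g y then g x else g z)" for z
      using gxy y(2) by (simp add: fun_upd_apply)
    let ?A = "A - {x, y}"
    have gin: "g x \<in> ?A" "g y \<in> ?A" "g x \<noteq> g y"
      using False gy gxy g(1,2) y assms(4) by auto
    have other: "g z \<notin> {x, y}" "g z \<noteq> g x" "g z \<noteq> g y" if "z \<in> ?A - {g x, g y}" for z
      using that g(3) y(1) assms(4) by (auto, metis+)
    have pg': "pairing ?A g'"
      unfolding pairing_def
    proof
      fix z assume z: "z \<in> ?A"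
      show "g' z \<in> ?A \<and> g' z \<noteq> z \<and> g' (g' z) = z"
      proof (cases "z \<in> {g x, g y}")
        case True then show ?thesis using gin g' by auto
      next
        case F: False
        then show ?thesis using z other[of z] g[of z] g' by auto
      qed
    qed
    have s: "sym (strands g \<mu> A)" "sym (strands g' \<mu> ?A)"
      using assms(2,3) pg' pm by (auto intro: sym_strands)
    \<comment> \<open>The removed darts are retracted along their segments to the ends that
      survive.\<close>
    define h where "h z = (if z = x then g x else if z = y then g y else z)" for z
    have hx: "h x = g x" "h y = g y" using y by (auto simp: h_def)
    have hg: "h (g x) = g x" "h (g y) = g y" using gin unfolding h_def by auto
    have gg: "(g x, g y) \<in> strands g' \<mu> ?A" "(g y, g x) \<in> strands g' \<mu> ?A"
      using strandsI(1)[OF gin(1), of g' \<mu>] strandsI(1)[OF gin(2), of g' \<mu>] g'[of "g x"] g'[of "g y"] gin by auto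
    have base: "(z, g z) \<in> (strands g \<mu> A)\<^sup>*" "(z, \<mu> z) \<in> (strands g \<mu> A)\<^sup>*" if "z \<in> A" for z
      using that by (intro r_into_rtrancl strandsI; simp)+
    have e: "(g x, x) \<in> (strands g \<mu> A)\<^sup>*" "(g y, y) \<in> (strands g \<mu> A)\<^sup>*"
      using base(1)[of "g x"] base(1)[of "g y"] g y assms(4) by auto
    have xy: "(x, y) \<in> (strands g \<mu> A)\<^sup>*" "(y, x) \<in> (strands g \<mu> A)\<^sup>*"
      using base(2)[of x] base(2)[of y] y assms(4,5) by auto
    have e2: "(g x, g y) \<in> (strands g \<mu> A)\<^sup>*" "(g y, g x) \<in> (strands g \<mu> A)\<^sup>*"
      using e xy base(1)[of x] base(1)[of y] y assms(4) by (meson rtrancl_trans)+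
    have "card (components (strands g' \<mu> ?A) ?A) = card (components (strands g \<mu> A) A)"
    proof (rule card_components_eq[where f = h and h = id, OF s(2,1)])
      fix u v assume "(u, v) \<in> strands g \<mu> A"
      then have u: "u \<in> A" and v: "v = g u \<or> v = \<mu> u" unfolding strands_def by auto
      show "(h u, h v) \<in> (strands g' \<mu> ?A)\<^sup>*"
      proof (cases "v = g u")
        case True
        consider "u = x" | "u = y" | "u = g x" | "u = g y" | "u \<in> ?A - {g x, g y}" using u by auto
        then show ?thesis
        proof cases
          case 5
          then have "h u = u" "h v = v" "v = g' u" using True other[of u] g'[of u] by (auto simp: h_def)
          then show ?thesis using strands_edge(1)[of u ?A g' \<mu>] 5 by auto
        next
          case 1 then show ?thesis using True hx hg by simp
        next
          case 2 then show ?thesis using True hx hg by simp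
        next
          case 3
          then have "v = x" using True g(3)[OF assms(4)] by simp
          then show ?thesis using 3 hx hg by simp
        next
          case 4
          then have "v = y" using True g(3)[OF y(1)] by simp
          then show ?thesis using 4 hx hg by simp
        qed
      next
        case F: False
        then have v: "v = \<mu> u" using v by auto
        consider "u = x" | "u = y" | "u \<in> ?A" using u by auto
        then show ?thesis
        proof cases
          case 3
          then have "v \<in> ?A" using pm v unfolding pairing_def by auto
          then show ?thesis using strands_edge(2)[of u ?A \<mu> g'] 3 v unfolding h_def by auto
        next
          case 1 then have "v = y" using v assms(5) by simp
          then show ?thesis using 1 gg hx by auto
        next
          case 2 then have "v = x" using v y(3) by simp
          then show ?thesis using 2 gg hx by auto
        qed
      qed
    next
      fix u v assume "(u, v) \<in> strands g' \<mu> ?A"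
      then have u: "u \<in> ?A" and v: "v = g' u \<or> v = \<mu> u" unfolding strands_def by auto
      show "(id u, id v) \<in> (strands g \<mu> A)\<^sup>*"
        using u v base[of u] e2 g'[of u] by (auto split: if_splits)
    next
      fix u assume "u \<in> A"
      then show "h u \<in> ?A" using gin by (auto simp: h_def)
      show "(id (h u), u) \<in> (strands g \<mu> A)\<^sup>*" using e by (auto simp: h_def)
    next
      fix u assume "u \<in> ?A"
      then have "h u = u" "u \<in> A" unfolding h_def by auto
      then show "id u \<in> A" "(h (id u), u) \<in> (strands g' \<mu> ?A)\<^sup>*" by auto
    qed
    then show ?thesis using k' pg' pm by simp
  qed
qed


section \<open>State sums\<close>

text \<open>
  A state is given by the set \<open>S\<close> of the crossings at which the corners with odd index are merged;
  at the other crossings the corners with even index are merged.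
\<close>

definition state_partner :: "'c set \<Rightarrow> 'c dart \<Rightarrow> 'c dart" where
  "state_partner S = (\<lambda>(c, i). (c, (if c \<in> S then 1 else 3) - i))"

definition circles :: "'c set \<Rightarrow> ('c dart \<Rightarrow> 'c dart) \<Rightarrow> 'c set \<Rightarrow> nat" where
  "circles C g S = card (components (strands g (state_partner S) (C \<times> UNIV)) (C \<times> UNIV))"

definition loop_value :: laurent where
  "loop_value = - A_pow 2 - A_pow (- 2)"

text \<open>One circle has value 1, hence the exponent. The subtraction on natural numbers is exact
  as soon as some circle is present, which explains the conditions on \<open>k\<close> for
  \<open>C = {}\<close> below.\<close>

definition state_sum ::
    "'c set \<Rightarrow> ('c dart \<Rightarrow> 'c dart) \<times> nat \<Rightarrow> ('c \<Rightarrow> bool \<Rightarrow> laurent) \<Rightarrow> laurent" where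
  "state_sum C = (\<lambda>(g, k) w. \<Sum>S\<in>Pow C. (\<Prod>c\<in>C. w c (c \<in> S)) * loop_value ^ (k + circles C g S - 1))"

text \<open>A fixed point would be a solution of 2i = 1 or 2i = 3 modulo 4.\<close>

lemma pairing_state_partner: "pairing (C \<times> UNIV) (state_partner S)"
proof -
  have "(if b then 1 else 3) - i \<noteq> (i::4)" for b i
    using four_cases[of i 0] by auto
  then show ?thesis unfolding pairing_def state_partner_def by auto
qed

lemma circles_cong: "(\<And>c. c \<in> C \<Longrightarrow> c \<in> S \<longleftrightarrow> c \<in> S') \<Longrightarrow> circles C g S = circles C g S'"
  unfolding circles_def by (intro arg_cong2[where f = "\<lambda>r A. card (components r A)"] strands_cong)
    (auto simp: state_partner_def)

lemma circles_pos: "finite C \<Longrightarrow> C \<noteq> {} \<Longrightarrow> 0 < circles C g S"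
  unfolding circles_def components_def by (auto simp: card_gt_0_iff)

text \<open>The state merges the corners of the parity of \<open>i\<close>, so both splices of
  \<open>merge_corners c i\<close> run along arcs of the state at \<open>c\<close>, and each of them
  preserves the total of recorded and visible circles.\<close>

lemma merge_corners_circles:
  assumes "finite C" "pairing (C \<times> UNIV) g" "c \<in> C" "c \<in> S \<longleftrightarrow> odd4 i"
    and m: "merge_corners c i (g, k) = (g', k')"
  shows "pairing ((C - {c}) \<times> UNIV) g' \<and> k' + circles (C - {c}) g' S = k + circles C g S"
proof -
  obtain g1 k1 where 1: "splice (c, i + 1) (c, i + 2) (g, k) = (g1, k1)" by (metis surj_pair)
  with m have 2: "splice (c, i + 3) (c, i) (g1, k1) = (g', k')" by (simp add: merge_corners_def del: splice.simps)
  have o: "(if c \<in> S then 1 else 3) - (i + 1) = i + 2" "(if c \<in> S then 1 else 3) - (i + 3) = i"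
    using assms(4) four_cases[of i 0] by (auto simp: odd4_def)
  let ?A = "C \<times> (UNIV :: 4 set)" and ?B = "C \<times> (UNIV :: 4 set) - {(c, i + 1), (c, i + 2)}"
  have A: "?B - {(c, i + 3), (c, i)} = (C - {c}) \<times> UNIV"
  proof -
    have "(UNIV :: 4 set) = {i, i + 1, i + 2, i + 3}" using four_cases[of _ i] by auto
    then show ?thesis by auto
  qed
  have s1: "pairing ?B g1 \<and> pairing ?B (state_partner S) \<and>
    k1 + card (components (strands g1 (state_partner S) ?B) ?B) =
    k + card (components (strands g (state_partner S) ?A) ?A)"
    by (rule splice_circles[OF _ assms(2) pairing_state_partner _ _ 1])
      (use assms o in \<open>auto simp: state_partner_def\<close>)
  have "pairing (?B - {(c, i + 3), (c, i)}) g' \<and> pairing (?B - {(c, i + 3), (c, i)}) (state_partner S) \<and>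
    k' + card (components (strands g' (state_partner S) (?B - {(c, i + 3), (c, i)})) (?B - {(c, i + 3), (c, i)})) =
    k1 + card (components (strands g1 (state_partner S) ?B) ?B)"
    by (rule splice_circles[OF _ _ _ _ _ 2]) (use assms o s1 in \<open>auto simp: state_partner_def\<close>)
  with s1 show ?thesis unfolding A circles_def by simp
qed

lemma sum_Pow_insert:
  assumes "finite E" "c \<notin> E"
  shows "(\<Sum>S\<in>Pow (insert c E). F S) = (\<Sum>S\<in>Pow E. F S + F (insert c S))"
proof -
  have "Pow (insert c E) = Pow E \<union> insert c ` Pow E" by (rule Pow_insert)
  moreover have "Pow E \<inter> insert c ` Pow E = {}" using assms(2) by auto
  moreover have "inj_on (insert c) (Pow E)" using assms(2) by (intro inj_onI) (metis PowD insert_ident subsetD)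
  ultimately show ?thesis using assms(1)
    by (simp add: sum.union_disjoint sum.reindex sum.distrib)
qed

lemma state_sum_insert:
  assumes "finite E" "c \<notin> E"
  shows "state_sum (insert c E) (g, k) w = (\<Sum>S\<in>Pow E. (\<Prod>x\<in>E. w x (x \<in> S)) *
    (w c False * loop_value ^ (k + circles (insert c E) g S - 1) +
     w c True * loop_value ^ (k + circles (insert c E) g (insert c S) - 1)))"
proof -
  have "(\<Prod>x\<in>insert c E. w x (x \<in> S)) = w c False * (\<Prod>x\<in>E. w x (x \<in> S))"
       "(\<Prod>x\<in>insert c E. w x (x \<in> insert c S)) = w c True * (\<Prod>x\<in>E. w x (x \<in> S))" if "S \<subseteq> E" for S
  proof -
    have "c \<notin> S" using assms that by auto
    moreover have "(\<Prod>x\<in>E. w x (x \<in> insert c S)) = (\<Prod>x\<in>E. w x (x \<in> S))"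
      using assms by (intro prod.cong) (auto intro!: arg_cong[of _ _ "w _"])
    ultimately show "(\<Prod>x\<in>insert c E. w x (x \<in> S)) = w c False * (\<Prod>x\<in>E. w x (x \<in> S))"
      "(\<Prod>x\<in>insert c E. w x (x \<in> insert c S)) = w c True * (\<Prod>x\<in>E. w x (x \<in> S))"
      using assms by simp_all
  qed
  note pr = this
  have "(\<Prod>x\<in>insert c E. w x (x \<in> S)) * a + (\<Prod>x\<in>insert c E. w x (x \<in> insert c S)) * b =
      (\<Prod>x\<in>E. w x (x \<in> S)) * (w c False * a + w c True * b)" if "S \<in> Pow E" for S and a b
    using that by (simp only: pr[of S] Pow_iff) (simp only: distrib_left mult.assoc mult.commute mult.left_commute)
  note eq = this
  show ?thesis
    unfolding state_sum_def prod.case sum_Pow_insert[OF assms] by (intro sum.cong refl eq)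
qed

section \<open>The skein relation and the bracket as a state sum\<close>

text \<open>The flag \<open>b\<close> says that the corners of odd index are merged, and the
  A-smoothing merges the corners of the parity of \<open>v c\<close>.\<close>

definition skein_weight :: "('c \<Rightarrow> 4) \<Rightarrow> 'c \<Rightarrow> bool \<Rightarrow> laurent" where
  "skein_weight v c b = (if b = odd4 (v c) then A_pow 1 else A_pow (- 1))"

text \<open>States are sorted by their smoothing at \<open>c\<close>; performing this smoothing
  beforehand does not change the number of circles.\<close>

lemma smoothing_state_sum:
  assumes "finite C" "pairing (C \<times> UNIV) g" "c \<in> C"
  shows "state_sum C (g, k) (skein_weight v) =
    A_pow 1 * state_sum (C - {c}) (A_smoothing v c (g, k)) (skein_weight v) +
    A_pow (- 1) * state_sum (C - {c}) (B_smoothing v c (g, k)) (skein_weight v)"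
proof -
  let ?E = "C - {c}"
  obtain gA kA where A: "A_smoothing v c (g, k) = (gA, kA)" by (metis surj_pair)
  obtain gB kB where B: "B_smoothing v c (g, k) = (gB, kB)" by (metis surj_pair)
  have C: "C = insert c ?E" using assms by auto
  have eqA: "kA + circles ?E gA S = k + circles C g (if odd4 (v c) then insert c S else S)"
   and eqB: "kB + circles ?E gB S = k + circles C g (if odd4 (v c) then S else insert c S)"
   if "S \<subseteq> ?E" for S
  proof -
    have cS: "c \<notin> S" using that by auto
    have cong: "circles ?E gA S = circles ?E gA (if odd4 (v c) then insert c S else S)"
      by (intro circles_cong) auto
    show "kA + circles ?E gA S = k + circles C g (if odd4 (v c) then insert c S else S)"
      unfolding cong
      using merge_corners_circles[OF assms, of "if odd4 (v c) then insert c S else S" "v c" k gA kA] A cS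
      by (auto simp: A_smoothing_def)
    have cong: "circles ?E gB S = circles ?E gB (if odd4 (v c) then S else insert c S)"
      by (intro circles_cong) auto
    show "kB + circles ?E gB S = k + circles C g (if odd4 (v c) then S else insert c S)"
      unfolding cong
      using merge_corners_circles[OF assms, of "if odd4 (v c) then S else insert c S" "v c + 1" k gB kB] B cS
      by (auto simp: B_smoothing_def odd4_add)
  qed
  have "state_sum C (g, k) (skein_weight v) = (\<Sum>S\<in>Pow ?E. (\<Prod>x\<in>?E. skein_weight v x (x \<in> S)) *
    (skein_weight v c False * loop_value ^ (k + circles C g S - 1) +
     skein_weight v c True * loop_value ^ (k + circles C g (insert c S) - 1)))"
    using state_sum_insert[of ?E c g k "skein_weight v"] C assms(1) by auto
  also have "\<dots> = (\<Sum>S\<in>Pow ?E. (\<Prod>x\<in>?E. skein_weight v x (x \<in> S)) *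
    (A_pow 1 * loop_value ^ (kA + circles ?E gA S - 1) +
     A_pow (- 1) * loop_value ^ (kB + circles ?E gB S - 1)))"
    by (intro sum.cong refl) (simp add: eqA eqB skein_weight_def)
  also have "\<dots> = A_pow 1 * state_sum ?E (gA, kA) (skein_weight v) + A_pow (- 1) * state_sum ?E (gB, kB) (skein_weight v)"
    unfolding state_sum_def by (simp add: sum_distrib_left sum.distrib algebra_simps)
  finally show ?thesis using A B by simp
qed

text \<open>Smoothing the last crossing leaves circles only in the counter, and a state with a
  crossing has at least one circle. So the recursion never arrives at the empty diagram, which has
  no bracket value.\<close>

lemma smoothing_pairing:
  assumes "finite C" "pairing (C \<times> UNIV) g" "c \<in> C"
    and "A_smoothing v c (g, k) = (g', k') \<or> B_smoothing v c (g, k) = (g', k')"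
  shows "pairing ((C - {c}) \<times> UNIV) g'" "C = {c} \<Longrightarrow> 0 < k'"
proof -
  obtain i where "merge_corners c i (g, k) = (g', k')"
    using assms(4) by (auto simp: A_smoothing_def B_smoothing_def)
  then have *: "pairing ((C - {c}) \<times> UNIV) g' \<and>
      k' + circles (C - {c}) g' (if odd4 i then {c} else {}) = k + circles C g (if odd4 i then {c} else {})"
    by (intro merge_corners_circles[OF assms(1-3)]) auto
  then show "pairing ((C - {c}) \<times> UNIV) g'" by simp
  assume C: "C = {c}"
  have "circles (C - {c}) g' (if odd4 i then {c} else {}) = 0"
    unfolding circles_def components_def using C by simp
  then show "0 < k'" using * circles_pos[OF assms(1), of g] C by force
qed

text \<open>Every derivation, whatever the order of its skein and circle steps, computes the state
  sum; this gives uniqueness of the bracket value.\<close>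

lemma bracket_value_state_sum:
  assumes "bracket_value v C gk p" "finite C" "pairing (C \<times> UNIV) (fst gk)"
  shows "p = state_sum C gk (skein_weight v)" "C = {} \<Longrightarrow> 0 < snd gk"
proof -
  have "p = state_sum C gk (skein_weight v) \<and> (C = {} \<longrightarrow> 0 < snd gk)"
    using assms
  proof induction
    case (circle g)
    then show ?case by (simp add: state_sum_def circles_def components_def)
  next
    case (disjoint_circle C g k p)
    \<comment> \<open>Without crossings, the induction hypothesis supplies a recorded circle. So the
      exponent really grows by one when a circle is added.\<close>
    then have "0 < k + circles C g S" for S using circles_pos[of C g S] by (cases "C = {}") auto
    then have "loop_value ^ (k + circles C g S) = loop_value * loop_value ^ (k + circles C g S - 1)" for S
      by (metis power_minus_mult mult.commute)
    then show ?case using disjoint_circle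
      by (simp add: state_sum_def sum_distrib_left algebra_simps flip: loop_value_def)
  next
    case (skein c C g k p q)
    then have "pairing ((C - {c}) \<times> UNIV) (fst (A_smoothing v c (g, k)))"
      "pairing ((C - {c}) \<times> UNIV) (fst (B_smoothing v c (g, k)))"
      using smoothing_pairing(1)[of C g c v k] by (metis fst_conv prod.collapse)+
    with skein show ?case by (auto simp: smoothing_state_sum[of C g c k v])
  qed
  then show "p = state_sum C gk (skein_weight v)" "C = {} \<Longrightarrow> 0 < snd gk" by auto
qed

lemma bracket_value_exists:
  assumes "finite C" "pairing (C \<times> UNIV) g" "C = {} \<Longrightarrow> 0 < k"
  shows "\<exists>p. bracket_value v C (g, k) p"
  using assms
proof (induction C arbitrary: g k rule: finite_psubset_induct)
  case (psubset C)
  show ?case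
  proof (cases "C = {}")
    case True
    have "\<exists>p. bracket_value v {} (g, Suc j) p" for j
      by (induction j) (use bracket_value.circle bracket_value.disjoint_circle in \<open>metis One_nat_def\<close>)+
    then show ?thesis using True psubset.prems by (metis gr0_implies_Suc)
  next
    case False
    then obtain c where c: "c \<in> C" by auto
    obtain gA kA where A: "A_smoothing v c (g, k) = (gA, kA)" by (metis surj_pair)
    obtain gB kB where B: "B_smoothing v c (g, k) = (gB, kB)" by (metis surj_pair)
    have "\<exists>p. bracket_value v (C - {c}) (gA, kA) p"
      by (rule psubset.IH) (use c smoothing_pairing[OF psubset.hyps psubset.prems(1) c] A in blast)+
    moreover have "\<exists>p. bracket_value v (C - {c}) (gB, kB) p"
      by (rule psubset.IH) (use c smoothing_pairing[OF psubset.hyps psubset.prems(1) c] B in blast)+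
    ultimately show ?thesis using bracket_value.skein[OF c] A B by metis
  qed
qed

lemma bracket_eq_state_sum:
  assumes "finite (crossings K)" "crossings K \<noteq> {}" "pairing (crossings K \<times> UNIV) (glue K)"
  shows "bracket K = state_sum (crossings K) (glue K, 0) (skein_weight (over K))"
proof -
  let ?p = "state_sum (crossings K) (glue K, 0) (skein_weight (over K))"
  have eq: "p = ?p" if "bracket_value (over K) (crossings K) (glue K, 0) p" for p
    using bracket_value_state_sum(1)[OF that] assms by simp
  obtain p where "bracket_value (over K) (crossings K) (glue K, 0) p"
    using bracket_value_exists[of "crossings K" "glue K" 0 "over K"] assms by auto
  with eq have "bracket_value (over K) (crossings K) (glue K, 0) ?p" by metis
  then show ?thesis unfolding bracket_def using eq by (rule the_equality)
qed


section \<open>State sums under bigon extensions\<close>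

text \<open>Merging the corners \<open>k\<close> and \<open>k + 2\<close> leaves arcs around the
  corners \<open>k + 1\<close> and \<open>k + 3\<close>; the companion lemma treats the other
  smoothing.\<close>

lemma partner_arith:
  assumes "b \<longleftrightarrow> odd4 k"
  shows "(if b then 1 else 3) - k = k + 3" "(if b then 1 else 3) - (k + 1) = k + 2"
    "(if b then 1 else 3) - (k + 2) = k + 1" "(if b then 1 else 3) - (k + 3) = k"
  using assms four_cases[of k 0] by (auto simp: odd4_def)

lemma partner_arith':
  assumes "b \<longleftrightarrow> \<not> odd4 k"
  shows "(if b then 1 else 3) - k = k + 1" "(if b then 1 else 3) - (k + 1) = k"
    "(if b then 1 else 3) - (k + 2) = k + 3" "(if b then 1 else 3) - (k + 3) = k + 2"
  using assms four_cases[of k 0] by (auto simp: odd4_def)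

lemma all4: "P k \<Longrightarrow> P (k + 1) \<Longrightarrow> P (k + 2) \<Longrightarrow> P (k + 3) \<Longrightarrow> P (i::4)"
  using four_cases[of i k] by auto

lemma state_partner_apply: "state_partner S (x, i) = (x, (if x \<in> S then 1 else 3) - i)"
  by (simp add: state_partner_def)

text \<open>Stated for gluings rather than universes, so that it covers the single curl from which
  the Hopf link arises. The bigon has the corners \<open>(c, k + 2)\<close> and
  \<open>(c', n)\<close>, and \<open>h\<close> gives the old darts their new names.\<close>

locale bigon_gluing =
  fixes C :: "'c set" and c c' :: 'c and g g' :: "'c dart \<Rightarrow> 'c dart" and k n :: 4
    and h :: "'c dart \<Rightarrow> 'c dart"
  assumes fin: "finite C" and c: "c \<in> C" and c': "c' \<notin> C"
    and pg: "pairing (C \<times> UNIV) g" and pg': "pairing (insert c' C \<times> UNIV) g'"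
    and h_def: "h = (\<lambda>d. if d = (c, k + 2) then (c', n + 2) else if d = (c, k + 3) then (c', n + 3) else d)"
    and g'h: "\<And>d. d \<in> C \<times> UNIV \<Longrightarrow> g' (h d) = h (g d)"
    and g'2: "g' (c, k + 2) = (c', n + 1)" and g'3: "g' (c, k + 3) = (c', n)"
begin

abbreviation "C' \<equiv> insert c' C"

text \<open>A left inverse of \<open>h\<close> that collapses each of the two segments bounding the
  bigon to one dart, \<open>u\<close> or \<open>v\<close>. These are chosen for each state, on the
  old strand to which that segment contributes.\<close>

definition pull :: "'c dart \<Rightarrow> 'c dart \<Rightarrow> 'c dart \<Rightarrow> 'c dart" where
  "pull u v d = (if d = (c, k + 2) \<or> d = (c', n + 1) then u else if d = (c, k + 3) \<or> d = (c', n) then v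
     else if d = (c', n + 2) then (c, k + 2) else if d = (c', n + 3) then (c, k + 3) else d)"

lemma neq: "c \<noteq> c'" "c' \<noteq> c" using c c' by auto

lemma pull_h: "d \<in> C \<times> UNIV \<Longrightarrow> pull u v (h d) = d"
  using neq c' by (auto simp: pull_def h_def)

lemma h_in: "d \<in> C \<times> UNIV \<Longrightarrow> h d \<in> C' \<times> UNIV"
  by (auto simp: h_def)

lemma g'_new: "g' (c', n + 1) = (c, k + 2)" "g' (c', n) = (c, k + 3)"
  using pg' g'2 g'3 c unfolding pairing_def by (metis SigmaI UNIV_I insertCI)+

lemma dart_cases:
  assumes "d \<in> C' \<times> UNIV"
  obtains e where "e \<in> C \<times> UNIV" "d = h e"
    | "d = (c, k + 2)" | "d = (c, k + 3)" | "d = (c', n)" | "d = (c', n + 1)"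
proof -
  obtain x i where d: "d = (x, i)" by (cases d)
  show thesis
  proof (cases "x = c'")
    case True
    consider "i = n" | "i = n + 1" | "i = n + 2" | "i = n + 3" using four_cases[of i n] by auto
    then show thesis
    proof cases
      case 3
      then have "d = h (c, k + 2)" using d True by (simp add: h_def)
      then show thesis using that(1)[of "(c, k + 2)"] c by simp
    next
      case 4
      then have "d = h (c, k + 3)" using d True by (simp add: h_def)
      then show thesis using that(1)[of "(c, k + 3)"] c by simp
    qed (use that d True in auto)
  next
    case False
    then have "d \<in> C \<times> UNIV" using assms d by auto
    moreover have "h d = d" if "d \<noteq> (c, k + 2)" "d \<noteq> (c, k + 3)" using that by (simp add: h_def)
    ultimately show thesis using that(1)[of d] that(2,3) by metis
  qed
qed

text \<open>Segments, and arcs away from the twist, are respected by \<open>h\<close> and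
  \<open>pull u v\<close> in every state. What remains to be checked for a state are the arcs at
  \<open>c\<close> and \<open>c'\<close> and the paths joining \<open>h u\<close> and
  \<open>h v\<close> to the bigon.\<close>

lemma count_eq:
  fixes S S' :: "'c set" and u v :: "'c dart"
  assumes S: "\<And>x. x \<in> C - {c} \<Longrightarrow> x \<in> S \<longleftrightarrow> x \<in> S'"
  defines "r \<equiv> strands g (state_partner S) (C \<times> UNIV)"
  defines "q \<equiv> strands g' (state_partner S') (C' \<times> UNIV)"
  assumes uv: "u \<in> C \<times> UNIV" "v \<in> C \<times> UNIV"
    and hc: "\<And>i. (h (c, i), h (state_partner S (c, i))) \<in> q\<^sup>*"
    and bc: "\<And>i. (pull u v (c, i), pull u v (state_partner S' (c, i))) \<in> r\<^sup>*"
    and bc': "\<And>i. (pull u v (c', i), pull u v (state_partner S' (c', i))) \<in> r\<^sup>*"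
    and hu: "(h u, (c, k + 2)) \<in> q\<^sup>*" and hv: "(h v, (c, k + 3)) \<in> q\<^sup>*"
  shows "circles C' g' S' = circles C g S"
  unfolding circles_def
proof (rule card_components_eq[where f = h and h = "pull u v"])
  show "sym (strands g' (state_partner S') (C' \<times> UNIV))" "sym (strands g (state_partner S) (C \<times> UNIV))"
    using pg pg' by (auto intro: sym_strands pairing_state_partner)
next
  fix x y assume "(x, y) \<in> strands g (state_partner S) (C \<times> UNIV)"
  then have x: "x \<in> C \<times> UNIV" and y: "y = g x \<or> y = state_partner S x" unfolding strands_def by auto
  show "(h x, h y) \<in> (strands g' (state_partner S') (C' \<times> UNIV))\<^sup>*"
  proof (cases "y = g x")
    case True
    then have "(h x, h y) \<in> q" using g'h[OF x] h_in[OF x] by (auto simp: q_def strands_def)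
    then show ?thesis unfolding q_def by auto
  next
    case F: False
    show ?thesis
    proof (cases "fst x = c")
      case True then show ?thesis using hc[of "snd x"] y F unfolding q_def by auto
    next
      case False
      then have "h x = x" "h y = y" "y = state_partner S' x"
        using y F x S[of "fst x"] by (auto simp: h_def state_partner_def split: prod.splits)
      then have "(h x, h y) \<in> q" using x by (auto simp: q_def strands_def)
      then show ?thesis unfolding q_def by auto
    qed
  qed
next
  fix x y assume "(x, y) \<in> strands g' (state_partner S') (C' \<times> UNIV)"
  then have x: "x \<in> C' \<times> UNIV" and y: "y = g' x \<or> y = state_partner S' x" unfolding strands_def by auto
  have "(pull u v x, pull u v y) \<in> r\<^sup>*"
  proof (cases "y = g' x")
    case True
    show ?thesis
    proof (cases rule: dart_cases[OF x])
      case (1 e)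
      then have "g e \<in> C \<times> UNIV" using pg unfolding pairing_def by auto
      then have "pull u v x = e" "pull u v y = g e" using 1 True g'h[of e] pull_h by auto
      then show ?thesis using 1 by (auto simp: r_def strands_def)
    qed (use True g'2 g'3 g'_new neq in \<open>auto simp: pull_def\<close>)
  next
    case F: False
    then have y: "y = state_partner S' x" using y by auto
    consider "fst x = c" | "fst x = c'" | "fst x \<noteq> c" "fst x \<noteq> c'" by auto
    then show ?thesis
    proof cases
      case 1 then show ?thesis using bc[of "snd x"] y by auto
    next
      case 2 then show ?thesis using bc'[of "snd x"] y by auto
    next
      case 3
      then have "pull u v x = x" "pull u v y = y" "y = state_partner S x" "x \<in> C \<times> UNIV"
        using y x S[of "fst x"] by (auto simp: pull_def state_partner_def split: prod.splits)
      then have "(pull u v x, pull u v y) \<in> r" by (auto simp: r_def strands_def)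
      then show ?thesis by auto
    qed
  qed
  then show "(pull u v x, pull u v y) \<in> (strands g (state_partner S) (C \<times> UNIV))\<^sup>*" unfolding r_def .
next
  fix x :: "'c dart" assume x: "x \<in> C' \<times> UNIV"
  show "pull u v x \<in> C \<times> UNIV"
    by (cases rule: dart_cases[OF x]) (use pull_h uv in \<open>auto simp: pull_def\<close>)
  have "sym q" unfolding q_def using pg' by (auto intro: sym_strands pairing_state_partner)
  have "(c, k + 2) \<in> C' \<times> UNIV" "(c, k + 3) \<in> C' \<times> UNIV" using c by auto
  then have "((c, k + 2), (c', n + 1)) \<in> q" "((c, k + 3), (c', n)) \<in> q"
    using g'2 g'3 unfolding q_def strands_def by (auto simp: prod_eq_iff)
  then have "(h u, (c', n + 1)) \<in> q\<^sup>*" "(h v, (c', n)) \<in> q\<^sup>*"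
    using hu hv by (auto intro: rtrancl_into_rtrancl)
  then have "(h (pull u v x), x) \<in> q\<^sup>*"
    by (cases rule: dart_cases[OF x]) (use hu hv pull_h neq in \<open>auto simp: pull_def\<close>)
  then show "(h (pull u v x), x) \<in> (strands g' (state_partner S') (C' \<times> UNIV))\<^sup>*" unfolding q_def .
qed (auto simp: h_in pull_h)

lemma new_edges:
  assumes "q = strands g' \<mu> (C' \<times> UNIV)"
  shows "((c, k + 2), (c', n + 1)) \<in> q\<^sup>*" "((c', n + 1), (c, k + 2)) \<in> q\<^sup>*"
    "((c, k + 3), (c', n)) \<in> q\<^sup>*" "((c', n), (c, k + 3)) \<in> q\<^sup>*"
  using strands_edge(1)[of "(c, k + 2)" "C' \<times> UNIV" g' \<mu>] strands_edge(1)[of "(c, k + 3)" "C' \<times> UNIV" g' \<mu>]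
    strands_edge(1)[of "(c', n)" "C' \<times> UNIV" g' \<mu>] strands_edge(1)[of "(c', n + 1)" "C' \<times> UNIV" g' \<mu>]
    assms c g'2 g'3 g'_new by auto

lemma h_at_c: "h (c, k) = (c, k)" "h (c, k + 1) = (c, k + 1)" "h (c, k + 2) = (c', n + 2)" "h (c, k + 3) = (c', n + 3)"
  by (auto simp: h_def)

lemma pull_at:
  "pull u v (c, k) = (c, k)" "pull u v (c, k + 1) = (c, k + 1)" "pull u v (c, k + 2) = u" "pull u v (c, k + 3) = v"
  "pull u v (c', n) = v" "pull u v (c', n + 1) = u" "pull u v (c', n + 2) = (c, k + 2)" "pull u v (c', n + 3) = (c, k + 3)"
  using neq by (auto simp: pull_def)

section \<open>Circles in the four states of a twist\<close>

text \<open>The bigon becomes a passage between the two separated corners, so the twist looks like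
  \<open>c\<close> with these corners merged.\<close>

lemma circles_both:
  assumes "\<And>x. x \<in> C - {c} \<Longrightarrow> x \<in> S \<longleftrightarrow> x \<in> S'"
    and "c \<in> S' \<longleftrightarrow> odd4 k" "c' \<in> S' \<longleftrightarrow> odd4 n" "c \<in> S \<longleftrightarrow> odd4 k"
  shows "circles C' g' S' = circles C g S"
proof -
  let ?r = "strands g (state_partner S) (C \<times> UNIV)"
  let ?q = "strands g' (state_partner S') (C' \<times> UNIV)"
  note pa = partner_arith[OF assms(2)] partner_arith[OF assms(3)] partner_arith[OF assms(4)]
  have er: "((c, i), state_partner S (c, i)) \<in> ?r\<^sup>*" for i using c by (intro strands_edge) auto
  have eq: "((c, i), state_partner S' (c, i)) \<in> ?q\<^sup>*" "((c', i), state_partner S' (c', i)) \<in> ?q\<^sup>*" for i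
    using c by (intro strands_edge; auto)+
  note E = er[unfolded state_partner_apply] eq[unfolded state_partner_apply]
  note new = new_edges[of ?q, OF refl]
  have q: "((c', n + 2), (c, k + 2)) \<in> ?q\<^sup>*" "((c, k + 2), (c', n + 2)) \<in> ?q\<^sup>*"
      "((c', n + 3), (c, k + 3)) \<in> ?q\<^sup>*" "((c, k + 3), (c', n + 3)) \<in> ?q\<^sup>*"
    using E(3)[of "n + 2"] E(3)[of "n + 1"] E(3)[of "n + 3"] E(3)[of n] new unfolding pa by (meson rtrancl_trans)+
  show ?thesis
  proof (rule count_eq[where u = "(c, k + 2)" and v = "(c, k + 3)"])
    fix i
    show "(h (c, i), h (state_partner S (c, i))) \<in> ?q\<^sup>*"
      by (rule all4[of _ k]; simp only: state_partner_apply pa h_at_c;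
        use E(2)[of k] E(2)[of "k + 1"] E(2)[of "k + 2"] E(2)[of "k + 3"] q in \<open>unfold pa, meson rtrancl_trans\<close>)
    show "(pull (c, k + 2) (c, k + 3) (c, i), pull (c, k + 2) (c, k + 3) (state_partner S' (c, i))) \<in> ?r\<^sup>*"
      by (rule all4[of _ k]; simp only: state_partner_apply pa pull_at;
        use E(1)[of k] E(1)[of "k + 1"] E(1)[of "k + 2"] E(1)[of "k + 3"] in \<open>unfold pa, blast\<close>)
    show "(pull (c, k + 2) (c, k + 3) (c', i), pull (c, k + 2) (c, k + 3) (state_partner S' (c', i))) \<in> ?r\<^sup>*"
      by (rule all4[of _ n]; simp only: state_partner_apply pa pull_at; blast)
  qed (use assms c q in \<open>auto simp: h_at_c\<close>)
qed

text \<open>The two segments of the bigon form a finger on the strand from \<open>(c, k)\<close> to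
  \<open>(c, k + 1)\<close>. Pulled straight, it leaves \<open>c\<close> with the other two corners
  merged, so both segments collapse to \<open>(c, k)\<close>.\<close>

lemma circles_first:
  assumes "\<And>x. x \<in> C - {c} \<Longrightarrow> x \<in> S \<longleftrightarrow> x \<in> S'"
    and "c \<in> S' \<longleftrightarrow> odd4 k" "c' \<in> S' \<longleftrightarrow> \<not> odd4 n" "c \<in> S \<longleftrightarrow> \<not> odd4 k"
  shows "circles C' g' S' = circles C g S"
proof -
  let ?r = "strands g (state_partner S) (C \<times> UNIV)"
  let ?q = "strands g' (state_partner S') (C' \<times> UNIV)"
  note pa = partner_arith[OF assms(2)] partner_arith'[OF assms(3)] partner_arith'[OF assms(4)]
  have er: "((c, i), state_partner S (c, i)) \<in> ?r\<^sup>*" for i using c by (intro strands_edge) auto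
  have eq: "((c, i), state_partner S' (c, i)) \<in> ?q\<^sup>*" "((c', i), state_partner S' (c', i)) \<in> ?q\<^sup>*" for i
    using c by (intro strands_edge; auto)+
  note E = er[unfolded state_partner_apply] eq[unfolded state_partner_apply]
  note new = new_edges[of ?q, OF refl]
  have q: "((c, k), (c, k + 2)) \<in> ?q\<^sup>*" "((c, k), (c, k + 3)) \<in> ?q\<^sup>*" "((c, k), (c, k + 1)) \<in> ?q\<^sup>*" "((c, k + 1), (c, k)) \<in> ?q\<^sup>*"
    using E(2)[of k] E(2)[of "k + 1"] E(2)[of "k + 2"] E(2)[of "k + 3"] E(3)[of "n + 1"] E(3)[of n] new
    unfolding pa by (meson rtrancl_trans)+
  show ?thesis
  proof (rule count_eq[where u = "(c, k)" and v = "(c, k)"])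
    fix i
    show "(h (c, i), h (state_partner S (c, i))) \<in> ?q\<^sup>*"
      by (rule all4[of _ k]; simp only: state_partner_apply pa h_at_c;
        use E(3)[of "n + 2"] E(3)[of "n + 3"] q in \<open>unfold pa, blast\<close>)
    show "(pull (c, k) (c, k) (c, i), pull (c, k) (c, k) (state_partner S' (c, i))) \<in> ?r\<^sup>*"
      by (rule all4[of _ k]; simp only: state_partner_apply pa pull_at;
        use E(1)[of k] E(1)[of "k + 1"] in \<open>unfold pa, blast\<close>)
    show "(pull (c, k) (c, k) (c', i), pull (c, k) (c, k) (state_partner S' (c', i))) \<in> ?r\<^sup>*"
      by (rule all4[of _ n]; simp only: state_partner_apply pa pull_at;
        use E(1)[of "k + 2"] E(1)[of "k + 3"] in \<open>unfold pa, blast\<close>)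
  qed (use assms c q in \<open>auto simp: h_at_c\<close>)
qed

text \<open>Mirror image of the preceding case: the finger hangs on the strand between the two ends
  that moved to \<open>c'\<close>.\<close>

lemma circles_second:
  assumes "\<And>x. x \<in> C - {c} \<Longrightarrow> x \<in> S \<longleftrightarrow> x \<in> S'"
    and "c \<in> S' \<longleftrightarrow> \<not> odd4 k" "c' \<in> S' \<longleftrightarrow> odd4 n" "c \<in> S \<longleftrightarrow> \<not> odd4 k"
  shows "circles C' g' S' = circles C g S"
proof -
  let ?r = "strands g (state_partner S) (C \<times> UNIV)"
  let ?q = "strands g' (state_partner S') (C' \<times> UNIV)"
  note pa = partner_arith'[OF assms(2)] partner_arith[OF assms(3)] partner_arith'[OF assms(4)]
  have er: "((c, i), state_partner S (c, i)) \<in> ?r\<^sup>*" for i using c by (intro strands_edge) auto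
  have eq: "((c, i), state_partner S' (c, i)) \<in> ?q\<^sup>*" "((c', i), state_partner S' (c', i)) \<in> ?q\<^sup>*" for i
    using c by (intro strands_edge; auto)+
  note E = er[unfolded state_partner_apply] eq[unfolded state_partner_apply]
  note new = new_edges[of ?q, OF refl]
  have q: "((c', n + 2), (c, k + 2)) \<in> ?q\<^sup>*" "((c', n + 2), (c, k + 3)) \<in> ?q\<^sup>*"
     "((c', n + 2), (c', n + 3)) \<in> ?q\<^sup>*" "((c', n + 3), (c', n + 2)) \<in> ?q\<^sup>*"
    using E(2)[of "k + 2"] E(2)[of "k + 3"] E(3)[of "n + 1"] E(3)[of n] E(3)[of "n + 2"] E(3)[of "n + 3"] new
    unfolding pa by (meson rtrancl_trans)+
  show ?thesis
  proof (rule count_eq[where u = "(c, k + 2)" and v = "(c, k + 2)"])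
    fix i
    show "(h (c, i), h (state_partner S (c, i))) \<in> ?q\<^sup>*"
      by (rule all4[of _ k]; simp only: state_partner_apply pa h_at_c;
        use E(2)[of "k"] E(2)[of "k + 1"] q in \<open>unfold pa, blast\<close>)
    show "(pull (c, k + 2) (c, k + 2) (c, i), pull (c, k + 2) (c, k + 2) (state_partner S' (c, i))) \<in> ?r\<^sup>*"
      by (rule all4[of _ k]; simp only: state_partner_apply pa pull_at;
        use E(1)[of k] E(1)[of "k + 1"] in \<open>unfold pa, blast\<close>)
    show "(pull (c, k + 2) (c, k + 2) (c', i), pull (c, k + 2) (c, k + 2) (state_partner S' (c', i))) \<in> ?r\<^sup>*"
      by (rule all4[of _ n]; simp only: state_partner_apply pa pull_at;
        use E(1)[of "k + 2"] E(1)[of "k + 3"] in \<open>unfold pa, blast\<close>)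
  qed (use assms c q in \<open>auto simp: h_at_c\<close>)
qed

text \<open>The arcs on both sides close the bigon off as a circle through the four darts of its two
  segments. The remaining darts form a copy, under \<open>h\<close>, of the old state.\<close>

lemma circles_neither:
  assumes S: "\<And>x. x \<in> C - {c} \<Longrightarrow> x \<in> S \<longleftrightarrow> x \<in> S'"
    and "c \<in> S' \<longleftrightarrow> \<not> odd4 k" "c' \<in> S' \<longleftrightarrow> \<not> odd4 n" "c \<in> S \<longleftrightarrow> \<not> odd4 k"
  shows "circles C' g' S' = Suc (circles C g S)"
proof -
  note pa = partner_arith'[OF assms(2)] partner_arith'[OF assms(3)] partner_arith'[OF assms(4)]
  let ?A = "C \<times> (UNIV :: 4 set)"
  let ?A' = "C' \<times> (UNIV :: 4 set)"
  let ?B = "{(c, k + 2), (c, k + 3), (c', n), (c', n + 1)}"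
  let ?p = "state_partner S" and ?p' = "state_partner S'"
  note p' = pairing_state_partner[of C' S'] and p = pairing_state_partner[of C S]
  have pB: "?p' (c, k + 2) = (c, k + 3)" "?p' (c, k + 3) = (c, k + 2)" "?p' (c', n) = (c', n + 1)" "?p' (c', n + 1) = (c', n)"
    unfolding state_partner_apply pa by auto
  have B: "?B \<subseteq> ?A'" using c by auto
  have closed: "x \<in> ?B \<Longrightarrow> g' x \<in> ?B" "x \<in> ?B \<Longrightarrow> ?p' x \<in> ?B" for x
    using g'2 g'3 g'_new pB by auto
  have conn: "((c, k + 2), y) \<in> (strands g' ?p' ?B)\<^sup>*" if "y \<in> ?B" for y
    using that strands_edge(1)[of "(c, k + 2)" ?B g' ?p'] strands_edge(2)[of "(c, k + 2)" ?B ?p' g']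
      strands_edge(1)[of "(c, k + 3)" ?B g' ?p'] unfolding g'2 g'3 pB
    by (auto intro: rtrancl_trans)
  have split: "circles C' g' S' = Suc (card (components (strands g' ?p' (?A' - ?B)) (?A' - ?B)))"
    unfolding circles_def
    by (rule card_components_split[of ?A' ?B "(c, k + 2)" g' ?p']) (use fin pg' p' closed conn B in auto)
  have hA: "h d \<in> ?A' - ?B" if "d \<in> ?A" for d
    using that c' neq by (auto simp: h_def)
  have inv: "\<exists>e\<in>?A. d = h e" if "d \<in> ?A' - ?B" for d
  proof -
    from that have d: "d \<in> ?A'" by auto
    show ?thesis by (cases rule: dart_cases[OF d]) (use that in auto)
  qed
  define f where "f = pull (c, k) (c, k)"
  have hp: "?p' (h d) = h (?p d)" if "d \<in> ?A" for d
  proof (cases "fst d = c")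
    case True
    then obtain i where d: "d = (c, i)" by (cases d) auto
    show ?thesis unfolding d
      by (rule all4[of _ k]; simp only: h_at_c state_partner_apply pa)
  next
    case False
    obtain x i where d: "d = (x, i)" by (cases d)
    have x: "x \<noteq> c" "x \<in> S \<longleftrightarrow> x \<in> S'" using S[of x] that False d by auto
    have "h (x, j) = (x, j)" for j using x(1) by (simp add: h_def)
    then show ?thesis unfolding d using x(2) by (simp add: state_partner_apply)
  qed
  have pc: "g d \<in> ?A" "?p d \<in> ?A" if "d \<in> ?A" for d using that pg p unfolding pairing_def by auto
  have "card (components (strands g' ?p' (?A' - ?B)) (?A' - ?B)) = circles C g S"
    unfolding circles_def
  proof (rule card_components_eq[where f = h and h = f])
    show "sym (strands g' ?p' (?A' - ?B))" "sym (strands g ?p ?A)"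
      using sym_strands[OF pairing_diff[OF pg' B closed(1)] pairing_diff[OF p' B closed(2)]] sym_strands[OF pg p]
      by simp_all
  next
    fix x y assume "(x, y) \<in> strands g ?p ?A"
    then have x: "x \<in> ?A" "y = g x \<or> y = ?p x" unfolding strands_def by auto
    then have "h y = g' (h x) \<or> h y = ?p' (h x)" using hp[OF x(1)] g'h[OF x(1)] by metis
    then show "(h x, h y) \<in> (strands g' ?p' (?A' - ?B))\<^sup>*" using strands_edge[OF hA[OF x(1)]] by metis
  next
    fix x y assume "(x, y) \<in> strands g' ?p' (?A' - ?B)"
    then have x: "x \<in> ?A' - ?B" "y = g' x \<or> y = ?p' x" unfolding strands_def by auto
    obtain e where e: "e \<in> ?A" "x = h e" using inv[OF x(1)] by auto
    have "y = h (g e) \<or> y = h (?p e)" using x(2) e(2) hp[OF e(1)] g'h[OF e(1)] by metis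
    then have "f y = g e \<or> f y = ?p e" "f x = e"
      using e(2) pull_h[OF pc(1)[OF e(1)]] pull_h[OF pc(2)[OF e(1)]] pull_h[OF e(1)] unfolding f_def by metis+
    then show "(f x, f y) \<in> (strands g ?p ?A)\<^sup>*" using strands_edge[OF e(1)] by metis
  next
    fix y assume "y \<in> ?A' - ?B"
    from inv[OF this] obtain e where "e \<in> ?A" "y = h e" by blast
    then show "f y \<in> ?A" "(h (f y), y) \<in> (strands g' ?p' (?A' - ?B))\<^sup>*"
      using pull_h[of e] unfolding f_def by simp_all
  next
    fix x assume x: "x \<in> ?A"
    show "h x \<in> ?A' - ?B" using hA[OF x] .
    show "(f (h x), x) \<in> (strands g ?p ?A)\<^sup>*" using pull_h[OF x] unfolding f_def by simp
  qed
  then show ?thesis using split by simp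
qed

text \<open>A twist of two crossings acts like a single crossing with these weights.\<close>

definition merged_weight :: "('c \<Rightarrow> bool \<Rightarrow> laurent) \<Rightarrow> 'c \<Rightarrow> bool \<Rightarrow> laurent" where
  "merged_weight w = (\<lambda>x b. if x \<noteq> c then w x b
     else if b = odd4 k then w c (odd4 k) * w c' (odd4 n)
     else w c (odd4 k) * w c' (\<not> odd4 n) + w c (\<not> odd4 k) * w c' (odd4 n) +
       loop_value * w c (\<not> odd4 k) * w c' (\<not> odd4 n))"

text \<open>The four smoothings of the twist are sorted by the smoothing of \<open>c\<close> that
  they amount to; three of them amount to the same one, and one of these carries an extra
  circle.\<close>

lemma state_sum_bigon: "state_sum C' (g', 0) w = state_sum C (g, 0) (merged_weight w)"
proof -
  let ?E = "C - {c}"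
  let ?W = "merged_weight w"
  have C: "C = insert c ?E" using c by auto
  have E: "finite ?E" "c \<notin> ?E" using fin by auto
  have sumC: "(\<Sum>S\<in>Pow C. F S) = (\<Sum>S\<in>Pow ?E. F S + F (insert c S))" for F :: "'c set \<Rightarrow> laurent"
    using sum_Pow_insert[OF E] C by simp
  have prodC: "(\<Prod>x\<in>C. f x) = f c * (\<Prod>x\<in>?E. f x)" for f :: "'c \<Rightarrow> laurent"
    using fin c by (rule prod.remove)
  let ?P = "\<lambda>S. \<Prod>x\<in>?E. w x (x \<in> S)"
  have wE: "(\<Prod>x\<in>?E. w x (x \<in> insert c S)) = ?P S" "(\<Prod>x\<in>?E. w x (x \<in> insert c' S)) = ?P S"
    "(\<Prod>x\<in>?E. ?W x (x \<in> S)) = ?P S" "c \<notin> S" "c' \<notin> S" if "S \<subseteq> ?E" for S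
    using that c' by (auto simp: merged_weight_def intro!: prod.cong arg_cong[of _ _ "w _"])
  have "state_sum C' (g', 0) w = (\<Sum>S\<in>Pow C. (\<Prod>x\<in>C. w x (x \<in> S)) *
    (w c' False * loop_value ^ (circles C' g' S - 1) +
     w c' True * loop_value ^ (circles C' g' (insert c' S) - 1)))"
    using state_sum_insert[OF fin c', of g' 0 w] by simp
  also have "\<dots> = (\<Sum>S\<in>Pow ?E. ?P S *
     (w c False * w c' False * loop_value ^ (circles C' g' S - 1) +
      w c False * w c' True * loop_value ^ (circles C' g' (insert c' S) - 1) +
      w c True * w c' False * loop_value ^ (circles C' g' (insert c S) - 1) +
      w c True * w c' True * loop_value ^ (circles C' g' (insert c' (insert c S)) - 1)))"
    unfolding sumC prodC by (intro sum.cong refl) (simp add: wE algebra_simps)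
  also have "\<dots> = (\<Sum>S\<in>Pow ?E. ?P S *
     (?W c False * loop_value ^ (circles C g S - 1) + ?W c True * loop_value ^ (circles C g (insert c S) - 1)))"
  proof (intro sum.cong refl arg_cong2[where f = times])
    fix S assume "S \<in> Pow ?E"
    then have S: "c \<notin> S" "c' \<notin> S" using c' by auto
    have pos: "0 < circles C g T" for T using circles_pos[OF fin] c by auto
    have pow: "loop_value ^ (Suc (circles C g T) - 1) = loop_value * loop_value ^ (circles C g T - 1)" for T
      using pos[of T] by (metis One_nat_def diff_Suc_1 power_minus_mult mult.commute)
    show "w c False * w c' False * loop_value ^ (circles C' g' S - 1) +
      w c False * w c' True * loop_value ^ (circles C' g' (insert c' S) - 1) +
      w c True * w c' False * loop_value ^ (circles C' g' (insert c S) - 1) +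
      w c True * w c' True * loop_value ^ (circles C' g' (insert c' (insert c S)) - 1) =
      ?W c False * loop_value ^ (circles C g S - 1) + ?W c True * loop_value ^ (circles C g (insert c S) - 1)"
    \<comment> \<open>Membership of \<open>c\<close> and \<open>c'\<close> in a state records
      absolute parities, so the parities of \<open>k\<close> and \<open>n\<close> decide which
      counting lemma applies to which of the four sets.\<close>
    proof (cases "odd4 k"; cases "odd4 n")
      assume o: "odd4 k" "odd4 n"
      have "circles C' g' S = Suc (circles C g S)" by (rule circles_neither) (use S o neq c' in auto)
      moreover have "circles C' g' (insert c' S) = circles C g S" by (rule circles_second) (use S o neq c' in auto)
      moreover have "circles C' g' (insert c S) = circles C g S" by (rule circles_first) (use S o neq c' in auto)
      moreover have "circles C' g' (insert c' (insert c S)) = circles C g (insert c S)" by (rule circles_both) (use S o c' in auto)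
      ultimately show ?thesis using o pow by (simp add: merged_weight_def algebra_simps)
    next
      assume o: "odd4 k" "\<not> odd4 n"
      have "circles C' g' S = circles C g S" by (rule circles_second) (use S o neq c' in auto)
      moreover have "circles C' g' (insert c' S) = Suc (circles C g S)" by (rule circles_neither) (use S o neq c' in auto)
      moreover have "circles C' g' (insert c S) = circles C g (insert c S)" by (rule circles_both) (use S o neq c' in auto)
      moreover have "circles C' g' (insert c' (insert c S)) = circles C g S" by (rule circles_first) (use S o c' in auto)
      ultimately show ?thesis using o pow by (simp add: merged_weight_def algebra_simps)
    next
      assume o: "\<not> odd4 k" "odd4 n"
      have "circles C' g' S = circles C g (insert c S)" by (rule circles_first) (use S o neq c' in auto)
      moreover have "circles C' g' (insert c' S) = circles C g S" by (rule circles_both) (use S o neq c' in auto)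
      moreover have "circles C' g' (insert c S) = Suc (circles C g (insert c S))" by (rule circles_neither) (use S o neq c' in auto)
      moreover have "circles C' g' (insert c' (insert c S)) = circles C g (insert c S)" by (rule circles_second) (use S o c' in auto)
      ultimately show ?thesis using o pow by (simp add: merged_weight_def algebra_simps)
    next
      assume o: "\<not> odd4 k" "\<not> odd4 n"
      have "circles C' g' S = circles C g S" by (rule circles_both) (use S o neq c' in auto)
      moreover have "circles C' g' (insert c' S) = circles C g (insert c S)" by (rule circles_first) (use S o neq c' in auto)
      moreover have "circles C' g' (insert c S) = circles C g (insert c S)" by (rule circles_second) (use S o neq c' in auto)
      moreover have "circles C' g' (insert c' (insert c S)) = Suc (circles C g (insert c S))" by (rule circles_neither) (use S o c' in auto)
      ultimately show ?thesis using o pow by (simp add: merged_weight_def algebra_simps)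
    qed
  qed
  also have "\<dots> = state_sum (insert c ?E) (g, 0) ?W"
    using state_sum_insert[OF E, of g 0 ?W] C by (simp add: wE)
  finally show ?thesis using C by simp
qed

end


section \<open>Matchings and activities of coloured incidence structures\<close>

text \<open>A matching becomes a bijection from crossings to regions, unique as a function by
  extensionality. In a plain incidence structure neither colour is distinguished, so bigon
  extensions of both types are a single case.\<close>

definition matchings :: "'c set \<Rightarrow> 'r set \<Rightarrow> ('c \<Rightarrow> 'r \<Rightarrow> bool) \<Rightarrow> ('c \<Rightarrow> 'r) set" where
  "matchings C X I = {f \<in> extensional C. bij_betw f C X \<and> (\<forall>c\<in>C. I c (f c))}"

definition ends :: "('c \<Rightarrow> 'r \<Rightarrow> bool) \<Rightarrow> 'r set \<Rightarrow> 'c \<Rightarrow> 'r set" where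
  "ends I V c = {R \<in> V. I c R}"

definition joined :: "('c \<Rightarrow> 'r \<Rightarrow> bool) \<Rightarrow> 'r set \<Rightarrow> 'c set \<Rightarrow> 'r rel" where
  "joined I V T = {(Q, R). \<exists>c\<in>T. ends I V c = {Q, R}}\<^sup>*"

text \<open>The edge of \<open>c\<close> has its ends in different components of the graph
  \<open>T\<close>. For \<open>T\<close> equal to a tree minus one edge, this is membership in a
  fundamental cocycle.\<close>

definition separated :: "('c \<Rightarrow> 'r \<Rightarrow> bool) \<Rightarrow> 'r set \<Rightarrow> 'c set \<Rightarrow> 'c \<Rightarrow> bool" where
  "separated I V T c \<longleftrightarrow> (\<exists>Q R. ends I V c = {Q, R} \<and> (Q, R) \<notin> joined I V T)"

definition active :: "'c set \<Rightarrow> ('c \<Rightarrow> 'r \<Rightarrow> bool) \<Rightarrow> ('c \<Rightarrow> nat) \<Rightarrow> 'r set \<Rightarrow> 'c set \<Rightarrow> 'c \<Rightarrow> bool" where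
  "active C I l V T c \<longleftrightarrow> (\<forall>c'\<in>C. separated I V (T - {c}) c' \<longrightarrow> l c \<le> l c')"

definition lowest :: "'c set \<Rightarrow> ('c \<Rightarrow> 'r \<Rightarrow> bool) \<Rightarrow> ('c \<Rightarrow> nat) \<Rightarrow> 'c \<Rightarrow> 'r \<Rightarrow> bool" where
  "lowest C I l c R \<longleftrightarrow> (\<forall>c'\<in>C. I c' R \<longrightarrow> l c \<le> l c')"

definition colour_class :: "'r set \<Rightarrow> ('r \<Rightarrow> bool) \<Rightarrow> bool \<Rightarrow> 'r set" where
  "colour_class N q b = {R \<in> N. q R = b}"

definition tree_part :: "'c set \<Rightarrow> ('r \<Rightarrow> bool) \<Rightarrow> ('c \<Rightarrow> 'r) \<Rightarrow> bool \<Rightarrow> 'c set" where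
  "tree_part C q f b = {c \<in> C. q (f c) = b}"

definition spanning :: "('c \<Rightarrow> 'r \<Rightarrow> bool) \<Rightarrow> 'r set \<Rightarrow> 'c set \<Rightarrow> bool" where
  "spanning I V T \<longleftrightarrow> (\<forall>Q\<in>V. \<forall>R\<in>V. (Q, R) \<in> joined I V T)"

definition active_at :: "'c set \<Rightarrow> 'r set \<Rightarrow> ('c \<Rightarrow> 'r \<Rightarrow> bool) \<Rightarrow> ('r \<Rightarrow> bool) \<Rightarrow> ('c \<Rightarrow> nat) \<Rightarrow> ('c \<Rightarrow> 'r) \<Rightarrow> 'c \<Rightarrow> bool" where
  "active_at C N I q l f c = active C I l (colour_class N q (q (f c))) (tree_part C q f (q (f c))) c"

text \<open>The combinatorial half of the induction invariant. Spanning, together with the clause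
  that every edge lies in its own cocycle, says that both parts are trees; this is carried along
  rather than derived from planarity. The last clause supplies the matchings of both colours with
  which activities at a bigon are compared.\<close>

definition coherent :: "'c set \<Rightarrow> 'r set \<Rightarrow> 'r set \<Rightarrow> ('c \<Rightarrow> 'r \<Rightarrow> bool) \<Rightarrow> ('r \<Rightarrow> bool) \<Rightarrow> ('c \<Rightarrow> nat) \<Rightarrow> bool" where
  "coherent C N X I q l \<longleftrightarrow>
     (\<forall>f\<in>matchings C X I.
        (\<forall>b. spanning I (colour_class N q b) (tree_part C q f b)) \<and>
        (\<forall>c\<in>C. separated I (colour_class N q (q (f c))) (tree_part C q f (q (f c)) - {c}) c) \<and>
        (\<forall>c\<in>C. active_at C N I q l f c \<longleftrightarrow> lowest C I l c (f c))) \<and>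
     (\<forall>c\<in>C. \<forall>b. \<exists>f\<in>matchings C X I. q (f c) = b)"

text \<open>\<open>m b c\<close> is the weight of merging the two corners of colour \<open>b\<close>
  at \<open>c\<close>.\<close>

definition half_edge_weight :: "'c set \<Rightarrow> ('c \<Rightarrow> 'r \<Rightarrow> bool) \<Rightarrow> ('r \<Rightarrow> bool) \<Rightarrow> ('c \<Rightarrow> nat) \<Rightarrow>
    (bool \<Rightarrow> 'c \<Rightarrow> laurent) \<Rightarrow> 'c \<Rightarrow> 'r \<Rightarrow> laurent" where
  "half_edge_weight C I q l m c R = m (q R) c + (if lowest C I l c R then loop_value * m (\<not> q R) c else 0)"

definition matching_sum :: "'c set \<Rightarrow> 'r set \<Rightarrow> ('c \<Rightarrow> 'r \<Rightarrow> bool) \<Rightarrow> ('r \<Rightarrow> bool) \<Rightarrow> ('c \<Rightarrow> nat) \<Rightarrow>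
    (bool \<Rightarrow> 'c \<Rightarrow> laurent) \<Rightarrow> laurent" where
  "matching_sum C X I q l m = (\<Sum>f\<in>matchings C X I. \<Prod>c\<in>C. half_edge_weight C I q l m c (f c))"

section \<open>Connectivity by a set of edges\<close>

lemma joined_refl: "(R, R) \<in> joined I V T"
  unfolding joined_def by simp

lemma joined_edge: "c \<in> T \<Longrightarrow> ends I V c = {Q, R} \<Longrightarrow> (Q, R) \<in> joined I V T"
  unfolding joined_def by (rule r_into_rtrancl) auto

lemma joined_trans: "(P, Q) \<in> joined I V T \<Longrightarrow> (Q, R) \<in> joined I V T \<Longrightarrow> (P, R) \<in> joined I V T"
  unfolding joined_def by (rule rtrancl_trans)

lemma joined_sym:
  assumes "(Q, R) \<in> joined I V T"
  shows "(R, Q) \<in> joined I V T"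
proof -
  have "sym {(Q, R). \<exists>c\<in>T. ends I V c = {Q, R}}"
    unfolding sym_def by (auto simp: insert_commute)
  then show ?thesis using assms unfolding joined_def by (meson sym_rtrancl symD)
qed

lemma joined_map:
  assumes "\<And>c Q R. c \<in> T \<Longrightarrow> ends I V c = {Q, R} \<Longrightarrow> (f Q, f R) \<in> joined I' V' T'"
    and "(Q, R) \<in> joined I V T"
  shows "(f Q, f R) \<in> joined I' V' T'"
  using assms(2) unfolding joined_def
  by (rule rtrancl_map[rotated]) (use assms(1) in \<open>auto simp: joined_def\<close>)

lemma separated_iff:
  assumes "ends I V c = {Q, R}"
  shows "separated I V T c \<longleftrightarrow> (Q, R) \<notin> joined I V T"
  using assms joined_sym[of _ _ I V T] unfolding separated_def by (auto simp: doubleton_eq_iff)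

lemma not_separated: "c \<in> T \<Longrightarrow> \<not> separated I V T c"
  unfolding separated_def using joined_edge by fast

lemma spanning_not_separated: "spanning I V T \<Longrightarrow> \<not> separated I V T c"
  unfolding spanning_def separated_def ends_def by blast

text \<open>
  A crossing \<open>c0\<close> with corner regions \<open>P, S1, Q, S2\<close> in cyclic order is split into \<open>c1\<close>, incident to
  \<open>P\<close>, and \<open>c2\<close>, incident to \<open>Q\<close>, with the bigon \<open>B\<close> in between; \<open>\<phi>\<close> maps the old regions to the new
  ones. The set \<open>X\<close> consists of the regions that are to be matched.
\<close>

locale crossing_split =
  fixes E :: "'c set" and c0 c1 c2 :: 'c and N X :: "'r set" and I q and l :: "'c \<Rightarrow> nat"
    and C' :: "'c set" and N' X' :: "'s set" and I' q' and l' :: "'c \<Rightarrow> nat"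
    and \<phi> :: "'r \<Rightarrow> 's" and B :: 's and P Q S1 S2 :: 'r and \<beta> :: bool
  assumes E: "finite E" "c0 \<notin> E" "c1 \<notin> E" "c2 \<notin> E" "c1 \<noteq> c2" "C' = insert c1 (insert c2 E)"
    and N': "N' = insert B (\<phi> ` N)" and inj: "inj_on \<phi> N" and B: "B \<notin> \<phi> ` N"
    and X: "X \<subseteq> N" "X' = insert B (\<phi> ` X)"
    and IE: "\<And>x R. x \<in> E \<Longrightarrow> R \<in> N \<Longrightarrow> I' x (\<phi> R) \<longleftrightarrow> I x R" "\<And>x. x \<in> E \<Longrightarrow> \<not> I' x B"
    and IB: "I' c1 B" "I' c2 B"
    and I0: "\<And>R. R \<in> N \<Longrightarrow> I c0 R \<longleftrightarrow> R \<in> {P, Q, S1, S2}"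
    and I1: "\<And>R. R \<in> N \<Longrightarrow> I' c1 (\<phi> R) \<longleftrightarrow> R \<in> {P, S1, S2}"
    and I2: "\<And>R. R \<in> N \<Longrightarrow> I' c2 (\<phi> R) \<longleftrightarrow> R \<in> {Q, S1, S2}"
    and PQ: "P \<in> N" "Q \<in> N" "P \<noteq> Q" "q P = \<beta>" "q Q = \<beta>"
    and S: "S1 \<in> N" "S2 \<in> N" "q S1 = (\<not> \<beta>)" "q S2 = (\<not> \<beta>)"
    and q': "\<And>R. R \<in> N \<Longrightarrow> q' (\<phi> R) = q R" "q' B = \<beta>"
    and lE: "\<And>x y. x \<in> E \<Longrightarrow> y \<in> E \<Longrightarrow> l' x \<le> l' y \<longleftrightarrow> l x \<le> l y"
    and l1: "\<And>x. x \<in> E \<Longrightarrow> l' x \<le> l' c1 \<longleftrightarrow> l x \<le> l c0" "\<And>x. x \<in> E \<Longrightarrow> l' c1 \<le> l' x \<longleftrightarrow> l c0 \<le> l x"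
    and l2: "\<And>x. x \<in> E \<Longrightarrow> l' x \<le> l' c2 \<longleftrightarrow> l x \<le> l c0" "\<And>x. x \<in> E \<Longrightarrow> l' c2 \<le> l' x \<longleftrightarrow> l c0 \<le> l x"
    and l12: "l' c1 \<noteq> l' c2"
begin

text \<open>Reading the twist from its other end exchanges \<open>c1\<close> with \<open>c2\<close>
  and \<open>P\<close> with \<open>Q\<close>. Facts about one end thus yield those about the other
  by interpretation.\<close>

lemma swap: "crossing_split E c0 c2 c1 N X I q l C' N' X' I' q' l' \<phi> B Q P S1 S2 \<beta>"
  by unfold_locales (auto simp: E N' inj B X IE IB I0 I1 I2 PQ S q' lE l1 l2
    E(5)[symmetric] PQ(3)[symmetric] l12[symmetric] dest: subsetD[OF X(1)])

abbreviation "C \<equiv> insert c0 E"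
abbreviation "V \<equiv> colour_class N q"
abbreviation "V' \<equiv> colour_class N' q'"

section \<open>Connectivity after splitting a crossing\<close>

lemma V': "V' b = (if b = \<beta> then insert B (\<phi> ` V b) else \<phi> ` V b)"
  unfolding colour_class_def N' by (auto simp: q')

lemma ends_E:
  assumes "x \<in> E"
  shows "ends I' (V' b) x = \<phi> ` ends I (V b) x"
proof -
  have "I' x (\<phi> R) \<longleftrightarrow> I x R" if "R \<in> V b" for R using IE(1)[OF assms] that by (simp add: colour_class_def)
  then show ?thesis using IE(2)[OF assms] unfolding V' ends_def by auto
qed

lemma ends_0: "ends I (V \<beta>) c0 = {P, Q}" "ends I (V (\<not> \<beta>)) c0 = {S1, S2}"
  by (auto simp: ends_def colour_class_def I0 PQ S)

lemma ends_1: "ends I' (V' \<beta>) c1 = {\<phi> P, B}" "ends I' (V' (\<not> \<beta>)) c1 = {\<phi> S1, \<phi> S2}"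
  unfolding ends_def V' by (auto simp: colour_class_def I1 IB PQ S)

lemma ends_2: "ends I' (V' \<beta>) c2 = {B, \<phi> Q}" "ends I' (V' (\<not> \<beta>)) c2 = {\<phi> S1, \<phi> S2}"
  unfolding ends_def V' by (auto simp: colour_class_def I2 IB PQ S)

text \<open>A left inverse of \<open>\<phi>\<close> that collapses the bigon to a region
  \<open>Z\<close>, to be taken as one of the ends \<open>P\<close>, \<open>Q\<close> of the split
  edge.\<close>

definition \<psi> :: "'r \<Rightarrow> 's \<Rightarrow> 'r" where
  "\<psi> Z R = (if R = B then Z else the_inv_into N \<phi> R)"

lemma \<psi>: "R \<in> N \<Longrightarrow> \<psi> Z (\<phi> R) = R" "\<psi> Z B = Z"
  unfolding \<psi>_def using B the_inv_into_f_f[OF inj] by auto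

text \<open>In the graph of colour \<open>\<beta>\<close> the edge of \<open>c0\<close> is
  subdivided at the bigon; in the other graph it is doubled. A step along it becomes a path through
  \<open>B\<close>, or a step along either of two parallel edges.\<close>

lemma joined_lift:
  assumes "T \<subseteq> C" "T \<inter> E \<subseteq> T'"
    and c0: "c0 \<in> T \<Longrightarrow> if b = \<beta> then c1 \<in> T' \<and> c2 \<in> T' else c1 \<in> T' \<or> c2 \<in> T'"
    and "(R, R') \<in> joined I (V b) T"
  shows "(\<phi> R, \<phi> R') \<in> joined I' (V' b) T'"
proof (rule joined_map[OF _ assms(4)])
  fix x Y Z assume x: "x \<in> T" and e: "ends I (V b) x = {Y, Z}"
  show "(\<phi> Y, \<phi> Z) \<in> joined I' (V' b) T'"
  proof (cases "x = c0")
    case False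
    then have xE: "x \<in> E" using x assms(1) by auto
    then have "ends I' (V' b) x = {\<phi> Y, \<phi> Z}" using ends_E[OF xE, of b] e by simp
    then show ?thesis using joined_edge[of x T' I' "V' b"] x xE assms(2) by blast
  next
    case True
    show ?thesis
    proof (cases "b = \<beta>")
      case b: True
      then have "(\<phi> P, B) \<in> joined I' (V' b) T'" "(B, \<phi> Q) \<in> joined I' (V' b) T'"
        using c0 x True joined_edge[OF _ ends_1(1)] joined_edge[OF _ ends_2(1)] by auto
      then have j: "(\<phi> P, \<phi> Q) \<in> joined I' (V' b) T'" by (rule joined_trans)
      have "{Y, Z} = {P, Q}" using e True b ends_0 by simp
      then show ?thesis using j joined_sym[OF j] by (auto simp: doubleton_eq_iff)
    next
      case b: False
      then have b': "b = (\<not> \<beta>)" by auto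
      then have j: "(\<phi> S1, \<phi> S2) \<in> joined I' (V' b) T'"
        using c0 x True b joined_edge[OF _ ends_1(2)] joined_edge[OF _ ends_2(2)] by auto
      have "{Y, Z} = {S1, S2}" using e True b' ends_0 by simp
      then show ?thesis using j joined_sym[OF j] by (auto simp: doubleton_eq_iff)
    qed
  qed
qed

text \<open>After \<open>B\<close> is collapsed to \<open>Z\<close>, the halves of the subdivided
  edge join \<open>P\<close> to \<open>Z\<close> and \<open>Z\<close> to \<open>Q\<close>, and each
  of the parallel edges joins \<open>S1\<close> to \<open>S2\<close>. These are the only steps that
  need a substitute in the old graph.\<close>

lemma joined_drop:
  assumes "T' \<subseteq> C'" "T' \<inter> E \<subseteq> T"
    and c1: "c1 \<in> T' \<Longrightarrow> if b = \<beta> then (P, Z) \<in> joined I (V b) T else (S1, S2) \<in> joined I (V b) T"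
    and c2: "c2 \<in> T' \<Longrightarrow> if b = \<beta> then (Z, Q) \<in> joined I (V b) T else (S1, S2) \<in> joined I (V b) T"
    and "(R, R') \<in> joined I' (V' b) T'"
  shows "(\<psi> Z R, \<psi> Z R') \<in> joined I (V b) T"
proof (rule joined_map[OF _ assms(5)])
  fix x Y W assume x: "x \<in> T'" and e: "ends I' (V' b) x = {Y, W}"
  have pairs: "(\<psi> Z Y, \<psi> Z W) \<in> joined I (V b) T"
    if "{Y, W} = {Y', W'}" "(\<psi> Z Y', \<psi> Z W') \<in> joined I (V b) T" for Y' W'
    using that joined_sym[OF that(2)] by (auto simp: doubleton_eq_iff)
  consider "x \<in> E" | "x = c1" | "x = c2" using x assms(1) E by auto
  then show "(\<psi> Z Y, \<psi> Z W) \<in> joined I (V b) T"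
  proof cases
    case 1
    have "\<psi> Z ` {Y, W} = \<psi> Z ` \<phi> ` ends I (V b) x" using e ends_E[OF 1] by simp
    also have "\<dots> = ends I (V b) x"
      using \<psi>(1) unfolding image_image ends_def colour_class_def by (auto simp: image_iff)
    finally have "ends I (V b) x = {\<psi> Z Y, \<psi> Z W}" by simp
    then show ?thesis using joined_edge[of x T I "V b"] 1 x assms(2) by blast
  next
    case 2
    show ?thesis
    proof (cases "b = \<beta>")
      case True
      then show ?thesis using pairs[of "\<phi> P" B] c1 2 x e ends_1(1) \<psi> PQ by auto
    next
      case False
      then have "b = (\<not> \<beta>)" by auto
      then show ?thesis using pairs[of "\<phi> S1" "\<phi> S2"] c1 2 x e ends_1(2) \<psi> S by auto
    qed
  next
    case 3
    show ?thesis
    proof (cases "b = \<beta>")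
      case True
      then show ?thesis using pairs[of B "\<phi> Q"] c2 3 x e ends_2(1) \<psi> PQ by auto
    next
      case False
      then have "b = (\<not> \<beta>)" by auto
      then show ?thesis using pairs[of "\<phi> S1" "\<phi> S2"] c2 3 x e ends_2(2) \<psi> S by auto
    qed
  qed
qed

text \<open>Edge sets that connect the old regions in the same way before and after the split: a
  subdivided edge needs both halves, a doubled edge only one of its copies.\<close>

definition matched_sets :: "bool \<Rightarrow> 'c set \<Rightarrow> 'c set \<Rightarrow> bool" where
  "matched_sets b T T' \<longleftrightarrow> T \<subseteq> C \<and> T' \<subseteq> C' \<and> T \<inter> E = T' \<inter> E \<and>
     (c0 \<in> T \<longleftrightarrow> (if b = \<beta> then c1 \<in> T' \<and> c2 \<in> T' else c1 \<in> T' \<or> c2 \<in> T'))"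

lemma joined_iff:
  assumes m: "matched_sets b T T'" and R: "R \<in> N" "R' \<in> N"
  shows "(\<phi> R, \<phi> R') \<in> joined I' (V' b) T' \<longleftrightarrow> (R, R') \<in> joined I (V b) T"
proof
  assume "(R, R') \<in> joined I (V b) T"
  then show "(\<phi> R, \<phi> R') \<in> joined I' (V' b) T'"
    using m by (intro joined_lift[of T T']) (auto simp: matched_sets_def)
next
  assume j: "(\<phi> R, \<phi> R') \<in> joined I' (V' b) T'"
  have T: "T' \<subseteq> C'" "T' \<inter> E \<subseteq> T" using m by (auto simp: matched_sets_def)
  \<comment> \<open>\<open>B\<close> is collapsed along a half that is present, which makes this
    half trivial; if both halves are present, the other one becomes the edge of
    \<open>c0\<close>.\<close>
  define Z where "Z = (if c2 \<in> T' then Q else P)"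
  have e0: "if b = \<beta> then (P, Q) \<in> joined I (V b) T else (S1, S2) \<in> joined I (V b) T" if "c0 \<in> T"
  proof (cases "b = \<beta>")
    case True
    then show ?thesis using joined_edge[OF that ends_0(1)] by simp
  next
    case False
    then have "b = (\<not> \<beta>)" by auto
    then show ?thesis using joined_edge[OF that ends_0(2)] by simp
  qed
  have "(\<psi> Z (\<phi> R), \<psi> Z (\<phi> R')) \<in> joined I (V b) T"
  proof (rule joined_drop[OF T _ _ j])
    assume "c1 \<in> T'"
    then show "if b = \<beta> then (P, Z) \<in> joined I (V b) T else (S1, S2) \<in> joined I (V b) T"
      using e0 m joined_refl by (auto simp: matched_sets_def Z_def split: if_splits)
  next
    assume "c2 \<in> T'"
    then show "if b = \<beta> then (Z, Q) \<in> joined I (V b) T else (S1, S2) \<in> joined I (V b) T"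
      using e0 m joined_refl by (auto simp: matched_sets_def Z_def split: if_splits)
  qed
  then show "(R, R') \<in> joined I (V b) T" using \<psi>(1) R by simp
qed

lemma separated_E:
  assumes m: "matched_sets b T T'" and y: "y \<in> E"
  shows "separated I' (V' b) T' y \<longleftrightarrow> separated I (V b) T y"
proof
  assume "separated I (V b) T y"
  then obtain Y W where e: "ends I (V b) y = {Y, W}" and n: "(Y, W) \<notin> joined I (V b) T"
    unfolding separated_def by auto
  then have "Y \<in> N" "W \<in> N" unfolding ends_def colour_class_def by auto
  then have "(\<phi> Y, \<phi> W) \<notin> joined I' (V' b) T'" using joined_iff[OF m] n by blast
  moreover have "ends I' (V' b) y = {\<phi> Y, \<phi> W}" using ends_E[OF y, of b] e by simp
  ultimately show "separated I' (V' b) T' y" unfolding separated_def by blast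
next
  assume "separated I' (V' b) T' y"
  then obtain Y' W' where e: "ends I' (V' b) y = {Y', W'}" and n: "(Y', W') \<notin> joined I' (V' b) T'"
    unfolding separated_def by auto
  have "{Y', W'} = \<phi> ` ends I (V b) y" using e ends_E[OF y] by simp
  then obtain Y W where YW: "Y \<in> ends I (V b) y" "W \<in> ends I (V b) y" "Y' = \<phi> Y" "W' = \<phi> W" by blast
  have "ends I (V b) y = {Y, W}"
  proof
    show "ends I (V b) y \<subseteq> {Y, W}"
    proof
      fix R assume R: "R \<in> ends I (V b) y"
      then have "\<phi> R \<in> {\<phi> Y, \<phi> W}" using \<open>{Y', W'} = _\<close> YW by blast
      moreover have "R \<in> N" "Y \<in> N" "W \<in> N" using R YW by (auto simp: ends_def colour_class_def)
      ultimately show "R \<in> {Y, W}" using inj by (auto dest: inj_onD)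
    qed
  qed (use YW in auto)
  moreover have "(Y, W) \<notin> joined I (V b) T"
    using joined_iff[OF m, of Y W] YW n by (auto simp: ends_def colour_class_def)
  ultimately show "separated I (V b) T y" unfolding separated_def by blast
qed

text \<open>As \<open>c2\<close> is present, \<open>B\<close> lies in the component of
  \<open>\<phi> Q\<close>, and the missing half runs between the same components as the edge of
  \<open>c0\<close>.\<close>

lemma separated_series:
  assumes m: "matched_sets \<beta> T T'" and "c1 \<notin> T'" "c2 \<in> T'"
  shows "separated I' (V' \<beta>) T' c1 \<longleftrightarrow> separated I (V \<beta>) T c0"
proof -
  have j: "(B, \<phi> Q) \<in> joined I' (V' \<beta>) T'" using joined_edge[OF assms(3) ends_2(1)] .
  have "separated I' (V' \<beta>) T' c1 \<longleftrightarrow> (\<phi> P, B) \<notin> joined I' (V' \<beta>) T'"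
    by (rule separated_iff[OF ends_1(1)])
  also have "\<dots> \<longleftrightarrow> (\<phi> P, \<phi> Q) \<notin> joined I' (V' \<beta>) T'"
    using j joined_trans joined_sym by metis
  also have "\<dots> \<longleftrightarrow> separated I (V \<beta>) T c0"
    using joined_iff[OF m] PQ separated_iff[OF ends_0(1)] by simp
  finally show ?thesis .
qed

text \<open>No edge from \<open>E\<close> ends at the bigon, so \<open>B\<close> is isolated in such
  a set.\<close>

lemma separated_leaf:
  assumes "T' \<subseteq> E"
  shows "separated I' (V' \<beta>) T' c1"
proof -
  have no: "(x, B) \<notin> {(Q, R). \<exists>c\<in>T'. ends I' (V' \<beta>) c = {Q, R}}" for x
  proof
    assume "(x, B) \<in> {(Q, R). \<exists>c\<in>T'. ends I' (V' \<beta>) c = {Q, R}}"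
    then obtain c where c: "c \<in> T'" "ends I' (V' \<beta>) c = {x, B}" by auto
    then have "B \<in> ends I' (V' \<beta>) c" by simp
    then show False using IE(2)[of c] c(1) assms by (auto simp: ends_def)
  qed
  have "R = B" if "(R, B) \<in> joined I' (V' \<beta>) T'" for R
    using that unfolding joined_def by (rule rtranclE) (use no in blast)+
  moreover have "\<phi> P \<noteq> B" using B PQ by auto
  ultimately show ?thesis unfolding separated_iff[OF ends_1(1)] by auto
qed

lemma separated_parallel:
  assumes m: "matched_sets (\<not> \<beta>) T T'"
  shows "separated I' (V' (\<not> \<beta>)) T' c1 \<longleftrightarrow> separated I (V (\<not> \<beta>)) T c0"
  using joined_iff[OF m] S separated_iff[OF ends_0(2)] separated_iff[OF ends_1(2)] by simp

text \<open>The bigon is the only new vertex, and one half of the subdivided edge attaches it to the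
  rest.\<close>

lemma spanning_split:
  assumes m: "matched_sets b T T'" and "b = \<beta> \<Longrightarrow> c1 \<in> T' \<or> c2 \<in> T'" and s: "spanning I (V b) T"
  shows "spanning I' (V' b) T'"
proof -
  have *: "\<exists>R\<in>V b. (R', \<phi> R) \<in> joined I' (V' b) T'" if "R' \<in> V' b" for R'
  proof (cases "R' \<in> \<phi> ` V b")
    case True then show ?thesis using joined_refl by fast
  next
    case False
    then have b: "b = \<beta>" "R' = B" using that unfolding V' by (auto split: if_splits)
    have "P \<in> V b" "Q \<in> V b" using PQ b by (auto simp: colour_class_def)
    moreover have "(B, \<phi> P) \<in> joined I' (V' \<beta>) T' \<or> (B, \<phi> Q) \<in> joined I' (V' \<beta>) T'"
      using assms(2)[OF b(1)] joined_edge[OF _ ends_1(1)] joined_edge[OF _ ends_2(1)] joined_sym by metis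
    ultimately show ?thesis using b by blast
  qed
  show ?thesis unfolding spanning_def
  proof (intro ballI)
    fix R1 R2 assume "R1 \<in> V' b" "R2 \<in> V' b"
    with * obtain Y W where "Y \<in> V b" "W \<in> V b" "(R1, \<phi> Y) \<in> joined I' (V' b) T'" "(R2, \<phi> W) \<in> joined I' (V' b) T'"
      by metis
    moreover from this have "(\<phi> Y, \<phi> W) \<in> joined I' (V' b) T'"
      using s joined_iff[OF m] unfolding spanning_def by (auto simp: colour_class_def)
    ultimately show "(R1, R2) \<in> joined I' (V' b) T'" using joined_trans joined_sym by metis
  qed
qed


section \<open>Activities after splitting a crossing\<close>

text \<open>One of the new crossings enters a cocycle exactly when \<open>c0\<close> entered the old
  one. As both new labels compare with the labels in \<open>E\<close> as the old one did, the
  activity of a crossing in \<open>E\<close> is unaffected.\<close>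

lemma separated_new:
  assumes m: "matched_sets b T T'" and c2: "b = \<beta> \<Longrightarrow> c2 \<in> T'"
  shows "separated I' (V' b) T' c1 \<or> separated I' (V' b) T' c2 \<longleftrightarrow> separated I (V b) T c0"
proof (cases "b = \<beta>")
  case True
  have n2: "\<not> separated I' (V' b) T' c2" using c2[OF True] by (rule not_separated)
  show ?thesis
  proof (cases "c1 \<in> T'")
    case c1: True
    then have "c0 \<in> T" using m c2 True by (auto simp: matched_sets_def)
    then show ?thesis using n2 not_separated[of c1 T' I' "V' b"] not_separated[of c0 T I "V b"] c1 by auto
  next
    case c1: False
    then show ?thesis using n2 separated_series[OF _ c1 c2[OF True]] m True by auto
  qed
next
  case False
  then have b: "b = (\<not> \<beta>)" by auto
  interpret sw: crossing_split E c0 c2 c1 N X I q l C' N' X' I' q' l' \<phi> B Q P S1 S2 \<beta> by (rule swap)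
  have "sw.matched_sets b T T'" using m b unfolding sw.matched_sets_def matched_sets_def by auto
  then show ?thesis using separated_parallel[of T T'] sw.separated_parallel[of T T'] m b by simp
qed

lemma active_old:
  assumes m: "matched_sets b T T'" and c2: "b = \<beta> \<Longrightarrow> c2 \<in> T'" and x: "x \<in> E"
  shows "active C' I' l' (V' b) T' x \<longleftrightarrow> active C I l (V b) T x"
proof -
  have x': "x \<noteq> c0" "x \<noteq> c1" "x \<noteq> c2" using x E by auto
  have m: "matched_sets b (T - {x}) (T' - {x})" using m x' unfolding matched_sets_def by auto
  have "c2 \<in> T' - {x}" if "b = \<beta>" using c2[OF that] x' by auto
  note n = separated_new[OF m this]
  have "(\<forall>y\<in>E. separated I' (V' b) (T' - {x}) y \<longrightarrow> l' x \<le> l' y) \<longleftrightarrow>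
    (\<forall>y\<in>E. separated I (V b) (T - {x}) y \<longrightarrow> l x \<le> l y)"
    using separated_E[OF m] lE[OF x] by simp
  then show ?thesis unfolding active_def E(6) using n l1(1)[OF x] l2(1)[OF x] by auto
qed

lemma active_series:
  assumes m: "matched_sets \<beta> (T - {c0}) (T' - {c1})" and "c2 \<in> T'"
  shows "active C' I' l' (V' \<beta>) T' c1 \<longleftrightarrow> active C I l (V \<beta>) T c0"
proof -
  have c2: "c2 \<in> T' - {c1}" using assms E by auto
  have "\<not> separated I' (V' \<beta>) (T' - {c1}) c2" using c2 by (rule not_separated)
  moreover have "(\<forall>y\<in>E. separated I' (V' \<beta>) (T' - {c1}) y \<longrightarrow> l' c1 \<le> l' y) \<longleftrightarrow>
    (\<forall>y\<in>E. separated I (V \<beta>) (T - {c0}) y \<longrightarrow> l c0 \<le> l y)"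
    using separated_E[OF m] l1(2) by simp
  ultimately show ?thesis unfolding active_def E(6) by auto
qed

text \<open>If \<open>c0\<close> is not in the tree, the bigon hangs on the tree by
  \<open>c2\<close> alone. Without \<open>c2\<close> the old tree still connects all old regions, so
  the cocycle consists of \<open>c1\<close> and \<open>c2\<close> only.\<close>

lemma active_leaf:
  assumes m: "matched_sets \<beta> T T'" and "c0 \<notin> T" "c2 \<in> T'" and s: "spanning I (V \<beta>) T"
  shows "active C' I' l' (V' \<beta>) T' c2 \<longleftrightarrow> l' c2 \<le> l' c1"
proof -
  have c1: "c1 \<notin> T'" using m assms(2,3) by (simp add: matched_sets_def)
  have m': "matched_sets \<beta> T (T' - {c2})" 
  proof -
    have "(T' - {c2}) \<inter> E = T' \<inter> E" using E(4) by auto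
    then show ?thesis using m c1 assms(2) unfolding matched_sets_def by auto
  qed
  have "separated I' (V' \<beta>) (T' - {c2}) c1"
  proof (rule separated_leaf)
    have "T' \<subseteq> C'" using m by (simp add: matched_sets_def)
    then show "T' - {c2} \<subseteq> E" using c1 E(6) by blast
  qed
  moreover have "\<not> separated I' (V' \<beta>) (T' - {c2}) y" if "y \<in> E" for y
    using separated_E[OF m' that] spanning_not_separated[OF s] by simp
  ultimately show ?thesis unfolding active_def E(6) by auto
qed

text \<open>Removing the tree edge separates the common ends of the parallel pair, so
  \<open>c2\<close> belongs to the cocycle of \<open>c1\<close> and its label has to be compared
  too.\<close>

lemma active_parallel:
  assumes m: "matched_sets (\<not> \<beta>) (T - {c0}) (T' - {c1})" and s: "separated I (V (\<not> \<beta>)) (T - {c0}) c0"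
  shows "active C' I' l' (V' (\<not> \<beta>)) T' c1 \<longleftrightarrow> active C I l (V (\<not> \<beta>)) T c0 \<and> l' c1 \<le> l' c2"
proof -
  interpret sw: crossing_split E c0 c2 c1 N X I q l C' N' X' I' q' l' \<phi> B Q P S1 S2 \<beta> by (rule swap)
  have "sw.matched_sets (\<not> \<beta>) (T - {c0}) (T' - {c1})"
    using m unfolding sw.matched_sets_def matched_sets_def by auto
  then have "separated I' (V' (\<not> \<beta>)) (T' - {c1}) c2" using sw.separated_parallel s by simp
  moreover have "(\<forall>y\<in>E. separated I' (V' (\<not> \<beta>)) (T' - {c1}) y \<longrightarrow> l' c1 \<le> l' y) \<longleftrightarrow>
    (\<forall>y\<in>E. separated I (V (\<not> \<beta>)) (T - {c0}) y \<longrightarrow> l c0 \<le> l y)"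
    using separated_E[OF m] l1(2) by simp
  ultimately show ?thesis unfolding active_def E(6) by auto
qed

lemma lowest_old:
  assumes "x \<in> E" "R \<in> N"
  shows "lowest C' I' l' x (\<phi> R) \<longleftrightarrow> lowest C I l x R"
proof -
  have "I' c1 (\<phi> R) \<or> I' c2 (\<phi> R) \<longleftrightarrow> I c0 R" using I0 I1 I2 assms(2) by auto
  moreover have "(\<forall>y\<in>E. I' y (\<phi> R) \<longrightarrow> l' x \<le> l' y) \<longleftrightarrow> (\<forall>y\<in>E. I y R \<longrightarrow> l x \<le> l y)"
    using IE(1) assms lE by simp
  ultimately show ?thesis unfolding lowest_def E(6) using l1(1)[OF assms(1)] l2(1)[OF assms(1)] by auto
qed

lemma lowest_c1:
  assumes "R \<in> N"
  shows "lowest C' I' l' c1 (\<phi> R) \<longleftrightarrow> lowest C I l c0 R \<and> (I' c2 (\<phi> R) \<longrightarrow> l' c1 \<le> l' c2)"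
proof -
  have "(\<forall>y\<in>E. I' y (\<phi> R) \<longrightarrow> l' c1 \<le> l' y) \<longleftrightarrow> (\<forall>y\<in>E. I y R \<longrightarrow> l c0 \<le> l y)"
    using IE(1) assms l1(2) by simp
  then show ?thesis unfolding lowest_def E(6) by auto
qed

lemma lowest_bigon: "lowest C' I' l' c1 B \<longleftrightarrow> l' c1 \<le> l' c2" "lowest C' I' l' c2 B \<longleftrightarrow> l' c2 \<le> l' c1"
  unfolding lowest_def E(6) using IE(2) IB by auto

end

section \<open>Lifts of matchings\<close>

definition split_matching :: "'c set \<Rightarrow> ('r \<Rightarrow> 's) \<Rightarrow> 's \<Rightarrow> 'c \<Rightarrow> 'c \<Rightarrow> 'c \<Rightarrow> ('c \<Rightarrow> 'r) \<Rightarrow> 'c \<Rightarrow> 's" where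
  "split_matching C' \<phi> B c0 c1 c2 f = (\<lambda>x\<in>C'. if x = c2 then B else if x = c1 then \<phi> (f c0) else \<phi> (f x))"

lemma matchingsD:
  assumes "f \<in> matchings C X I"
  shows "f \<in> extensional C" "bij_betw f C X" "c \<in> C \<Longrightarrow> I c (f c)" "c \<in> C \<Longrightarrow> f c \<in> X"
  using assms unfolding matchings_def by (auto simp: bij_betw_apply)

context crossing_split
begin

abbreviation "up1 \<equiv> split_matching C' \<phi> B c0 c1 c2"
abbreviation "up2 \<equiv> split_matching C' \<phi> B c0 c2 c1"
abbreviation "M \<equiv> matchings C X I"
abbreviation "M' \<equiv> matchings C' X' I'"

lemma up1_apply: "x \<in> E \<Longrightarrow> up1 f x = \<phi> (f x)" "up1 f c1 = \<phi> (f c0)" "up1 f c2 = B"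
  using E by (auto simp: split_matching_def)

lemma M_N: "f \<in> M \<Longrightarrow> x \<in> C \<Longrightarrow> f x \<in> N"
  using matchingsD(4)[of f C X I x] X(1) by blast

text \<open>Apart from \<open>Q\<close>, every corner region of \<open>c0\<close> is one of
  \<open>c1\<close>, so \<open>c1\<close> can inherit the partner of \<open>c0\<close>. The old
  bijection is renamed accordingly and extended by the pair of \<open>c2\<close> and the
  bigon.\<close>

lemma up1_in:
  assumes f: "f \<in> M" and "f c0 \<noteq> Q"
  shows "up1 f \<in> M'"
proof -
  define g where "g x = (if x = c1 then c0 else x)" for x
  have "bij_betw g (insert c1 E) C"
    unfolding bij_betw_def inj_on_def g_def using E by auto
  moreover have "bij_betw \<phi> X (\<phi> ` X)" using inj X(1) by (simp add: bij_betw_def inj_on_subset)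
  ultimately have bb: "bij_betw (\<phi> \<circ> (f \<circ> g)) (insert c1 E) (\<phi> ` X)"
    using matchingsD(2)[OF f] by (blast intro: bij_betw_trans)
  have eq: "(\<phi> \<circ> (f \<circ> g)) x = up1 f x" if "x \<in> insert c1 E" for x
    using that E up1_apply by (auto simp: g_def)
  have "bij_betw (up1 f) (insert c1 E) (\<phi> ` X)" by (rule iffD1[OF bij_betw_cong[OF eq] bb])
  moreover have "c2 \<notin> insert c1 E" "B \<notin> \<phi> ` X" using E B X by auto
  ultimately have "bij_betw (up1 f) (insert c1 E \<union> {c2}) (\<phi> ` X \<union> {B})"
    using notIn_Un_bij_betw[of c2 "insert c1 E" "up1 f" "\<phi> ` X"] up1_apply by simp
  moreover have "insert c1 E \<union> {c2} = C'" "\<phi> ` X \<union> {B} = X'" using E X by auto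
  ultimately have bij: "bij_betw (up1 f) C' X'" by simp
  have "I c0 (f c0)" "f c0 \<in> N" using matchingsD(3)[OF f] M_N[OF f] by auto
  then have "f c0 \<in> {P, S1, S2}" using I0 assms(2) by auto
  then have "I' c1 (up1 f c1)" using I1[OF \<open>f c0 \<in> N\<close>] up1_apply by simp
  moreover have "I' x (up1 f x)" if "x \<in> E" for x
    using IE(1)[OF that M_N[OF f]] matchingsD(3)[OF f, of x] that up1_apply by simp
  ultimately have "\<forall>x\<in>C'. I' x (up1 f x)" using IB up1_apply E(6) by auto
  then show ?thesis using bij unfolding matchings_def by (simp add: split_matching_def)
qed

lemma inj_up1: "inj_on up1 M"
proof (rule inj_onI)
  fix f g assume f: "f \<in> M" and g: "g \<in> M" and eq: "up1 f = up1 g"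
  have "f x = g x" if x: "x \<in> C" for x
  proof -
    have "\<phi> (f x) = \<phi> (g x)"
      using fun_cong[OF eq, of x] fun_cong[OF eq, of c1] up1_apply x by (cases "x = c0") auto
    then show ?thesis using inj M_N[OF f x] M_N[OF g x] by (auto dest: inj_onD)
  qed
  then show "f = g" using matchingsD(1)[OF f] matchingsD(1)[OF g] by (rule extensionalityI[rotated 2])
qed

text \<open>Deleting the pair of \<open>c2\<close> and the bigon and undoing \<open>\<phi>\<close>
  recovers the old matching; it avoids \<open>Q\<close> at \<open>c0\<close> because
  \<open>c1\<close> does not meet \<open>\<phi> Q\<close>.\<close>

lemma up1_surj:
  assumes f': "f' \<in> M'" and c2: "f' c2 = B"
  shows "f' \<in> up1 ` {f \<in> M. f c0 \<noteq> Q}"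
proof -
  define \<chi> where "\<chi> = the_inv_into N \<phi>"
  define g where "g x = (if x = c0 then c1 else x)" for x
  define f where "f = (\<lambda>x\<in>C. \<chi> (f' (g x)))"
  have C': "C' = insert c1 E \<union> {c2}" and X': "X' = \<phi> ` X \<union> {f' c2}" using E X c2 by auto
  have "B \<notin> \<phi> ` X" using B X by auto
  then have bf: "bij_betw f' (insert c1 E) (\<phi> ` X)"
    using notIn_Un_bij_betw3[of c2 "insert c1 E" f' "\<phi> ` X"] matchingsD(2)[OF f'] E c2 unfolding C' X' by auto
  have bg: "bij_betw g C (insert c1 E)"
    unfolding bij_betw_def inj_on_def g_def using E by auto
  have \<chi>: "\<chi> (\<phi> R) = R" if "R \<in> N" for R unfolding \<chi>_def using that by (rule the_inv_into_f_f[OF inj])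
  have "bij_betw \<chi> (\<phi> ` X) X"
    unfolding bij_betw_def inj_on_def using \<chi> X(1) by (auto simp: image_image subset_iff image_iff)
  then have bb: "bij_betw (\<chi> \<circ> (f' \<circ> g)) C X" using bf bg by (blast intro: bij_betw_trans)
  have eq: "(\<chi> \<circ> (f' \<circ> g)) x = f x" if "x \<in> C" for x using that by (simp add: f_def)
  have bij: "bij_betw f C X" by (rule iffD1[OF bij_betw_cong[OF eq] bb])
  have \<phi>f: "\<phi> (f x) = f' (g x)" "f x \<in> N" if x: "x \<in> C" for x
  proof -
    have "f' (g x) \<in> \<phi> ` X" using bf bg x by (auto dest: bij_betw_apply)
    then obtain R where R: "R \<in> X" "f' (g x) = \<phi> R" by blast
    then show "\<phi> (f x) = f' (g x)" "f x \<in> N" using \<chi>[of R] X(1) x by (auto simp: f_def)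
  qed
  have c0: "I' c1 (\<phi> (f c0))"
    using matchingsD(3)[OF f', of c1] \<phi>f(1)[of c0] by (simp add: E(6) g_def)
  have I: "I x (f x)" if x: "x \<in> C" for x
  proof (cases "x = c0")
    case True
    then show ?thesis using c0 I1[OF \<phi>f(2)] I0[OF \<phi>f(2)] by auto
  next
    case False
    then have "x \<in> E" "g x = x" using x by (auto simp: g_def)
    then show ?thesis using matchingsD(3)[OF f', of x] \<phi>f[OF x] IE(1)[of x "f x"] by (simp add: E(6))
  qed
  have "f \<in> M" unfolding matchings_def using bij I by (simp add: f_def)
  moreover have "f c0 \<noteq> Q"
  proof
    assume "f c0 = Q"
    then have "Q \<in> {P, S1, S2}" using c0 I1[OF PQ(2)] by simp
    then show False using PQ S by auto
  qed
  moreover have "up1 f = f'"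
  proof (rule extensionalityI[where A = C'])
    show "up1 f \<in> extensional C'" by (simp add: split_matching_def)
    show "f' \<in> extensional C'" using matchingsD(1)[OF f'] .
    fix x assume "x \<in> C'"
    then consider "x = c1" | "x = c2" | "x \<in> E" using E by auto
    then show "up1 f x = f' x"
      by cases (use up1_apply \<phi>f(1)[of x] \<phi>f(1)[of c0] c2 E in \<open>auto simp: g_def\<close>)
  qed
  ultimately show ?thesis by blast
qed

text \<open>The bigon has to be matched, and only \<open>c1\<close> and \<open>c2\<close> meet
  it.\<close>

lemma M'_eq: "M' = up1 ` {f \<in> M. f c0 \<noteq> Q} \<union> up2 ` {f \<in> M. f c0 \<noteq> P}"
proof
  interpret sw: crossing_split E c0 c2 c1 N X I q l C' N' X' I' q' l' \<phi> B Q P S1 S2 \<beta> by (rule swap)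
  show "up1 ` {f \<in> M. f c0 \<noteq> Q} \<union> up2 ` {f \<in> M. f c0 \<noteq> P} \<subseteq> M'"
    using up1_in sw.up1_in by auto
  show "M' \<subseteq> up1 ` {f \<in> M. f c0 \<noteq> Q} \<union> up2 ` {f \<in> M. f c0 \<noteq> P}"
  proof
    fix f' assume f': "f' \<in> M'"
    have "B \<in> f' ` C'" using matchingsD(2)[OF f'] X by (simp add: bij_betw_def)
    then obtain x where x: "x \<in> C'" "f' x = B" by auto
    then have "I' x B" using matchingsD(3)[OF f'] by metis
    then have "x = c1 \<or> x = c2" using x(1) IE(2) E(6) by auto
    then show "f' \<in> up1 ` {f \<in> M. f c0 \<noteq> Q} \<union> up2 ` {f \<in> M. f c0 \<noteq> P}"
      using up1_surj[OF f'] sw.up1_surj[OF f'] x(2) by blast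
  qed
qed

lemma up_disjoint: "up1 ` F \<inter> up2 ` G = {}" if "F \<subseteq> M" "G \<subseteq> M"
proof -
  have "up1 f \<noteq> up2 g" if "g \<in> M" for f g
  proof
    assume "up1 f = up2 g"
    then have "up2 g c2 = B" using up1_apply(3)[of f] by simp
    then have "\<phi> (g c0) = B" using E by (simp add: split_matching_def)
    then show False using B M_N[OF that, of c0] by auto
  qed
  then show ?thesis using that by blast
qed

text \<open>The bigon has colour \<open>\<beta>\<close>, so \<open>c2\<close> always lies in the
  tree of this colour: the lift either subdivides the tree edge of \<open>c0\<close> or adds a leaf.
  In the other colour \<open>c1\<close> takes the place of \<open>c0\<close>.\<close>

lemma tree_up1:
  assumes f: "f \<in> M"
  shows "matched_sets b (tree_part C q f b) (tree_part C' q' (up1 f) b)"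
    "c1 \<in> tree_part C' q' (up1 f) b \<longleftrightarrow> q (f c0) = b"
    "c2 \<in> tree_part C' q' (up1 f) b \<longleftrightarrow> b = \<beta>"
    "x \<in> E \<Longrightarrow> q' (up1 f x) = q (f x)" "q' (up1 f c1) = q (f c0)" "q' (up1 f c2) = \<beta>"
proof -
  show v: "x \<in> E \<Longrightarrow> q' (up1 f x) = q (f x)" "q' (up1 f c1) = q (f c0)" "q' (up1 f c2) = \<beta>" for x
    using up1_apply M_N[OF f] q' by simp_all
  then show c: "c1 \<in> tree_part C' q' (up1 f) b \<longleftrightarrow> q (f c0) = b"
    "c2 \<in> tree_part C' q' (up1 f) b \<longleftrightarrow> b = \<beta>"
    unfolding tree_part_def E(6) by auto
  have "tree_part C q f b \<inter> E = tree_part C' q' (up1 f) b \<inter> E"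
    using v E unfolding tree_part_def by auto
  then show "matched_sets b (tree_part C q f b) (tree_part C' q' (up1 f) b)"
    unfolding matched_sets_def using c by (auto simp: tree_part_def)
qed


section \<open>Coherence of the extension\<close>

text \<open>The EI-property for the two half-edges at the bigon, in terms of matching
  functions.\<close>

definition bigon_coherent :: bool where
  "bigon_coherent \<longleftrightarrow> (\<forall>x\<in>{c1, c2}. \<forall>f\<in>M'. \<forall>g\<in>M'. f x = B \<longrightarrow> g x = B \<longrightarrow>
     active_at C' N' I' q' l' f x = active_at C' N' I' q' l' g x)"

lemma coherentD:
  assumes "coherent C N X I q l" "f \<in> M"
  shows "spanning I (V b) (tree_part C q f b)"
    "c \<in> C \<Longrightarrow> separated I (V (q (f c))) (tree_part C q f (q (f c)) - {c}) c"
    "c \<in> C \<Longrightarrow> active C I l (V (q (f c))) (tree_part C q f (q (f c))) c \<longleftrightarrow> lowest C I l c (f c)"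
  using assms unfolding coherent_def active_at_def by blast+

lemma f_c0_cases:
  assumes "f \<in> M" "f c0 \<noteq> Q"
  shows "f c0 = P \<or> f c0 \<noteq> P \<and> q (f c0) = (\<not> \<beta>) \<and> I' c2 (\<phi> (f c0))"
proof -
  have "f c0 \<in> {P, S1, S2}" using matchingsD(3)[OF assms(1), of c0] I0[OF M_N[OF assms(1)], of c0] assms(2) by auto
  then show ?thesis using I2 S PQ by auto
qed

text \<open>The edge of \<open>c2\<close> is either half of a subdivided tree edge, with the cocycle
  of \<open>c0\<close> carried over, or the edge of a leaf. Coherence of the old structure turns the
  first kind of activity into a comparison of labels around \<open>P\<close>.\<close>

lemma active_bigon:
  assumes coh: "coherent C N X I q l" and f: "f \<in> M" "f c0 \<noteq> Q"
  shows "active_at C' N' I' q' l' (up1 f) c2 \<longleftrightarrow> (if f c0 = P then lowest C I l c0 P else l' c2 \<le> l' c1)"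
proof -
  interpret sw: crossing_split E c0 c2 c1 N X I q l C' N' X' I' q' l' \<phi> B Q P S1 S2 \<beta> by (rule swap)
  let ?T = "tree_part C q f \<beta>" and ?T' = "tree_part C' q' (up1 f) \<beta>"
  have m: "matched_sets \<beta> ?T ?T'" and c: "c1 \<in> ?T' \<longleftrightarrow> q (f c0) = \<beta>" "c2 \<in> ?T'"
    using tree_up1[OF f(1)] by simp_all
  have a: "active_at C' N' I' q' l' (up1 f) c2 = active C' I' l' (V' \<beta>) ?T' c2"
    unfolding active_at_def tree_up1(6)[OF f(1)] ..
  show ?thesis
  proof (cases "f c0 = P")
    case True
    then have "c0 \<in> ?T" "c1 \<in> ?T'" using c PQ by (simp_all add: tree_part_def)
    then have "sw.matched_sets \<beta> (?T - {c0}) (?T' - {c2})"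
      using m c E unfolding sw.matched_sets_def matched_sets_def by auto
    from sw.active_series[OF this \<open>c1 \<in> ?T'\<close>]
    have "active C' I' l' (V' \<beta>) ?T' c2 = active C I l (V \<beta>) ?T c0" .
    also have "\<dots> = lowest C I l c0 P" using coherentD(3)[OF coh f(1), of c0] True PQ by simp
    finally show ?thesis using a True by simp
  next
    case False
    then have "c0 \<notin> ?T" using f_c0_cases[OF f] by (simp add: tree_part_def)
    from active_leaf[OF m this c(2) coherentD(1)[OF coh f(1)]] show ?thesis using a False by simp
  qed
qed

text \<open>Here the EI-property of the extension does its work: the activity of \<open>c2\<close>
  at the bigon is computed in two lifts, in one as that of \<open>c0\<close> at \<open>P\<close>, in
  the other as that of a leaf.\<close>

lemma lowest_P:
  assumes coh: "coherent C N X I q l" and bc: bigon_coherent and f: "f \<in> M" "f c0 = P"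
  shows "lowest C I l c0 P \<longleftrightarrow> l' c2 \<le> l' c1"
proof -
  \<comment> \<open>The comparison matching, from the last clause of \<open>coherent\<close>; it
    avoids \<open>P\<close> and \<open>Q\<close> because these have colour
    \<open>\<beta>\<close>.\<close>
  obtain g where g: "g \<in> M" "q (g c0) = (\<not> \<beta>)" using coh unfolding coherent_def by blast
  have n: "f c0 \<noteq> Q" "g c0 \<noteq> Q" "g c0 \<noteq> P" using f g PQ by auto
  have "active_at C' N' I' q' l' (up1 f) c2 = active_at C' N' I' q' l' (up1 g) c2"
    using bc up1_in[OF f(1) n(1)] up1_in[OF g(1) n(2)] up1_apply(3) unfolding bigon_coherent_def by blast
  then show ?thesis using active_bigon[OF coh f(1) n(1)] active_bigon[OF coh g(1) n(2)] f(2) n(3) by simp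
qed

text \<open>Crossings in \<open>E\<close> keep their comparisons. At \<open>c1\<close> the cocycle
  and the corner region gain \<open>c2\<close> in the same case, namely when \<open>c0\<close> was
  matched along the twist. At \<open>c2\<close> the required equality is
  \<open>lowest_P\<close>.\<close>

lemma coherent_up1:
  assumes coh: "coherent C N X I q l" and bc: bigon_coherent and f: "f \<in> M" "f c0 \<noteq> Q"
  shows "spanning I' (V' b) (tree_part C' q' (up1 f) b)"
    "x \<in> C' \<Longrightarrow> separated I' (V' (q' (up1 f x))) (tree_part C' q' (up1 f) (q' (up1 f x)) - {x}) x"
    "x \<in> C' \<Longrightarrow> active_at C' N' I' q' l' (up1 f) x \<longleftrightarrow> lowest C' I' l' x (up1 f x)"
proof -
  interpret sw: crossing_split E c0 c2 c1 N X I q l C' N' X' I' q' l' \<phi> B Q P S1 S2 \<beta> by (rule swap)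
  let ?T = "tree_part C q f" and ?T' = "tree_part C' q' (up1 f)"
  note t = tree_up1[OF f(1)]
  note d = coherentD[OF coh f(1)]
  have T0: "c0 \<in> ?T b \<longleftrightarrow> q (f c0) = b" for b by (simp add: tree_part_def)
  show "spanning I' (V' b) (?T' b)"
    by (rule spanning_split[OF t(1) _ d(1)]) (use t(3) in auto)
  have m1: "matched_sets b (?T b - {c0}) (?T' b - {c1})" if "b = \<beta> \<or> b = q (f c0)" for b
    using t(1)[of b] t(2,3)[of b] T0 that E unfolding matched_sets_def by auto
  have m2: "matched_sets \<beta> (?T \<beta> - {c0}) (?T' \<beta> - {c2})" "sw.matched_sets \<beta> (?T \<beta> - {c0}) (?T' \<beta> - {c2})"
    using t(1)[of \<beta>] t(2,3)[of \<beta>] T0[of \<beta>] E unfolding matched_sets_def sw.matched_sets_def by auto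
  assume "x \<in> C'"
  then consider "x \<in> E" | "x = c1" | "x = c2" using E by auto
  note cases = this
  show "separated I' (V' (q' (up1 f x))) (?T' (q' (up1 f x)) - {x}) x"
    using cases
  proof cases
    case 1
    then have "x \<noteq> c0" "x \<noteq> c1" "x \<noteq> c2" using E by auto
    then have "matched_sets b (?T b - {x}) (?T' b - {x})" for b
      using t(1)[of b] unfolding matched_sets_def by auto
    from separated_E[OF this 1] show ?thesis using d(2)[of x] t(4)[OF 1] 1 by simp
  next
    case 2
    show ?thesis
    proof (cases "f c0 = P")
      case True
      then have "c1 \<notin> ?T' \<beta> - {c1}" "c2 \<in> ?T' \<beta> - {c1}" using t(3)[of \<beta>] E by auto
      from separated_series[OF m1 this] show ?thesis using d(2)[of c0] 2 True t(5) PQ by simp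
    next
      case False
      then have q0: "q (f c0) = (\<not> \<beta>)" using f_c0_cases[OF f] by simp
      then have "matched_sets (\<not> \<beta>) (?T (\<not> \<beta>) - {c0}) (?T' (\<not> \<beta>) - {c1})" using m1 by metis
      from separated_parallel[OF this] show ?thesis using d(2)[of c0] 2 q0 t(5) by simp
    qed
  next
    case 3
    show ?thesis
    proof (cases "f c0 = P")
      case True
      then have "c2 \<notin> ?T' \<beta> - {c2}" "c1 \<in> ?T' \<beta> - {c2}" using t(2)[of \<beta>] E PQ by auto
      from sw.separated_series[OF m2(2) this] show ?thesis using d(2)[of c0] 3 True t(6) PQ by simp
    next
      case False
      then have "c1 \<notin> ?T' \<beta>" using f_c0_cases[OF f] t(2)[of \<beta>] by simp
      then have "?T' \<beta> - {c2} \<subseteq> E" unfolding tree_part_def E(6) by auto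
      from sw.separated_leaf[OF this] show ?thesis using 3 t(6) by simp
    qed
  qed
  show "active_at C' N' I' q' l' (up1 f) x \<longleftrightarrow> lowest C' I' l' x (up1 f x)"
    using cases
  proof cases
    case 1
    have "c2 \<in> ?T' b" if "b = \<beta>" for b using t(3) that by simp
    from active_old[OF t(1) this 1]
    have "active_at C' N' I' q' l' (up1 f) x \<longleftrightarrow> active C I l (V (q (f x))) (?T (q (f x))) x"
      unfolding active_at_def t(4)[OF 1] by simp
    then show ?thesis using d(3)[of x] 1 lowest_old[OF 1 M_N[OF f(1)]] up1_apply(1)[OF 1] by simp
  next
    case 2
    show ?thesis
    proof (cases "f c0 = P")
      case True
      then have q0: "q (f c0) = \<beta>" using PQ by simp
      have "\<not> I' c2 (\<phi> P)" using I2[OF PQ(1)] PQ S by auto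
      moreover have "c2 \<in> ?T' \<beta>" using t(3) by simp
      ultimately show ?thesis
        using active_series[OF m1[of \<beta>]] d(3)[of c0] lowest_c1[OF PQ(1)] 2 True q0 up1_apply(2)[of f] q'(1)[OF PQ(1)]
        unfolding active_at_def by (simp add: t(5))
    next
      case False
      then have q0: "q (f c0) = (\<not> \<beta>)" and i: "I' c2 (\<phi> (f c0))" using f_c0_cases[OF f] by simp_all
      then have "matched_sets (\<not> \<beta>) (?T (\<not> \<beta>) - {c0}) (?T' (\<not> \<beta>) - {c1})" using m1 by metis
      from active_parallel[OF this] have "active C' I' l' (V' (\<not> \<beta>)) (?T' (\<not> \<beta>)) c1 \<longleftrightarrow>
          active C I l (V (\<not> \<beta>)) (?T (\<not> \<beta>)) c0 \<and> l' c1 \<le> l' c2"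
        using d(2)[of c0] q0 by simp
      then show ?thesis
        using d(3)[of c0] lowest_c1[OF M_N[OF f(1)], of c0] 2 q0 i up1_apply(2)[of f] q'(1)[OF M_N[OF f(1)], of c0]
        unfolding active_at_def by (simp add: t(5))
    qed
  next
    case 3
    then show ?thesis
      using active_bigon[OF coh f] lowest_P[OF coh bc f(1)] lowest_bigon(2) up1_apply(3)[of f] by simp
  qed
qed

lemma coherent_split:
  assumes coh: "coherent C N X I q l" and bc: bigon_coherent
  shows "coherent C' N' X' I' q' l'"
proof -
  interpret sw: crossing_split E c0 c2 c1 N X I q l C' N' X' I' q' l' \<phi> B Q P S1 S2 \<beta> by (rule swap)
  have bc': sw.bigon_coherent using bc unfolding sw.bigon_coherent_def bigon_coherent_def insert_commute[of c2 c1 "{}"] .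
  have "(\<forall>b. spanning I' (V' b) (tree_part C' q' f' b)) \<and>
    (\<forall>x\<in>C'. separated I' (V' (q' (f' x))) (tree_part C' q' f' (q' (f' x)) - {x}) x) \<and>
    (\<forall>x\<in>C'. active_at C' N' I' q' l' f' x \<longleftrightarrow> lowest C' I' l' x (f' x))" if f': "f' \<in> M'" for f'
  proof -
    from f' M'_eq consider f where "f \<in> M" "f c0 \<noteq> Q" "f' = up1 f" | f where "f \<in> M" "f c0 \<noteq> P" "f' = up2 f" by blast
    then show ?thesis
    proof cases
      case 1 then show ?thesis using coherent_up1[OF coh bc 1(1,2)] by simp
    next
      case 2 then show ?thesis using sw.coherent_up1[OF coh bc' 2(1,2)] by simp
    qed
  qed
  moreover have "\<exists>f\<in>M'. q' (f x) = b" if x: "x \<in> C'" for x b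
  proof -
    have PQ': "\<And>f. f c0 \<noteq> P \<or> f c0 \<noteq> Q" using PQ by auto
    obtain g where g: "g \<in> M" "q (g c0) = (\<not> \<beta>)" using coh unfolding coherent_def by blast
    then have gn: "g c0 \<noteq> P" "g c0 \<noteq> Q" using PQ by auto
    \<comment> \<open>The two lifts of this one matching realise both colours at \<open>c1\<close>
      as well as at \<open>c2\<close>.\<close>
    note g12 = up1_in[OF g(1) gn(2)] sw.up1_in[OF g(1) gn(1)] tree_up1[OF g(1)] sw.tree_up1[OF g(1)]
    consider "x \<in> E" | "x = c1" | "x = c2" using x E by auto
    then show ?thesis
    proof cases
      case 1
      obtain f where f: "f \<in> M" "q (f x) = b" using coh 1 unfolding coherent_def by blast
      show ?thesis
      proof (cases "f c0 = Q")
        case False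
        then show ?thesis using up1_in[OF f(1)] tree_up1(4)[OF f(1) 1] f(2) by blast
      next
        case True
        then have "f c0 \<noteq> P" using PQ by simp
        then show ?thesis using sw.up1_in[OF f(1)] sw.tree_up1(4)[OF f(1) 1] f(2) by blast
      qed
    next
      case 2 then show ?thesis using g12 g(2) by (cases "b = \<beta>") auto
    next
      case 3 then show ?thesis using g12 g(2) by (cases "b = \<beta>") auto
    qed
  qed
  ultimately show ?thesis unfolding coherent_def by blast
qed

section \<open>The matching sum of the extension\<close>

lemma prod_up1:
  assumes f: "f \<in> M"
  shows "(\<Prod>x\<in>C'. half_edge_weight C' I' q' l' m' x (up1 f x)) =
    half_edge_weight C' I' q' l' m' c1 (\<phi> (f c0)) * half_edge_weight C' I' q' l' m' c2 B *
    (\<Prod>x\<in>E. half_edge_weight C I q l m' x (f x))"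
proof -
  have "(\<Prod>x\<in>E. half_edge_weight C' I' q' l' m' x (up1 f x)) = (\<Prod>x\<in>E. half_edge_weight C I q l m' x (f x))"
    by (intro prod.cong refl)
      (simp add: half_edge_weight_def up1_apply lowest_old M_N[OF f] q')
  moreover have "(\<Prod>x\<in>C'. h x) = h c1 * (h c2 * (\<Prod>x\<in>E. h x))" for h :: "'c \<Rightarrow> laurent"
    using E by simp
  ultimately show ?thesis by (simp only: up1_apply mult.assoc)
qed

text \<open>The assumptions on \<open>m\<close> are the weights of the twist in terms of colours:
  the corners of colour \<open>\<beta>\<close> are merged only if this happens at both crossings;
  the other three combinations merge the other colour, the last of them with the bigon closed
  off.\<close>

lemma matching_sum_split:
  assumes coh: "coherent C N X I q l" and bc: bigon_coherent
    and mE: "\<And>x b. x \<in> E \<Longrightarrow> m b x = m' b x"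
    and m\<beta>: "m \<beta> c0 = m' \<beta> c1 * m' \<beta> c2"
    and mn: "m (\<not> \<beta>) c0 = m' \<beta> c1 * m' (\<not> \<beta>) c2 + m' (\<not> \<beta>) c1 * m' \<beta> c2 +
      loop_value * m' (\<not> \<beta>) c1 * m' (\<not> \<beta>) c2"
    and fin: "finite M"
  shows "matching_sum C' X' I' q' l' m' = matching_sum C X I q l m"
proof -
  interpret sw: crossing_split E c0 c2 c1 N X I q l C' N' X' I' q' l' \<phi> B Q P S1 S2 \<beta> by (rule swap)
  have bc': sw.bigon_coherent using bc unfolding sw.bigon_coherent_def bigon_coherent_def insert_commute[of c2 c1 "{}"] .
  let ?w = "half_edge_weight C I q l m" and ?w' = "half_edge_weight C' I' q' l' m'"
  let ?p = "\<lambda>f. \<Prod>x\<in>E. half_edge_weight C I q l m' x (f x)"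
  have wE: "(\<Prod>x\<in>E. ?w x (f x)) = ?p f" for f
    by (intro prod.cong refl) (simp add: half_edge_weight_def mE)
  \<comment> \<open>The factors at \<open>E\<close> are common to all lifts of a matching, so the
    identity reduces to the factors at the twist.\<close>
  have key: "(if f c0 \<noteq> Q then ?w' c1 (\<phi> (f c0)) * ?w' c2 B else 0) +
      (if f c0 \<noteq> P then ?w' c2 (\<phi> (f c0)) * ?w' c1 B else 0) = ?w c0 (f c0)" if f: "f \<in> M" for f
  proof -
    have R: "f c0 \<in> N" using M_N[OF f] by simp
    have l12': "l' c1 \<le> l' c2 \<longleftrightarrow> \<not> l' c2 \<le> l' c1" using l12 by auto
    consider "f c0 = P" | "f c0 = Q" | "f c0 \<noteq> P" "f c0 \<noteq> Q" by auto
    then show ?thesis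
    proof cases
      case 1
      \<comment> \<open>There is one lift. By \<open>lowest_P\<close> its two letters agree, and its
        weights multiply to \<open>m \<beta> c0\<close>, increased by
        \<open>loop_value * m (\<not> \<beta>) c0\<close> if both letters are
        \<open>L\<close>.\<close>
      have "\<not> I' c2 (\<phi> P)" using I2[OF PQ(1)] PQ S by auto
      then show ?thesis
        using 1 PQ lowest_P[OF coh bc f 1] lowest_c1[OF PQ(1)] lowest_bigon m\<beta> mn
        by (simp add: half_edge_weight_def q' algebra_simps)
    next
      case 2
      have "\<not> I' c1 (\<phi> Q)" using I1[OF PQ(2)] PQ S by auto
      then show ?thesis
        using 2 PQ sw.lowest_P[OF coh bc' f 2] sw.lowest_c1[OF PQ(2)] lowest_bigon m\<beta> mn
        by (simp add: half_edge_weight_def q' algebra_simps)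
    next
      case 3
      have c: "q (f c0) = (\<not> \<beta>)" "I' c2 (\<phi> (f c0))" "I' c1 (\<phi> (f c0))"
        using f_c0_cases[OF f 3(2)] sw.f_c0_cases[OF f 3(1)] 3 by auto
      show ?thesis
      \<comment> \<open>There are two lifts. The crossing with the lower new label has letter
        \<open>L\<close> at the bigon and inherits the letter of \<open>c0\<close> at the region;
        the other one has letter \<open>D\<close> at both.\<close>
      proof (cases "l' c1 \<le> l' c2")
        case True
        then have "\<not> l' c2 \<le> l' c1" using l12' by simp
        then show ?thesis
          using True 3 c lowest_c1[OF R] sw.lowest_c1[OF R] lowest_bigon m\<beta> mn
          by (simp add: half_edge_weight_def q' R algebra_simps)
      next
        case False
        then have "l' c2 \<le> l' c1" by simp
        then show ?thesis
          using False 3 c lowest_c1[OF R] sw.lowest_c1[OF R] lowest_bigon m\<beta> mn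
          by (simp add: half_edge_weight_def q' R algebra_simps)
      qed
    qed
  qed
  have sum_up1: "(\<Sum>f'\<in>up1 ` {f \<in> M. f c0 \<noteq> Q}. \<Prod>x\<in>C'. ?w' x (f' x)) =
      (\<Sum>f\<in>M. (if f c0 \<noteq> Q then ?w' c1 (\<phi> (f c0)) * ?w' c2 B else 0) * ?p f)"
  proof -
    have "inj_on up1 {f \<in> M. f c0 \<noteq> Q}" using inj_up1 by (rule inj_on_subset) auto
    then have "(\<Sum>f'\<in>up1 ` {f \<in> M. f c0 \<noteq> Q}. \<Prod>x\<in>C'. ?w' x (f' x)) =
        (\<Sum>f\<in>{f \<in> M. f c0 \<noteq> Q}. \<Prod>x\<in>C'. ?w' x (up1 f x))"
      by (subst sum.reindex) (auto simp: o_def)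
    also have "\<dots> = (\<Sum>f\<in>{f \<in> M. f c0 \<noteq> Q}. ?w' c1 (\<phi> (f c0)) * ?w' c2 B * ?p f)"
      by (intro sum.cong refl) (simp add: prod_up1)
    also have "\<dots> = (\<Sum>f\<in>M. (if f c0 \<noteq> Q then ?w' c1 (\<phi> (f c0)) * ?w' c2 B else 0) * ?p f)"
      using fin by (intro sum.mono_neutral_cong_left) auto
    finally show ?thesis .
  qed
  have sum_up2: "(\<Sum>f'\<in>up2 ` {f \<in> M. f c0 \<noteq> P}. \<Prod>x\<in>C'. ?w' x (f' x)) =
      (\<Sum>f\<in>M. (if f c0 \<noteq> P then ?w' c2 (\<phi> (f c0)) * ?w' c1 B else 0) * ?p f)"
  proof -
    have "inj_on up2 {f \<in> M. f c0 \<noteq> P}" using sw.inj_up1 by (rule inj_on_subset) auto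
    then have "(\<Sum>f'\<in>up2 ` {f \<in> M. f c0 \<noteq> P}. \<Prod>x\<in>C'. ?w' x (f' x)) =
        (\<Sum>f\<in>{f \<in> M. f c0 \<noteq> P}. \<Prod>x\<in>C'. ?w' x (up2 f x))"
      by (subst sum.reindex) (auto simp: o_def)
    also have "\<dots> = (\<Sum>f\<in>{f \<in> M. f c0 \<noteq> P}. ?w' c2 (\<phi> (f c0)) * ?w' c1 B * ?p f)"
      by (intro sum.cong refl) (simp add: sw.prod_up1)
    also have "\<dots> = (\<Sum>f\<in>M. (if f c0 \<noteq> P then ?w' c2 (\<phi> (f c0)) * ?w' c1 B else 0) * ?p f)"
      using fin by (intro sum.mono_neutral_cong_left) auto
    finally show ?thesis .
  qed
  have "matching_sum C' X' I' q' l' m' =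
    (\<Sum>f'\<in>up1 ` {f \<in> M. f c0 \<noteq> Q}. \<Prod>x\<in>C'. ?w' x (f' x)) + (\<Sum>f'\<in>up2 ` {f \<in> M. f c0 \<noteq> P}. \<Prod>x\<in>C'. ?w' x (f' x))"
    unfolding matching_sum_def M'_eq using fin by (intro sum.union_disjoint up_disjoint) auto
  also have "\<dots> = (\<Sum>f\<in>M. ?w c0 (f c0) * ?p f)"
    unfolding sum_up1 sum_up2 sum.distrib[symmetric] distrib_right[symmetric]
    by (intro sum.cong refl) (simp only: key)
  also have "\<dots> = matching_sum C X I q l m"
    unfolding matching_sum_def using E by (intro sum.cong refl) (simp add: wE)
  finally show ?thesis .
qed

end


section \<open>Regions and checkerboard colourings\<close>

lemma universeD:
  assumes "universe U"
  shows "finite (crossings U)" "finite (darts U)" "inj (glue U)"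
    "d \<in> darts U \<Longrightarrow> glue U d \<in> darts U" "d \<in> darts U \<Longrightarrow> glue U d \<noteq> d" "d \<in> darts U \<Longrightarrow> glue U (glue U d) = d"
    "pairing (crossings U \<times> UNIV) (glue U)"
proof -
  have u: "finite (crossings U)" "glue U permutes darts U"
    "\<forall>d\<in>darts U. glue U d \<noteq> d \<and> glue U (glue U d) = d"
    using assms unfolding universe_def by auto
  show "finite (crossings U)" by fact
  then show "finite (darts U)" unfolding darts_def by simp
  show "inj (glue U)" using u(2) by (rule permutes_inj)
  show g: "d \<in> darts U \<Longrightarrow> glue U d \<in> darts U" for d using u(2) permutes_in_image by metis
  show g2: "d \<in> darts U \<Longrightarrow> glue U d \<noteq> d" "d \<in> darts U \<Longrightarrow> glue U (glue U d) = d" for d using u(3) by auto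
  show "pairing (crossings U \<times> UNIV) (glue U)"
    unfolding pairing_def using g g2 unfolding darts_def by blast
qed

lemma next_corner_in:
  assumes "universe U" "d \<in> darts U"
  shows "next_corner U d \<in> darts U"
  using universeD(4)[OF assms] unfolding next_corner_def darts_def by (auto split: prod.splits)

lemma inj_next_corner:
  assumes "universe U"
  shows "inj (next_corner U)"
proof -
  have "inj (\<lambda>(c :: 'a, j :: 4). (c, j - 1))" by (auto simp: inj_on_def)
  moreover have "next_corner U = (\<lambda>(c, j). (c, j - 1)) \<circ> glue U" by (auto simp: next_corner_def)
  ultimately show ?thesis using universeD(3)[OF assms] by (simp add: inj_compose)
qed

lemma orbit_invariant:
  assumes "e \<in> orbit f d" "d \<in> A" "\<And>x. x \<in> A \<Longrightarrow> f x \<in> A \<and> g (f x) = g x"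
  shows "e \<in> A \<and> g e = g d"
  using assms(1)
proof induction
  case base
  then show ?case using assms(2,3) by simp
next
  case (step y)
  then show ?case using assms(3)[of y] by simp
qed

text \<open>Orbits consist of iterates with at least one step, so the start belongs to its orbit
  only because an injective map on a finite set returns to it.\<close>

lemma self_in_region:
  assumes "universe U" "d \<in> darts U"
  shows "d \<in> region U d"
proof -
  have "(next_corner U ^^ n) d \<in> darts U" for n
    by (induction n) (simp_all add: assms(2) next_corner_in[OF assms(1)])
  then have "{y. \<exists>n. y = (next_corner U ^^ n) d} \<subseteq> darts U" by blast
  then have "finite {y. \<exists>n. y = (next_corner U ^^ n) d}" using universeD(2)[OF assms(1)] finite_subset by blast
  then obtain n where "0 < n" "(next_corner U ^^ n) d = d"
    using funpow_inj_finite[OF inj_next_corner[OF assms(1)]] by metis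
  then show ?thesis unfolding region_def orbit_altdef by force
qed

lemma region_eqI:
  assumes "universe U" "d \<in> darts U" "e \<in> region U d"
  shows "region U e = region U d"
proof -
  have d: "d \<in> orbit (next_corner U) e"
    using orbit_swap[OF self_in_region[OF assms(1,2), unfolded region_def] assms(3)[unfolded region_def]] .
  show ?thesis
    unfolding region_def
  proof
    show "orbit (next_corner U) e \<subseteq> orbit (next_corner U) d"
      using assms(3)[unfolded region_def] orbit_trans by fast
    show "orbit (next_corner U) d \<subseteq> orbit (next_corner U) e" using d orbit_trans by fast
  qed
qed

lemma region_next_corner:
  assumes "universe U" "d \<in> darts U"
  shows "region U (next_corner U d) = region U d"
  by (rule region_eqI[OF assms]) (simp add: region_def orbit.base)

text \<open>A quantity preserved by the step to the next corner is constant on a region; the set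
  \<open>A\<close> restricts this to corners where the step is under control.\<close>

lemma region_eqD:
  assumes "universe U" "d \<in> darts U" "e \<in> darts U" "region U d = region U e"
    "\<And>x. x \<in> A \<Longrightarrow> next_corner U x \<in> A \<and> g (next_corner U x) = g x" "d \<in> A"
  shows "g d = g e"
proof -
  have "e \<in> orbit (next_corner U) d" using self_in_region[OF assms(1,3)] assms(4) unfolding region_def by simp
  from orbit_invariant[OF this assms(6,5)] show ?thesis by simp
qed

lemma checkerboard_alt:
  assumes "checkerboard U B" "c \<in> crossings U"
  shows "region U (c, i + 1) \<in> B \<longleftrightarrow> region U (c, i) \<notin> B"
proof -
  have "(c, i + 1) \<in> darts U" using assms(2) by (simp add: darts_def)
  then show ?thesis using assms(1) unfolding checkerboard_def by fastforce
qed

lemma checkerboard_parity: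
  assumes "checkerboard U B" "c \<in> crossings U"
  shows "region U (c, i) \<in> B \<longleftrightarrow> (region U (c, j) \<in> B \<longleftrightarrow> odd4 i = odd4 j)"
proof -
  have "region U (c, j + 1) \<in> B \<longleftrightarrow> region U (c, j) \<notin> B" "region U (c, j + 2) \<in> B \<longleftrightarrow> region U (c, j) \<in> B"
    "region U (c, j + 3) \<in> B \<longleftrightarrow> region U (c, j) \<notin> B"
    using checkerboard_alt[OF assms, of j] checkerboard_alt[OF assms, of "j + 1"] checkerboard_alt[OF assms, of "j + 2"]
    by (simp_all add: add.assoc)
  then show ?thesis using four_cases[of i j] odd4_add[of j] by auto
qed

text \<open>Agreement of two colourings is constant around a crossing, where colours alternate, and
  passes along segments, whose ends share a region. It holds at the outer region, which is white in
  both, and spreads by connectedness.\<close>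

lemma checkerboard_unique:
  assumes U: "universe U" and B: "checkerboard U B" "checkerboard U B'"
  shows "B = B'"
proof -
  define same where "same d \<longleftrightarrow> (region U d \<in> B \<longleftrightarrow> region U d \<in> B')" for d
  have const: "same (c, i) \<longleftrightarrow> same (c, j)" if "c \<in> crossings U" for c i j
    using checkerboard_parity[OF B(1) that, of i j] checkerboard_parity[OF B(2) that, of i j] unfolding same_def by auto
  have step: "same (fst d, 0) \<longleftrightarrow> same (fst (glue U d), 0)" if d: "d \<in> darts U" for d
  proof -
    obtain c i where di: "d = (c, i)" by (cases d)
    obtain c' j where gj: "glue U d = (c', j)" by (cases "glue U d")
    have c: "c \<in> crossings U" "c' \<in> crossings U" using d universeD(4)[OF U d] di gj by (auto simp: darts_def)
    have "same (c', j - 1) \<longleftrightarrow> same (c, i)"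
      using region_next_corner[OF U d] di gj unfolding same_def next_corner_def by simp
    then show ?thesis using const[OF c(1), of i 0] const[OF c(2), of "j - 1" 0] di gj by simp
  qed
  obtain d0 where d0: "d0 \<in> darts U" "outer U = region U d0"
    using U unfolding universe_def regions_def by auto
  have "same d0" using B d0 unfolding same_def checkerboard_def by auto
  then have s0: "same (fst d0, 0)" using const[of "fst d0" "snd d0" 0] d0 by (auto simp: darts_def)
  have all: "same (c, 0)" if "c \<in> crossings U" for c
  proof -
    have "(fst d0, c) \<in> {(fst d, fst (glue U d)) | d. d \<in> darts U}\<^sup>*"
      using U that d0 unfolding universe_def connected_universe_def by (auto simp: darts_def)
    then show ?thesis
    proof induction
      case base show ?case using s0 .
    next
      case (step y z)
      then obtain d where "d \<in> darts U" "y = fst d" "z = fst (glue U d)" by auto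
      then show ?case using step.IH \<open>\<And>d. d \<in> darts U \<Longrightarrow> same (fst d, 0) \<longleftrightarrow> same (fst (glue U d), 0)\<close> by blast
    qed
  qed
  have "same d" if "d \<in> darts U" for d
    using all[of "fst d"] const[of "fst d" "snd d" 0] that by (auto simp: darts_def)
  moreover have "B \<subseteq> region U ` darts U" "B' \<subseteq> region U ` darts U"
    using B unfolding checkerboard_def regions_def by auto
  ultimately show ?thesis unfolding same_def by blast
qed

lemma black_regions_eq: "universe U \<Longrightarrow> checkerboard U B \<Longrightarrow> black_regions U = B"
  unfolding black_regions_def by (rule the_equality) (assumption, metis checkerboard_unique)


section \<open>From half-edge sets to matching functions\<close>

definition is_black :: "'c link_universe \<Rightarrow> 'c region \<Rightarrow> bool" where
  "is_black U R \<longleftrightarrow> R \<in> black_regions U"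

abbreviation universe_matchings :: "'c link_universe \<Rightarrow> 'c dart set \<Rightarrow> ('c \<Rightarrow> 'c region) set" where
  "universe_matchings U s \<equiv> matchings (crossings U) (round_vertices U s) (incident U)"

definition graph_of :: "'c link_universe \<Rightarrow> ('c \<Rightarrow> 'c region) \<Rightarrow> 'c half_edge set" where
  "graph_of U f = (\<lambda>c. (c, f c)) ` crossings U"

lemma perfect_matching_graph_of:
  assumes f: "f \<in> universe_matchings U s"
  shows "perfect_matching U s (graph_of U f)"
  unfolding perfect_matching_def
proof (intro conjI ballI)
  show "graph_of U f \<subseteq> half_edges U s"
    using matchingsD(3,4)[OF f] unfolding graph_of_def half_edges_def by blast
  show "\<exists>!h. h \<in> graph_of U f \<and> fst h = c" if "c \<in> crossings U" for c
    using that unfolding graph_of_def by auto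
  show "\<exists>!h. h \<in> graph_of U f \<and> snd h = R" if "R \<in> round_vertices U s" for R
  proof -
    have bij: "bij_betw f (crossings U) (round_vertices U s)" using matchingsD(2)[OF f] .
    have "R \<in> f ` crossings U" using that bij_betw_imp_surj_on[OF bij] by simp
    then obtain c where c: "c \<in> crossings U" "f c = R" by blast
    have unique: "c' = c" if "c' \<in> crossings U" "f c' = R" for c'
      using inj_onD[OF bij_betw_imp_inj_on[OF bij], of c' c] that c by simp
    show ?thesis
    proof (rule ex1I[of _ "(c, R)"])
      show "(c, R) \<in> graph_of U f \<and> snd (c, R) = R" using c unfolding graph_of_def by auto
      fix h assume "h \<in> graph_of U f \<and> snd h = R"
      then obtain c' where "c' \<in> crossings U" "h = (c', R)" "f c' = R" unfolding graph_of_def by auto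
      then show "h = (c, R)" using unique by simp
    qed
  qed
qed

lemma inj_graph_of: "inj_on (graph_of U) (universe_matchings U s)"
proof (rule inj_onI)
  fix f g assume f: "f \<in> universe_matchings U s" and g: "g \<in> universe_matchings U s" and eq: "graph_of U f = graph_of U g"
  have "f c = g c" if "c \<in> crossings U" for c
  proof -
    have "(c, f c) \<in> graph_of U g" using that eq unfolding graph_of_def by auto
    then show ?thesis unfolding graph_of_def by auto
  qed
  then show "f = g" using matchingsD(1)[OF f] matchingsD(1)[OF g] by (rule extensionalityI[rotated 2])
qed

lemma graph_of_surj:
  assumes P: "perfect_matching U s P"
  shows "P \<in> graph_of U ` universe_matchings U s"
proof -
  have sub: "P \<subseteq> half_edges U s"
    and c1: "\<And>c. c \<in> crossings U \<Longrightarrow> \<exists>!h. h \<in> P \<and> fst h = c"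
    and R1: "\<And>R. R \<in> round_vertices U s \<Longrightarrow> \<exists>!h. h \<in> P \<and> snd h = R"
    using P unfolding perfect_matching_def by auto
  define f where "f = (\<lambda>c\<in>crossings U. THE R. (c, R) \<in> P)"
  have f: "(c, R) \<in> P \<longleftrightarrow> R = f c" if c: "c \<in> crossings U" for c R
  proof -
    obtain h where h: "h \<in> P" "fst h = c" and u: "\<And>h'. h' \<in> P \<Longrightarrow> fst h' = c \<Longrightarrow> h' = h" using c1[OF c] by blast
    have "(c, R) \<in> P \<longleftrightarrow> R = snd h" for R using h u[of "(c, R)"] by (cases h) auto
    then show ?thesis using c by (simp add: f_def)
  qed
  have P: "P = graph_of U f"
    using f sub unfolding graph_of_def half_edges_def by auto
  have "bij_betw f (crossings U) (round_vertices U s)"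
    unfolding bij_betw_def
  proof
    have fin: "f c \<in> round_vertices U s" if "c \<in> crossings U" for c
      using f[OF that, of "f c"] sub unfolding half_edges_def by auto
    show "inj_on f (crossings U)"
    proof (rule inj_onI)
      fix c c' assume c: "c \<in> crossings U" "c' \<in> crossings U" "f c = f c'"
      then have "(c, f c) \<in> P" "(c', f c) \<in> P" using f by auto
      then show "c = c'" using R1[OF fin[OF c(1)]] by (metis fst_conv snd_conv)
    qed
    show "f ` crossings U = round_vertices U s"
    proof
      show "f ` crossings U \<subseteq> round_vertices U s" using fin by auto
      show "round_vertices U s \<subseteq> f ` crossings U"
      proof
        fix R assume "R \<in> round_vertices U s"
        then obtain h where h: "h \<in> P" "snd h = R" using R1 by blast
        then have "fst h \<in> crossings U" using sub unfolding half_edges_def by auto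
        then show "R \<in> f ` crossings U" using f[of "fst h" R] h by (metis image_eqI prod.collapse)
      qed
    qed
  qed
  moreover have "incident U c (f c)" if "c \<in> crossings U" for c
    using f[OF that, of "f c"] sub unfolding half_edges_def by auto
  ultimately have "f \<in> universe_matchings U s" unfolding matchings_def by (simp add: f_def)
  then show ?thesis using P by blast
qed

lemma sum_perfect_matchings:
  "(\<Sum>P \<in> {P. perfect_matching U s P}. \<Prod>h\<in>P. F h) = (\<Sum>f\<in>universe_matchings U s. \<Prod>c\<in>crossings U. F (c, f c))"
proof -
  have "{P. perfect_matching U s P} = graph_of U ` universe_matchings U s"
    using perfect_matching_graph_of graph_of_surj by blast
  then have "(\<Sum>P \<in> {P. perfect_matching U s P}. \<Prod>h\<in>P. F h) = (\<Sum>f\<in>universe_matchings U s. \<Prod>h\<in>graph_of U f. F h)"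
    by (simp add: sum.reindex[OF inj_graph_of] o_def)
  moreover have "(\<Prod>h\<in>graph_of U f. F h) = (\<Prod>c\<in>crossings U. F (c, f c))" for f
    unfolding graph_of_def by (subst prod.reindex) (auto simp: inj_on_def o_def)
  ultimately show ?thesis by simp
qed

lemma tree_letter_active:
  "tree_letter U l V T c = L \<longleftrightarrow> active (crossings U) (incident U) l V T c"
proof -
  have "joined_by U V T' = joined (incident U) V T'" for T'
    unfolding joined_by_def joined_def edge_ends_def ends_def ..
  then have "fundamental_cocycle U V T c = {c' \<in> crossings U. separated (incident U) V (T - {c}) c'}"
    unfolding fundamental_cocycle_def separated_def edge_ends_def ends_def by simp
  then show ?thesis unfolding tree_letter_def active_def by auto
qed

text \<open>The flags \<open>True\<close> and \<open>False\<close> of \<open>colour_class\<close>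
  stand for black and white, that is, for the checkerboard graph and its dual.\<close>

lemma double_tree_letter_active:
  assumes B: "black_regions U \<subseteq> regions U" and c: "c \<in> crossings U"
  shows "double_tree_letter U l (eta U ` graph_of U f) (eta U (c, f c)) = L \<longleftrightarrow>
    active_at (crossings U) (regions U) (incident U) (is_black U) l f c"
proof -
  have V: "colour_class (regions U) (is_black U) True = black_regions U"
    "colour_class (regions U) (is_black U) False = white_regions U"
    using B unfolding colour_class_def is_black_def white_regions_def by auto
  have "{c'. Edge c' \<in> eta U ` graph_of U f} = tree_part (crossings U) (is_black U) f True"
    "{c'. Dual_Edge c' \<in> eta U ` graph_of U f} = tree_part (crossings U) (is_black U) f False"
    unfolding tree_part_def is_black_def graph_of_def eta_def by (auto simp: image_iff split: if_splits)
  then show ?thesis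
    unfolding active_at_def by (cases "f c \<in> black_regions U") (simp_all add: eta_def is_black_def V[unfolded is_black_def] tree_letter_active flip: V)
qed

lemma EI_active:
  assumes B: "black_regions U \<subseteq> regions U" and ei: "EI_property U s l"
    and f: "f \<in> universe_matchings U s" "g \<in> universe_matchings U s" and c: "c \<in> crossings U" "f c = g c"
  shows "active_at (crossings U) (regions U) (incident U) (is_black U) l f c =
    active_at (crossings U) (regions U) (incident U) (is_black U) l g c"
proof -
  have "(c, f c) \<in> half_edges U s" using matchingsD(3,4)[OF f(1) c(1)] c(1) unfolding half_edges_def by simp
  then have "EI_half_edge U s l (c, f c)" using ei unfolding EI_property_def by blast
  moreover have "(c, f c) \<in> graph_of U f" "(c, f c) \<in> graph_of U g" using c unfolding graph_of_def by auto
  ultimately have "double_tree_letter U l (eta U ` graph_of U f) (eta U (c, f c)) =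
     double_tree_letter U l (eta U ` graph_of U g) (eta U (c, f c))"
    using perfect_matching_graph_of[OF f(1)] perfect_matching_graph_of[OF f(2)] unfolding EI_half_edge_def by blast
  then show ?thesis
    using double_tree_letter_active[OF B c(1), of l f] double_tree_letter_active[OF B c(1), of l g] c(2) by simp
qed


section \<open>Bigon extensions of universes\<close>

lemma four_pred: "(i::4) + 1 - 1 = i" "(i::4) + 2 - 1 = i + 1" "(i::4) + 3 - 1 = i + 2"
  by simp_all

locale bigon_extended =
  fixes U U' :: "'c link_universe" and c c' :: 'c and k n :: 4 and h :: "'c dart \<Rightarrow> 'c dart"
  assumes U: "universe U" and U': "universe U'"
    and cU: "c \<in> crossings U" and c'U: "c' \<notin> crossings U" and crossings': "crossings U' = insert c' (crossings U)"
    and hdef: "h = (\<lambda>d. if d = (c, k + 2) then (c', n + 2) else if d = (c, k + 3) then (c', n + 3) else d)"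
    and glue_h: "\<And>d. d \<in> darts U \<Longrightarrow> glue U' (h d) = h (glue U d)"
    and glue_2: "glue U' (c, k + 2) = (c', n + 1)" and glue_3: "glue U' (c, k + 3) = (c', n)"
    and outer': "h ` outer U \<subseteq> outer U'"
begin

sublocale bigon_gluing "crossings U" c c' "glue U" "glue U'" k n h
  using universeD[OF U] universeD[OF U'] cU c'U crossings' hdef glue_h glue_2 glue_3
  by unfold_locales (simp_all add: darts_def)

text \<open>Sends a corner outside the bigon to an old corner of the corresponding region. It undoes
  \<open>h\<close>. The regions along the twist have gained one corner each,
  \<open>(c', n + 1)\<close> and \<open>(c, k + 3)\<close>; the corner next to it in the region is
  an image under \<open>h\<close> and determines its value.\<close>

definition slide :: "'c dart \<Rightarrow> 'c dart" where
  "slide e = (if e = (c', n + 1) then (c, k + 1) else if e = (c', n + 2) then (c, k + 2)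
     else if e = (c', n + 3) then (c, k + 3) else e)"

definition bigon :: "'c region" where
  "bigon = {(c, k + 2), (c', n)}"

lemma next_new:
  "next_corner U' (c, k + 2) = (c', n)" "next_corner U' (c', n) = (c, k + 2)"
  "next_corner U' (c, k + 3) = (c', n + 3)" "next_corner U' (c', n + 1) = (c, k + 1)"
  using glue_2 glue_3 g'_new by (simp_all add: next_corner_def four_shift)

lemma new_darts: "(c, i) \<in> darts U" "(c, i) \<in> darts U'" "(c', i) \<in> darts U'" "x \<in> crossings U \<Longrightarrow> (x, i) \<in> darts U"
  using cU crossings' by (auto simp: darts_def)

lemma region_bigon: "region U' (c, k + 2) = bigon" "region U' (c', n) = bigon"
proof -
  have "e \<in> bigon" if "e \<in> region U' (c, k + 2)" for e
  proof -
    have "e \<in> bigon \<and> (\<lambda>_. ()) e = (\<lambda>_. ()) (c, k + 2)"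
      by (rule orbit_invariant[OF that[unfolded region_def]]) (use next_new in \<open>auto simp: bigon_def\<close>)
    then show ?thesis by simp
  qed
  moreover have "(c, k + 2) \<in> region U' (c, k + 2)" by (rule self_in_region[OF U' new_darts(2)])
  moreover have "(c', n) \<in> region U' (c, k + 2)"
    using orbit.base[of "next_corner U'" "(c, k + 2)"] next_new(1) unfolding region_def by simp
  ultimately show b: "region U' (c, k + 2) = bigon" unfolding bigon_def by blast
  show "region U' (c', n) = bigon"
    using region_next_corner[OF U' new_darts(2), of "k + 2"] next_new(1) b by simp
qed

lemma h_darts: "d \<in> darts U \<Longrightarrow> h d \<in> darts U'"
  using h_in crossings' unfolding darts_def by simp

lemma slide_h:
  assumes "d \<in> darts U"
  shows "slide (h d) = d" "h d \<notin> bigon"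
proof -
  have "fst d \<noteq> c'" using assms c'U by (auto simp: darts_def)
  then show "slide (h d) = d" "h d \<notin> bigon"
    using neq unfolding slide_def bigon_def hdef by (cases d; auto)+
qed

lemma slide_cases:
  assumes "e \<in> darts U'" "e \<notin> bigon"
  shows "slide e \<in> darts U \<and> (e = h (slide e) \<or> next_corner U' e = h (slide e))"
proof -
  have e: "e \<in> insert c' (crossings U) \<times> UNIV" using assms(1) crossings' by (simp add: darts_def)
  show ?thesis
  proof (cases rule: dart_cases[OF e])
    case (1 d)
    then have "d \<in> darts U" by (simp add: darts_def)
    then show ?thesis using slide_h 1 by simp
  next
    case 3
    have "slide e = (c, k + 3)" using 3 neq by (simp add: slide_def)
    then show ?thesis using new_darts(1) next_new(3) h_at_c(4) 3 by simp
  next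
    case 5
    have "slide e = (c, k + 1)" using 5 by (simp add: slide_def)
    then show ?thesis using new_darts(1) next_new(4) h_at_c(2) 5 by simp
  qed (use assms(2) in \<open>simp_all add: bigon_def\<close>)
qed

lemma next_h:
  assumes "d \<in> darts U"
  shows "next_corner U' (h d) \<notin> bigon" "slide (next_corner U' (h d)) = next_corner U d"
proof -
  obtain x j where g: "glue U d = (x, j)" by (cases "glue U d")
  then have x: "x \<in> crossings U" using universeD(4)[OF U assms] by (simp add: darts_def)
  then have xc': "x \<noteq> c'" using c'U by auto
  have g': "glue U' (h d) = h (x, j)" using glue_h[OF assms] g by simp
  have "next_corner U' (h d) \<notin> bigon \<and> slide (next_corner U' (h d)) = next_corner U d"
  proof (cases "x = c")
    case False
    then have "h (x, j) = (x, j)" by (simp add: hdef)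
    then show ?thesis using g g' False xc' by (simp add: next_corner_def slide_def bigon_def)
  next
    case True
    have g'c: "next_corner U' (h d) = (case h (c, j) of (y, i) \<Rightarrow> (y, i - 1))" "next_corner U d = (c, j - 1)"
      using g g' True by (simp_all add: next_corner_def)
    consider "j = k" | "j = k + 1" | "j = k + 2" | "j = k + 3" using four_cases[of j k] by auto
    then show ?thesis
      by cases (use g'c h_at_c neq in \<open>simp_all add: slide_def bigon_def four_shift\<close>)
  qed
  then show "next_corner U' (h d) \<notin> bigon" "slide (next_corner U' (h d)) = next_corner U d" by auto
qed

lemma region_slide:
  assumes "e \<in> darts U'" "e \<notin> bigon"
  shows "region U' e = region U' (h (slide e))"
  using slide_cases[OF assms] region_next_corner[OF U' assms(1)] by metis

text \<open>Each direction follows a quantity that is constant on regions: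
  \<open>region U' (h d)\<close> over the old corners, and \<open>region U (slide e)\<close> over
  the new corners outside the bigon.\<close>

lemma region_h_iff:
  assumes d: "d \<in> darts U" and e: "e \<in> darts U"
  shows "region U' (h d) = region U' (h e) \<longleftrightarrow> region U d = region U e"
proof
  have 1: "region U' (h (next_corner U x)) = region U' (h x)" if x: "x \<in> darts U" for x
    using region_slide[OF next_corner_in[OF U' h_darts[OF x]] next_h(1)[OF x]] next_h(2)[OF x]
      region_next_corner[OF U' h_darts[OF x]] by simp
  assume eq: "region U d = region U e"
  show "region U' (h d) = region U' (h e)"
    by (rule region_eqD[OF U d e eq, where A = "darts U"]) (use d next_corner_in[OF U] 1 in simp_all)
next
  have 2: "next_corner U' x \<in> darts U' - bigon \<and> region U (slide (next_corner U' x)) = region U (slide x)"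
    if x: "x \<in> darts U' - bigon" for x
  proof -
    have xs: "slide x \<in> darts U" "x = h (slide x) \<or> next_corner U' x = h (slide x)" using slide_cases x by blast+
    from xs(2) show ?thesis
    proof
      assume "x = h (slide x)"
      then have "next_corner U' x \<notin> bigon" "slide (next_corner U' x) = next_corner U (slide x)"
        using next_h[OF xs(1)] by simp_all
      then show ?thesis using next_corner_in[OF U'] x region_next_corner[OF U xs(1)] by simp
    next
      assume "next_corner U' x = h (slide x)"
      then show ?thesis using slide_h[OF xs(1)] h_darts[OF xs(1)] by simp
    qed
  qed
  assume eq: "region U' (h d) = region U' (h e)"
  have "region U (slide (h d)) = region U (slide (h e))"
    by (rule region_eqD[OF U' h_darts[OF d] h_darts[OF e] eq 2]) (use h_darts[OF d] slide_h(2)[OF d] in simp_all)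
  then show "region U d = region U e" using slide_h d e by simp
qed

text \<open>The choice of the corner is immaterial, because \<open>h\<close> respects equality of
  regions.\<close>

definition lift :: "'c region \<Rightarrow> 'c region" where
  "lift R = region U' (h (SOME d. d \<in> darts U \<and> region U d = R))"

lemma lift_region:
  assumes "d \<in> darts U"
  shows "lift (region U d) = region U' (h d)"
proof -
  define e where "e = (SOME e. e \<in> darts U \<and> region U e = region U d)"
  have "e \<in> darts U \<and> region U e = region U d" unfolding e_def by (rule someI[of _ d]) (use assms in simp)
  then show ?thesis using region_h_iff[of e d] assms unfolding lift_def e_def[symmetric] by simp
qed

lemma region_h_bigon: "d \<in> darts U \<Longrightarrow> region U' (h d) \<noteq> bigon"
  using self_in_region[OF U' h_darts] slide_h(2) by metis

lemma inj_lift: "inj_on lift (regions U)"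
  unfolding regions_def by (rule inj_onI) (auto simp: lift_region region_h_iff)

lemma lift_bigon: "bigon \<notin> lift ` regions U"
  unfolding regions_def using region_h_bigon lift_region by force

lemma corner_lift:
  "x \<in> crossings U \<Longrightarrow> x \<noteq> c \<Longrightarrow> region U' (x, i) = lift (region U (x, i))"
  "region U' (c, k) = lift (region U (c, k))" "region U' (c, k + 1) = lift (region U (c, k + 1))"
  "region U' (c, k + 3) = lift (region U (c, k + 3))" "region U' (c', n + 1) = lift (region U (c, k + 1))"
  "region U' (c', n + 2) = lift (region U (c, k + 2))" "region U' (c', n + 3) = lift (region U (c, k + 3))"
proof -
  show "x \<in> crossings U \<Longrightarrow> x \<noteq> c \<Longrightarrow> region U' (x, i) = lift (region U (x, i))"
    using lift_region[OF new_darts(4)] by (simp add: hdef)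
  show "region U' (c, k) = lift (region U (c, k))" "region U' (c, k + 1) = lift (region U (c, k + 1))"
    "region U' (c', n + 2) = lift (region U (c, k + 2))" "region U' (c', n + 3) = lift (region U (c, k + 3))"
    using lift_region[OF new_darts(1)] h_at_c by simp_all
  have "(c, k + 3) \<notin> bigon" "(c', n + 1) \<notin> bigon" using neq by (auto simp: bigon_def)
  moreover have "slide (c, k + 3) = (c, k + 3)" "slide (c', n + 1) = (c, k + 1)" using neq by (auto simp: slide_def)
  ultimately show "region U' (c, k + 3) = lift (region U (c, k + 3))" "region U' (c', n + 1) = lift (region U (c, k + 1))"
    using region_slide[OF new_darts(2), of "k + 3"] region_slide[OF new_darts(3), of "n + 1"] lift_region[OF new_darts(1)]
    by simp_all
qed

lemma regions': "regions U' = insert bigon (lift ` regions U)"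
proof
  show "regions U' \<subseteq> insert bigon (lift ` regions U)"
  proof
    fix R assume "R \<in> regions U'"
    then obtain e where e: "e \<in> darts U'" "R = region U' e" unfolding regions_def by auto
    show "R \<in> insert bigon (lift ` regions U)"
    proof (cases "e \<in> bigon")
      case True
      then have "e = (c, k + 2) \<or> e = (c', n)" by (simp add: bigon_def)
      then show ?thesis using e(2) region_bigon by (elim disjE) simp_all
    next
      case False
      then have "R = lift (region U (slide e))" "slide e \<in> darts U"
        using region_slide e slide_cases lift_region by metis+
      then show ?thesis unfolding regions_def by blast
    qed
  qed
  have "bigon \<in> regions U'" using region_bigon(1) new_darts(2) unfolding regions_def by (metis imageI)
  moreover have "lift (region U d) \<in> regions U'" if "d \<in> darts U" for d
    using lift_region[OF that] h_darts[OF that] unfolding regions_def by simp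
  ultimately show "insert bigon (lift ` regions U) \<subseteq> regions U'" unfolding regions_def by auto
qed

lemma incident_bigon: "incident U' c bigon" "incident U' c' bigon" "x \<in> crossings U \<Longrightarrow> x \<noteq> c \<Longrightarrow> \<not> incident U' x bigon"
proof -
  show "incident U' c bigon" "incident U' c' bigon" unfolding incident_def using region_bigon by metis+
  assume x: "x \<in> crossings U" "x \<noteq> c"
  then have "bigon \<noteq> lift (region U (x, i))" for i
    using lift_bigon new_darts(4)[OF x(1)] unfolding regions_def by auto
  then show "\<not> incident U' x bigon" unfolding incident_def using corner_lift(1)[OF x] by simp
qed

lemma lift_eq_iff: "R \<in> regions U \<Longrightarrow> d \<in> darts U \<Longrightarrow> lift R = lift (region U d) \<longleftrightarrow> R = region U d"
  using inj_lift unfolding inj_on_def regions_def by blast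

lemma incident_lift:
  assumes R: "R \<in> regions U"
  shows "x \<in> crossings U \<Longrightarrow> x \<noteq> c \<Longrightarrow> incident U' x (lift R) \<longleftrightarrow> incident U x R"
    "incident U c R \<longleftrightarrow> R \<in> {region U (c, k), region U (c, k + 2), region U (c, k + 1), region U (c, k + 3)}"
    "incident U' c (lift R) \<longleftrightarrow> R \<in> {region U (c, k), region U (c, k + 1), region U (c, k + 3)}"
    "incident U' c' (lift R) \<longleftrightarrow> R \<in> {region U (c, k + 2), region U (c, k + 1), region U (c, k + 3)}"
proof -
  have ex: "(\<exists>i. Q i) \<longleftrightarrow> Q j \<or> Q (j + 1) \<or> Q (j + 2) \<or> Q (j + 3)" for Q and j :: 4
    using four_cases[of _ j] by metis
  have nb: "lift R \<noteq> bigon" using R lift_bigon by auto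
  note eq = lift_eq_iff[OF R new_darts(1)]
  show "incident U' x (lift R) \<longleftrightarrow> incident U x R" if "x \<in> crossings U" "x \<noteq> c"
    unfolding incident_def corner_lift(1)[OF that] using lift_eq_iff[OF R new_darts(4)[OF that(1)]] by simp
  show "incident U c R \<longleftrightarrow> R \<in> {region U (c, k), region U (c, k + 2), region U (c, k + 1), region U (c, k + 3)}"
    unfolding incident_def ex[of _ k] by auto
  show "incident U' c (lift R) \<longleftrightarrow> R \<in> {region U (c, k), region U (c, k + 1), region U (c, k + 3)}"
    unfolding incident_def ex[of _ k] corner_lift(2-4) region_bigon eq using nb by auto
  show "incident U' c' (lift R) \<longleftrightarrow> R \<in> {region U (c, k + 2), region U (c, k + 1), region U (c, k + 3)}"
    unfolding incident_def ex[of _ n] corner_lift(5-7) region_bigon eq using nb by auto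
qed

text \<open>The omitted regions of the transferred segment are the lifts of the old ones. The bigon
  is never omitted, as no image under \<open>h\<close> lies in it.\<close>

lemma round_vertices_h:
  assumes "s \<subseteq> darts U"
  shows "round_vertices U' (h ` s) = insert bigon (lift ` round_vertices U s)"
proof -
  have "region U' ` h ` s = lift ` region U ` s"
    using lift_region assms by (auto simp: image_image subset_iff intro!: image_cong)
  moreover have "region U ` s \<subseteq> regions U" using assms unfolding regions_def by auto
  ultimately show ?thesis
    unfolding round_vertices_def regions' using lift_bigon inj_on_image_set_diff[OF inj_lift, of "regions U" "region U ` s"]
    by auto
qed

lemma outer_lift: "outer U' = lift (outer U)"
proof -
  obtain d where d: "d \<in> darts U" "outer U = region U d" using U unfolding universe_def regions_def by auto
  obtain e where e: "e \<in> darts U'" "outer U' = region U' e" using U' unfolding universe_def regions_def by auto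
  have "h d \<in> region U' e" using self_in_region[OF U d(1)] outer' d e by auto
  then show ?thesis using region_eqI[OF U' e(1)] d e lift_region[OF d(1)] by simp
qed

section \<open>Colouring the extended universe\<close>

definition black' :: "'c region set \<Rightarrow> 'c region set" where
  "black' Bk = lift ` Bk \<union> (if region U (c, k) \<in> Bk then {bigon} else {})"

lemma black'_iff:
  assumes "Bk \<subseteq> regions U"
  shows "R \<in> regions U \<Longrightarrow> lift R \<in> black' Bk \<longleftrightarrow> R \<in> Bk" "bigon \<in> black' Bk \<longleftrightarrow> region U (c, k) \<in> Bk"
proof -
  have "lift R \<in> lift ` Bk \<longleftrightarrow> R \<in> Bk" if "R \<in> regions U" for R
    using inj_on_image_mem_iff[OF inj_lift that assms] .
  then show "R \<in> regions U \<Longrightarrow> lift R \<in> black' Bk \<longleftrightarrow> R \<in> Bk" unfolding black'_def using lift_bigon by auto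
  show "bigon \<in> black' Bk \<longleftrightarrow> region U (c, k) \<in> Bk" unfolding black'_def using lift_bigon assms by auto
qed

lemma checkerboard_black':
  assumes B: "checkerboard U Bk"
  shows "checkerboard U' (black' Bk)"
proof -
  have sub: "Bk \<subseteq> regions U" and out: "outer U \<notin> Bk" using B unfolding checkerboard_def by auto
  have reg: "region U (x, i) \<in> regions U" if "x \<in> crossings U" for x i
    using new_darts(4)[OF that] unfolding regions_def by blast
  note mem = black'_iff(1)[OF sub reg] black'_iff(1)[OF sub reg[OF cU]] black'_iff(2)[OF sub]
  have par: "region U (c, k + 1) \<in> Bk \<longleftrightarrow> region U (c, k) \<notin> Bk" "region U (c, k + 2) \<in> Bk \<longleftrightarrow> region U (c, k) \<in> Bk"
    "region U (c, k + 3) \<in> Bk \<longleftrightarrow> region U (c, k) \<notin> Bk"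
    by (simp_all add: checkerboard_parity[OF B cU, of "k + 1" k] checkerboard_parity[OF B cU, of "k + 2" k]
      checkerboard_parity[OF B cU, of "k + 3" k] odd4_add)
  have "region U' (x, i) \<in> black' Bk \<longleftrightarrow> region U' (x, i - 1) \<notin> black' Bk" if x': "x \<in> crossings U'" for x i
  proof -
    consider "x \<in> crossings U" "x \<noteq> c" | "x = c" | "x = c'"
      using x' unfolding crossings' by blast
    then show ?thesis
    proof cases
      case 1
      then show ?thesis
        using mem(1)[OF 1(1)] corner_lift(1)[OF 1] checkerboard_alt[OF B 1(1), of "i - 1"] by simp
    next
      case 2
      consider "i = k" | "i = k + 1" | "i = k + 2" | "i = k + 3" using four_cases[of i k] by auto
      then show ?thesis
        by cases (simp_all add: 2 four_shift(1)[of k] four_pred corner_lift region_bigon mem par)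
    next
      case 3
      consider "i = n" | "i = n + 1" | "i = n + 2" | "i = n + 3" using four_cases[of i n] by auto
      then show ?thesis
        by cases (simp_all add: 3 four_shift(1)[of n] four_pred corner_lift region_bigon mem par)
    qed
  qed
  moreover have "black' Bk \<subseteq> regions U'" unfolding black'_def regions' using sub by auto
  moreover have "outer U' \<notin> black' Bk"
    using out black'_iff(1)[OF sub, of "outer U"] U unfolding outer_lift universe_def by simp
  ultimately show ?thesis unfolding checkerboard_def darts_def by blast
qed

lemma is_black_lift:
  assumes B: "checkerboard U Bk"
  shows "R \<in> regions U \<Longrightarrow> is_black U' (lift R) \<longleftrightarrow> is_black U R" "is_black U' bigon \<longleftrightarrow> is_black U (region U (c, k))"
proof -
  have "Bk \<subseteq> regions U" using B unfolding checkerboard_def by auto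
  from black'_iff[OF this]
  show "R \<in> regions U \<Longrightarrow> is_black U' (lift R) \<longleftrightarrow> is_black U R" "is_black U' bigon \<longleftrightarrow> is_black U (region U (c, k))"
    unfolding is_black_def black_regions_eq[OF U B] black_regions_eq[OF U' checkerboard_black'[OF B]] by simp_all
qed

text \<open>The surviving crossing keeps its name, so \<open>c\<close> serves both as the split
  crossing and as the first of the new ones. The separated regions differ because \<open>c\<close>
  is not nugatory, and a natural labeling puts both new crossings in the place of the old
  one.\<close>

lemma crossing_split:
  assumes B: "checkerboard U Bk" and s: "s \<subseteq> darts U" and inj: "inj_on l (crossings U)"
    and nat: "natural_labeling U l c c' l'"
  shows "crossing_split (crossings U - {c}) c c c' (regions U) (round_vertices U s) (incident U) (is_black U) l
    (crossings U') (regions U') (round_vertices U' (h ` s)) (incident U') (is_black U') l' lift bigon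
    (region U (c, k)) (region U (c, k + 2)) (region U (c, k + 1)) (region U (c, k + 3)) (is_black U (region U (c, k)))"
proof -
  have reg: "region U (c, i) \<in> regions U" for i using new_darts(1) unfolding regions_def by blast
  have ne: "region U (c, k) \<noteq> region U (c, k + 2)" using U cU unfolding universe_def nugatory_def by auto
  have col: "is_black U (region U (c, k + 1)) = (\<not> is_black U (region U (c, k)))"
    "is_black U (region U (c, k + 2)) = is_black U (region U (c, k))"
    "is_black U (region U (c, k + 3)) = (\<not> is_black U (region U (c, k)))"
    unfolding is_black_def black_regions_eq[OF U B]
    by (simp_all add: checkerboard_parity[OF B cU, of "k + 1" k] checkerboard_parity[OF B cU, of "k + 2" k]
      checkerboard_parity[OF B cU, of "k + 3" k] odd4_add)
  have lne: "l x \<noteq> l c" if "x \<in> crossings U - {c}" for x using inj that cU by (auto dest: inj_onD)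
  have l': "l' x = (if l x < l c then l x else l x + 1)" if "x \<in> crossings U - {c}" for x
    using nat lne[OF that] that unfolding natural_labeling_def by auto
  have l'c: "l' c = l c \<and> l' c' = l c + 1 \<or> l' c = l c + 1 \<and> l' c' = l c"
    using nat unfolding natural_labeling_def by blast
  show ?thesis
  proof
    show "finite (crossings U - {c})" using universeD(1)[OF U] by simp
    show "crossings U' = insert c (insert c' (crossings U - {c}))" using crossings' cU by auto
    show "regions U' = insert bigon (lift ` regions U)" by (rule regions')
    show "inj_on lift (regions U)" by (rule inj_lift)
    show "bigon \<notin> lift ` regions U" by (rule lift_bigon)
    show "round_vertices U s \<subseteq> regions U" unfolding round_vertices_def by auto
    show "round_vertices U' (h ` s) = insert bigon (lift ` round_vertices U s)" by (rule round_vertices_h[OF s])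
    show "l' x \<le> l' y \<longleftrightarrow> l x \<le> l y" if "x \<in> crossings U - {c}" "y \<in> crossings U - {c}" for x y
      using l'[OF that(1)] l'[OF that(2)] by (auto split: if_splits)
    show "l' x \<le> l' c \<longleftrightarrow> l x \<le> l c" "l' c \<le> l' x \<longleftrightarrow> l c \<le> l x"
      "l' x \<le> l' c' \<longleftrightarrow> l x \<le> l c" "l' c' \<le> l' x \<longleftrightarrow> l c \<le> l x" if "x \<in> crossings U - {c}" for x
      using l'[OF that] lne[OF that] l'c by (auto split: if_splits)
    show "l' c \<noteq> l' c'" using l'c by auto
  qed (use neq c'U incident_bigon incident_lift reg ne col is_black_lift[OF B] in auto)
qed

end


section \<open>Expansion of admissible universes\<close>

definition black_odd :: "'c link_universe \<Rightarrow> 'c \<Rightarrow> bool" where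
  "black_odd U x \<longleftrightarrow> is_black U (region U (x, 1))"

text \<open>The weight of merging the corners of colour \<open>b\<close>.\<close>

definition colour_weight :: "'c link_universe \<Rightarrow> ('c \<Rightarrow> bool \<Rightarrow> laurent) \<Rightarrow> bool \<Rightarrow> 'c \<Rightarrow> laurent" where
  "colour_weight U w b x = w x (b \<longleftrightarrow> black_odd U x)"

lemma is_black_odd:
  assumes "universe U" "checkerboard U Bk" "x \<in> crossings U"
  shows "is_black U (region U (x, i)) \<longleftrightarrow> (black_odd U x \<longleftrightarrow> odd4 i)"
  unfolding black_odd_def is_black_def black_regions_eq[OF assms(1,2)]
  using checkerboard_parity[OF assms(2,3), of i 1] by (auto simp: odd4_def)

text \<open>The full induction invariant. The existence of a checkerboard colouring is inherited
  from the Hopf link universe and gives \<open>black_regions\<close> its meaning. The weights are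
  quantified inside, because the induction step changes them.\<close>

definition expands :: "'c link_universe \<Rightarrow> 'c dart set \<Rightarrow> ('c \<Rightarrow> nat) \<Rightarrow> bool" where
  "expands U s l \<longleftrightarrow> universe U \<and> s \<subseteq> darts U \<and> inj_on l (crossings U) \<and> (\<exists>Bk. checkerboard U Bk) \<and>
     coherent (crossings U) (regions U) (round_vertices U s) (incident U) (is_black U) l \<and>
     (\<forall>w. state_sum (crossings U) (glue U, 0) w =
        matching_sum (crossings U) (round_vertices U s) (incident U) (is_black U) l (colour_weight U w))"

lemma finite_matchings:
  assumes "finite C" "finite X"
  shows "finite (matchings C X I)"
proof -
  have "matchings C X I \<subseteq> PiE C (\<lambda>_. X)"
    unfolding matchings_def PiE_def by (auto dest: bij_betw_apply)
  then show ?thesis using finite_PiE[OF assms(1), of "\<lambda>_. X"] assms(2) finite_subset by blast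
qed

text \<open>\<open>merged_weight\<close> speaks of parities, the matching sum of colours. The two
  match because the colour of the bigon is found at the parity of \<open>k\<close> at
  \<open>c\<close> and at the parity of \<open>n\<close> at \<open>c'\<close>.\<close>

lemma (in bigon_extended) colour_weight_merged:
  assumes B: "checkerboard U Bk"
  defines "\<beta> \<equiv> is_black U (region U (c, k))"
  shows "x \<in> crossings U - {c} \<Longrightarrow> colour_weight U (merged_weight w) b x = colour_weight U' w b x"
    "colour_weight U (merged_weight w) \<beta> c = colour_weight U' w \<beta> c * colour_weight U' w \<beta> c'"
    "colour_weight U (merged_weight w) (\<not> \<beta>) c = colour_weight U' w \<beta> c * colour_weight U' w (\<not> \<beta>) c' +
      colour_weight U' w (\<not> \<beta>) c * colour_weight U' w \<beta> c' +
      loop_value * colour_weight U' w (\<not> \<beta>) c * colour_weight U' w (\<not> \<beta>) c'"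
proof -
  note B' = checkerboard_black'[OF B]
  have reg: "region U (x, i) \<in> regions U" if "x \<in> crossings U" for x i
    using new_darts(4)[OF that] unfolding regions_def by blast
  have c: "c \<in> crossings U'" "c' \<in> crossings U'" using crossings' cU by auto
  have 1: "\<beta> \<longleftrightarrow> (black_odd U c \<longleftrightarrow> odd4 k)" unfolding \<beta>_def by (rule is_black_odd[OF U B cU])
  have 2: "\<beta> \<longleftrightarrow> (black_odd U' c \<longleftrightarrow> odd4 k)"
    using is_black_odd[OF U' B' c(1), of k] is_black_lift(1)[OF B reg[OF cU]] unfolding \<beta>_def corner_lift(2) by simp
  have 3: "\<beta> \<longleftrightarrow> (black_odd U' c' \<longleftrightarrow> odd4 n)"
    using is_black_odd[OF U' B' c(2), of n] is_black_lift(2)[OF B] unfolding \<beta>_def region_bigon by simp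
  show "colour_weight U (merged_weight w) b x = colour_weight U' w b x" if x: "x \<in> crossings U - {c}"
  proof -
    have "black_odd U' x = black_odd U x"
      using corner_lift(1)[of x 1] is_black_lift(1)[OF B reg[of x]] x unfolding black_odd_def by simp
    then show ?thesis using x by (simp add: colour_weight_def merged_weight_def)
  qed
  have "(\<beta> \<longleftrightarrow> black_odd U c) = odd4 k" "(\<beta> \<longleftrightarrow> black_odd U' c) = odd4 k" "(\<beta> \<longleftrightarrow> black_odd U' c') = odd4 n"
    "((\<not> \<beta>) \<longleftrightarrow> black_odd U c) = (\<not> odd4 k)" "((\<not> \<beta>) \<longleftrightarrow> black_odd U' c) = (\<not> odd4 k)"
    "((\<not> \<beta>) \<longleftrightarrow> black_odd U' c') = (\<not> odd4 n)"
    using 1 2 3 by argo+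
  note e = this
  show "colour_weight U (merged_weight w) \<beta> c = colour_weight U' w \<beta> c * colour_weight U' w \<beta> c'"
    "colour_weight U (merged_weight w) (\<not> \<beta>) c = colour_weight U' w \<beta> c * colour_weight U' w (\<not> \<beta>) c' +
      colour_weight U' w (\<not> \<beta>) c * colour_weight U' w \<beta> c' +
      loop_value * colour_weight U' w (\<not> \<beta>) c * colour_weight U' w (\<not> \<beta>) c'"
    unfolding colour_weight_def e merged_weight_def by simp_all
qed

lemma (in bigon_extended) expands_extended:
  assumes e: "expands U s l" and nat: "natural_labeling U l c c' l'" and ei: "EI_property U' (h ` s) l'"
  shows "expands U' (h ` s) l'"
proof -
  obtain Bk where B: "checkerboard U Bk" using e unfolding expands_def by blast
  have s: "s \<subseteq> darts U" and inj: "inj_on l (crossings U)"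
    and coh: "coherent (crossings U) (regions U) (round_vertices U s) (incident U) (is_black U) l"
    and sum: "\<And>w. state_sum (crossings U) (glue U, 0) w =
        matching_sum (crossings U) (round_vertices U s) (incident U) (is_black U) l (colour_weight U w)"
    using e unfolding expands_def by blast+
  note B' = checkerboard_black'[OF B]
  interpret sp: crossing_split "crossings U - {c}" c c c' "regions U" "round_vertices U s" "incident U" "is_black U" l
    "crossings U'" "regions U'" "round_vertices U' (h ` s)" "incident U'" "is_black U'" l' lift bigon
    "region U (c, k)" "region U (c, k + 2)" "region U (c, k + 1)" "region U (c, k + 3)" "is_black U (region U (c, k))"
    by (rule crossing_split[OF B s inj nat])
  have C: "insert c (crossings U - {c}) = crossings U" using cU by auto
  have sub: "black_regions U' \<subseteq> regions U'"
    using B' unfolding black_regions_eq[OF U' B'] checkerboard_def by blast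
  have bc: "sp.bigon_coherent"
    unfolding sp.bigon_coherent_def
  proof (intro ballI impI)
    fix x f g assume "x \<in> {c, c'}" "f \<in> universe_matchings U' (h ` s)" "g \<in> universe_matchings U' (h ` s)" "f x = bigon" "g x = bigon"
    moreover from this have "x \<in> crossings U'" using crossings' cU by auto
    ultimately show "active_at (crossings U') (regions U') (incident U') (is_black U') l' f x =
        active_at (crossings U') (regions U') (incident U') (is_black U') l' g x"
      by (intro EI_active[OF sub ei]) simp_all
  qed
  have "finite (round_vertices U s)"
    using universeD(2)[OF U] unfolding round_vertices_def regions_def by simp
  then have fin: "finite (matchings (insert c (crossings U - {c})) (round_vertices U s) (incident U))"
    using universeD(1)[OF U] unfolding C by (intro finite_matchings)
  have coh': "coherent (insert c (crossings U - {c})) (regions U) (round_vertices U s) (incident U) (is_black U) l"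
    unfolding C by (rule coh)
  have "coherent (crossings U') (regions U') (round_vertices U' (h ` s)) (incident U') (is_black U') l'"
    by (rule sp.coherent_split[OF coh' bc])
  moreover have "state_sum (crossings U') (glue U', 0) w =
      matching_sum (crossings U') (round_vertices U' (h ` s)) (incident U') (is_black U') l' (colour_weight U' w)" for w
  proof -
    have "matching_sum (crossings U') (round_vertices U' (h ` s)) (incident U') (is_black U') l' (colour_weight U' w) =
      matching_sum (insert c (crossings U - {c})) (round_vertices U s) (incident U) (is_black U) l (colour_weight U (merged_weight w))"
      by (rule sp.matching_sum_split[OF coh' bc colour_weight_merged[OF B] fin])
    then show ?thesis using state_sum_bigon[of w] sum unfolding C crossings' by simp
  qed
  moreover have "inj_on l' (crossings U')"
  proof (rule inj_onI)
    fix x y assume xy: "x \<in> crossings U'" "y \<in> crossings U'" "l' x = l' y"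
    have cases: "z \<in> crossings U - {c} \<or> z = c \<or> z = c'" if "z \<in> crossings U'" for z
      using that crossings' by blast
    have ne: "l z \<noteq> l c" if "z \<in> crossings U - {c}" for z using inj that cU by (auto dest: inj_onD)
    have new: "l' z \<noteq> l' c \<and> l' z \<noteq> l' c'" if z: "z \<in> crossings U - {c}" for z
      using sp.l1[OF z] sp.l2[OF z] ne[OF z] by (metis order.antisym order_refl)
    have old: "x = y" if z: "x \<in> crossings U - {c}" "y \<in> crossings U - {c}"
    proof -
      have "l x = l y" using sp.lE[OF z] sp.lE[OF z(2,1)] xy(3) by simp
      then show ?thesis using inj z by (auto dest: inj_onD)
    qed
    show "x = y"
      using cases[OF xy(1)] cases[OF xy(2)] old new xy(3) sp.l12 by metis
  qed
  moreover have "h ` s \<subseteq> darts U'" using s h_darts by blast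
  ultimately show ?thesis unfolding expands_def using U' B' by blast
qed

lemma expands_admissible_extension:
  assumes e: "expands U s l" and ext: "admissible_extension U s l U' s' l'"
  shows "expands U' s' l'"
proof -
  obtain c c' k m where U': "universe U'" and c: "c \<in> crossings U" "c' \<notin> crossings U"
    and C': "crossings U' = insert c' (crossings U)"
    and g: "\<forall>d\<in>darts U. glue U' (transfer c c' k m d) = transfer c c' k m (glue U d)"
    and g23: "glue U' (c, k + 2) = (c', k + 1 + m)" "glue U' (c, k + 3) = (c', k + m)"
    and out: "transfer c c' k m ` outer U \<subseteq> outer U'" and s': "s' = transfer c c' k m ` s"
    and nat: "natural_labeling U l c c' l'" and ei: "EI_property U' s' l'"
    using ext unfolding admissible_extension_def bigon_extension_def by blast
  \<comment> \<open>Indices at \<open>c'\<close> are counted from the corner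
    \<open>(c', k + m)\<close> of the bigon.\<close>
  interpret bigon_extended U U' c c' k "k + m" "transfer c c' k m"
  proof
    show "universe U" using e unfolding expands_def by blast
    show "transfer c c' k m = (\<lambda>d. if d = (c, k + 2) then (c', k + m + 2) else if d = (c, k + 3) then (c', k + m + 3) else d)"
      unfolding transfer_def by (auto simp: fun_eq_iff algebra_simps)
    show "glue U' (c, k + 2) = (c', k + m + 1)" using g23 by (simp add: algebra_simps)
  qed (use U' c C' g g23 out in auto)
  show ?thesis using expands_extended[OF e nat] ei s' by simp
qed

section \<open>The Hopf link universe\<close>

text \<open>All four regions meet both crossings, so each graph is a pair of parallel edges. A tree
  is a single edge whose cocycle consists of both crossings; activity and lowest label are then the
  same comparison.\<close>

lemma hopf_coherent:
  fixes q :: "'r \<Rightarrow> bool" and l :: "'c \<Rightarrow> nat"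
  assumes ab: "a \<noteq> b" "l a \<noteq> l b" and R: "distinct [P0, P1, Q0, Q1]"
    and q: "q P0 = \<beta>" "q P1 = \<beta>" "q Q0 = (\<not> \<beta>)" "q Q1 = (\<not> \<beta>)"
    and I: "\<And>x R. x \<in> {a, b} \<Longrightarrow> R \<in> {P0, P1, Q0, Q1} \<Longrightarrow> I x R"
  shows "coherent {a, b} {P0, P1, Q0, Q1} {P0, Q0} I q l"
    "matching_sum {a, b} {P0, Q0} I q l m = m \<beta> a * m (\<not> \<beta>) b + m (\<not> \<beta>) a * m \<beta> b +
      loop_value * (m \<beta> a * m \<beta> b + m (\<not> \<beta>) a * m (\<not> \<beta>) b)"
proof -
  let ?N = "{P0, P1, Q0, Q1}" and ?M = "matchings {a, b} {P0, Q0} I"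
  define f1 where "f1 = (\<lambda>x\<in>{a, b}. if x = a then P0 else Q0)"
  define f2 where "f2 = (\<lambda>x\<in>{a, b}. if x = a then Q0 else P0)"
  have f1: "f1 a = P0" "f1 b = Q0" and f2: "f2 a = Q0" "f2 b = P0" using ab by (simp_all add: f1_def f2_def)
  have PQ: "P0 \<noteq> Q0" using R by simp
  have M: "?M = {f1, f2}"
  proof
    have "bij_betw f1 {a, b} {P0, Q0}" "bij_betw f2 {a, b} {P0, Q0}"
      unfolding bij_betw_def using f1 f2 PQ by auto
    then show "{f1, f2} \<subseteq> ?M" unfolding matchings_def using I f1 f2 by (simp add: f1_def f2_def)
    show "?M \<subseteq> {f1, f2}"
    proof
      fix f assume f: "f \<in> ?M"
      have "f a \<noteq> f b" using matchingsD(2)[OF f] ab(1) unfolding bij_betw_def inj_on_def by auto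
      moreover have "f a \<in> {P0, Q0}" "f b \<in> {P0, Q0}" using matchingsD(4)[OF f] by simp_all
      ultimately consider "f a = P0" "f b = Q0" | "f a = Q0" "f b = P0" by auto
      then have "(\<forall>x\<in>{a, b}. f x = f1 x) \<or> (\<forall>x\<in>{a, b}. f x = f2 x)" by cases (use f1 f2 in auto)
      moreover have "f1 \<in> extensional {a, b}" "f2 \<in> extensional {a, b}" by (simp_all add: f1_def f2_def)
      ultimately show "f \<in> {f1, f2}" using matchingsD(1)[OF f] extensionalityI by blast
    qed
  qed
  have low: "lowest {a, b} I l x R \<longleftrightarrow> l x \<le> l a \<and> l x \<le> l b" if "R \<in> ?N" for x R
    unfolding lowest_def using I that by blast
  have cl: "colour_class ?N q \<beta> = {P0, P1}" "colour_class ?N q (\<not> \<beta>) = {Q0, Q1}"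
    using q by (auto simp: colour_class_def)
  have ends: "ends I (colour_class ?N q d) x = colour_class ?N q d" if "x \<in> {a, b}" for x d
    using I[OF that] unfolding ends_def colour_class_def by auto
  have two: "\<exists>Y Z. Y \<noteq> Z \<and> colour_class ?N q d = {Y, Z}" for d
    using cl R by (cases "d = \<beta>") auto
  have sep: "separated I (colour_class ?N q d) {} x" if "x \<in> {a, b}" for x d
    using ends[OF that, of d] two[of d] unfolding separated_def joined_def by auto
  have main: "spanning I (colour_class ?N q d) T \<and> active {a, b} I l (colour_class ?N q d) T x = (l x \<le> l a \<and> l x \<le> l b)"
    if "x \<in> {a, b}" "T = {x}" for x T d
  proof
    obtain Y Z where YZ: "colour_class ?N q d = {Y, Z}" using two by blast
    have "(Y, Z) \<in> joined I (colour_class ?N q d) T"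
      by (rule joined_edge[of x]) (use ends[OF that(1), of d] YZ that in simp_all)
    then show "spanning I (colour_class ?N q d) T"
      unfolding spanning_def YZ using joined_sym joined_refl by fast
    have T: "T - {x} = {}" using that by simp
    show "active {a, b} I l (colour_class ?N q d) T x = (l x \<le> l a \<and> l x \<le> l b)"
      unfolding active_def T using sep by simp
  qed
  have tree: "\<And>x. x \<in> {a, b} \<Longrightarrow> tree_part {a, b} q f (q (f x)) = {x}" "\<exists>y\<in>{a, b}. tree_part {a, b} q f d = {y}"
    if "f \<in> {f1, f2}" for f d
  proof -
    have "q (f a) = (\<not> q (f b))" using that f1 f2 q by auto
    then show t: "tree_part {a, b} q f (q (f x)) = {x}" if "x \<in> {a, b}" for x
      using that ab(1) unfolding tree_part_def by auto
    have "d = q (f a) \<or> d = q (f b)" using \<open>q (f a) = (\<not> q (f b))\<close> by auto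
    then show "\<exists>y\<in>{a, b}. tree_part {a, b} q f d = {y}" using t by auto
  qed
  have fN: "f x \<in> ?N" if "f \<in> {f1, f2}" "x \<in> {a, b}" for f x using that f1 f2 by auto
  show "coherent {a, b} ?N {P0, Q0} I q l"
    unfolding coherent_def M
  proof (intro conjI ballI allI)
    fix f d assume f: "f \<in> {f1, f2}"
    obtain y where "y \<in> {a, b}" "tree_part {a, b} q f d = {y}" using tree(2)[OF f] by blast
    then show "spanning I (colour_class ?N q d) (tree_part {a, b} q f d)" using main by blast
  next
    fix f x assume f: "f \<in> {f1, f2}" and x: "x \<in> {a, b}"
    show "separated I (colour_class ?N q (q (f x))) (tree_part {a, b} q f (q (f x)) - {x}) x"
      using sep[OF x] tree(1)[OF f x] by simp
    show "active_at {a, b} ?N I q l f x = lowest {a, b} I l x (f x)"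
      unfolding active_at_def low[OF fN[OF f x]] using main[OF x tree(1)[OF f x]] by blast
  next
    fix x d assume x: "x \<in> {a, b}"
    have "q (f1 x) = (\<not> q (f2 x))" using x f1 f2 q by auto
    then show "\<exists>f\<in>{f1, f2}. q (f x) = d" by (cases "d = q (f1 x)") auto
  qed
  have "f1 \<noteq> f2" using f1 f2 PQ by metis
  then have "matching_sum {a, b} {P0, Q0} I q l m =
      (\<Prod>x\<in>{a, b}. half_edge_weight {a, b} I q l m x (f1 x)) + (\<Prod>x\<in>{a, b}. half_edge_weight {a, b} I q l m x (f2 x))"
    unfolding matching_sum_def M by simp
  also have "\<dots> = half_edge_weight {a, b} I q l m a P0 * half_edge_weight {a, b} I q l m b Q0 +
      half_edge_weight {a, b} I q l m a Q0 * half_edge_weight {a, b} I q l m b P0"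
    using ab(1) f1 f2 by simp
  \<comment> \<open>The crossing with the lower label carries \<open>L\<close> at both regions, and
    the outcome is symmetric in \<open>a\<close> and \<open>b\<close>.\<close>
  also have "\<dots> = m \<beta> a * m (\<not> \<beta>) b + m (\<not> \<beta>) a * m \<beta> b +
      loop_value * (m \<beta> a * m \<beta> b + m (\<not> \<beta>) a * m (\<not> \<beta>) b)"
    using ab(2) unfolding half_edge_weight_def by (cases "l a < l b") (simp_all add: low q algebra_simps)
  finally show "matching_sum {a, b} {P0, Q0} I q l m = m \<beta> a * m (\<not> \<beta>) b + m (\<not> \<beta>) a * m \<beta> b +
      loop_value * (m \<beta> a * m \<beta> b + m (\<not> \<beta>) a * m (\<not> \<beta>) b)" .
qed


text \<open>\<open>f\<close> picks a representative of every component, and a set without edges has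
  as many components as elements.\<close>

lemma card_components_representatives:
  assumes "sym q" "A \<subseteq> B" and f: "\<And>x y. (x, y) \<in> q \<Longrightarrow> f x = f y" "\<And>y. y \<in> B \<Longrightarrow> f y \<in> A"
    "\<And>y. y \<in> B \<Longrightarrow> (f y, y) \<in> q\<^sup>*" "\<And>x. x \<in> A \<Longrightarrow> f x = x"
  shows "card (components q B) = card A"
proof -
  have "card (components {} A) = card (components q B)"
    by (rule card_components_eq[where f = f and h = id]) (use assms in \<open>auto simp: sym_def\<close>)
  moreover have "components {} A = (\<lambda>x. {x}) ` A" unfolding components_def by simp
  moreover have "card ((\<lambda>x. {x}) ` A) = card A" by (rule card_image) simp
  ultimately show ?thesis by simp
qed

lemma double_ne_3: "2 * y \<noteq> (3 :: 4)"
  using four_cases[of y 0] by auto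

text \<open>The segments join 0 with 3 and 1 with 2. The even smoothing has the same arcs, so each
  segment closes up to a circle; the odd one joins 0 with 1 and thereby links the two
  segments.\<close>

lemma circles_curl:
  assumes g: "\<And>i. g (a, i) = (a, 3 - i)"
  shows "circles {a} g {} = 2" "circles {a} g {a} = 1"
proof -
  let ?B = "{a} \<times> (UNIV :: 4 set)"
  have pg: "pairing ?B g" unfolding pairing_def using g double_ne_3 by auto
  have four: "i = 0 \<or> i = 1 \<or> i = 2 \<or> i = 3" for i :: 4 using four_cases[of i 0] by auto
  have sym: "sym (strands g (state_partner S) ?B)" for S by (rule sym_strands[OF pg pairing_state_partner])
  have e: "((a, i), (a, 3 - i)) \<in> (strands g (state_partner S) ?B)\<^sup>*"
    "((a, i), state_partner S (a, i)) \<in> (strands g (state_partner S) ?B)\<^sup>*" for S i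
    using strands_edge(1)[of "(a, i)" ?B g "state_partner S"] strands_edge(2)[of "(a, i)" ?B "state_partner S" g] g by auto
  define f :: "'a dart \<Rightarrow> 'a dart" where "f = (\<lambda>(x, i). if i = 0 \<or> i = 3 then (a, 0) else (a, 1))"
  have "card (components (strands g (state_partner {}) ?B) ?B) = card {(a, 0 :: 4), (a, 1)}"
  proof (rule card_components_representatives[where f = f, OF sym])
    show "f x = f y" if "(x, y) \<in> strands g (state_partner {}) ?B" for x y
    proof -
      have x: "x \<in> ?B" and y: "y = g x \<or> y = state_partner {} x" using that unfolding strands_def by auto
      obtain i where i: "x = (a, i)" using x by auto
      then have "y = (a, 3 - i)" using y g by (simp add: state_partner_apply)
      then show ?thesis unfolding i using four[of i] by (auto simp: f_def)
    qed
    show "(f y, y) \<in> (strands g (state_partner {}) ?B)\<^sup>*" if y': "y \<in> ?B" for y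
    proof -
      obtain i where y: "y = (a, i)" using y' by auto
      show ?thesis unfolding y using four[of i] e(1)[of 0 "{}"] e(1)[of 1 "{}"] by (auto simp: f_def)
    qed
  qed (auto simp: f_def split: if_splits)
  then show "circles {a} g {} = 2" unfolding circles_def by simp
  have "card (components (strands g (state_partner {a}) ?B) ?B) = card {(a, 0 :: 4)}"
  proof (rule card_components_representatives[where f = "\<lambda>_. (a, 0)", OF sym])
    show "((a, 0), y) \<in> (strands g (state_partner {a}) ?B)\<^sup>*" if y': "y \<in> ?B" for y
    proof -
      obtain i where y: "y = (a, i)" using y' by auto
      have 1: "((a, 0), (a, 1)) \<in> (strands g (state_partner {a}) ?B)\<^sup>*"
        using e(2)[of 0 "{a}"] by (simp add: state_partner_apply)
      then have "((a, 0), (a, 2)) \<in> (strands g (state_partner {a}) ?B)\<^sup>*"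
        using e(1)[of 1 "{a}"] by (auto intro: rtrancl_trans)
      then show ?thesis unfolding y using four[of i] e(1)[of 0 "{a}"] 1 by auto
    qed
  qed auto
  then show "circles {a} g {a} = 1" unfolding circles_def by simp
qed

text \<open>The Hopf link universe is a bigon extension of a single curl.\<close>

lemma hopf_state_sum:
  assumes ab: "a \<noteq> b" and pg: "pairing ({a, b} \<times> UNIV) g'" and g': "\<And>i. g' (a, i) = (b, k - i)"
  shows "state_sum {a, b} (g', 0) w =
    w a True * w b (odd4 (k + 1)) + w a False * w b (\<not> odd4 (k + 1)) +
    loop_value * (w a False * w b (odd4 (k + 1)) + w a True * w b (\<not> odd4 (k + 1)))"
proof -
  \<comment> \<open>The curl is what remains when the bigon with the corners \<open>(a, 2)\<close>
    and \<open>(b, k + 1)\<close> is undone; hence the base indices 0 at \<open>a\<close> and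
    \<open>k + 1\<close> at \<open>b\<close>.\<close>
  define g :: "'a dart \<Rightarrow> 'a dart" where "g = (\<lambda>(x, i). (x, 3 - i))"
  define h :: "'a dart \<Rightarrow> 'a dart" where
    "h = (\<lambda>d. if d = (a, 0 + 2) then (b, k + 1 + 2) else if d = (a, 0 + 3) then (b, k + 1 + 3) else d)"
  have g'b: "g' (b, j) = (a, k - j)" for j
  proof -
    have "g' (g' (a, k - j)) = (a, k - j)" using pg unfolding pairing_def by auto
    then show ?thesis using g' by simp
  qed
  have o: "\<not> odd4 0" by (simp add: odd4_def)
  have k: "k - 2 = k + 1 + 1" "k - 3 = k + 1" by (simp_all add: four_shift)
  interpret bigon_gluing "{a}" a b g g' 0 "k + 1" h
  proof
    show "pairing ({a} \<times> UNIV) g" unfolding pairing_def g_def using double_ne_3 by auto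
    show "pairing (insert b {a} \<times> UNIV) g'" using pg by (simp add: insert_commute)
    show "g' (a, 0 + 2) = (b, k + 1 + 1)" "g' (a, 0 + 3) = (b, k + 1)" using g' k by simp_all
    fix d :: "'a dart" assume "d \<in> {a} \<times> UNIV"
    then obtain i where d: "d = (a, i)" by auto
    have "i = 0 \<or> i = 1 \<or> i = 2 \<or> i = 3" using four_cases[of i 0] by auto
    then show "g' (h d) = h (g d)"
      unfolding d using g' g'b by (elim disjE) (simp_all add: h_def g_def four_shift add.assoc)
  qed (use ab h_def in auto)
  have c: "circles {a} g {} = 2" "circles {a} g {a} = 1" by (rule circles_curl; simp add: g_def)+
  have "state_sum {a} (g, 0) W = W a False * loop_value + W a True" for W
    using state_sum_insert[of "{}" a g 0 W] c by simp
  then have sum: "state_sum {a, b} (g', 0) w = merged_weight w a False * loop_value + merged_weight w a True"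
    using state_sum_bigon[of w] by (simp add: insert_commute)
  have W: "merged_weight w a False = w a False * w b (odd4 (k + 1))"
    "merged_weight w a True = w a False * w b (\<not> odd4 (k + 1)) + w a True * w b (odd4 (k + 1)) +
      loop_value * w a True * w b (\<not> odd4 (k + 1))"
    unfolding merged_weight_def using o by simp_all
  show ?thesis unfolding sum W by (simp add: algebra_simps)
qed

lemma hopf_expands:
  assumes hopf: "hopf_universe U" and conf: "link_configuration U s l"
  shows "expands U s l"
proof -
  obtain a b k where ab: "a \<noteq> b" and C: "crossings U = {a, b}" and G: "\<And>i. glue U (a, i) = (b, k - i)"
    using hopf unfolding hopf_universe_def by blast
  have U: "universe U" and s: "s \<in> segments U" and bij: "bij_betw l (crossings U) {1..card (crossings U)}"
    using conf unfolding link_configuration_def by auto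
  have inj: "inj_on l (crossings U)" using bij by (rule bij_betw_imp_inj_on)
  have in_darts: "(a, i) \<in> darts U" "(b, i) \<in> darts U" for i by (simp_all add: darts_def C)
  have Gb: "glue U (b, j) = (a, k - j)" for j
    using universeD(6)[OF U in_darts(1), of "k - j"] G by simp
  \<comment> \<open>The four regions are the bigons between consecutive segments at
    \<open>a\<close>.\<close>
  define Rg where "Rg i = {(a, i), (b, k - i - 1)}" for i
  have nx: "next_corner U (a, i) = (b, k - i - 1)" "next_corner U (b, k - i - 1) = (a, i)" for i
    by (simp_all add: next_corner_def G Gb)
  have Ra: "region U (a, i) = Rg i" for i
  proof
    show "region U (a, i) \<subseteq> Rg i"
    proof
      fix e assume e: "e \<in> region U (a, i)"
      have "e \<in> Rg i \<and> (\<lambda>_. ()) e = (\<lambda>_. ()) (a, i)"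
        by (rule orbit_invariant[OF e[unfolded region_def]]) (use nx in \<open>auto simp: Rg_def\<close>)
      then show "e \<in> Rg i" by simp
    qed
    have "(b, k - i - 1) \<in> region U (a, i)"
      using orbit.base[of "next_corner U" "(a, i)"] nx(1) unfolding region_def by simp
    then show "Rg i \<subseteq> region U (a, i)" using self_in_region[OF U in_darts(1)] by (simp add: Rg_def)
  qed
  have Rb: "region U (b, j) = Rg (k - j - 1)" for j
    using region_next_corner[OF U in_darts(1), of "k - j - 1"] nx(1)[of "k - j - 1"] by (simp add: Ra)
  have Rg_inj: "Rg i = Rg j \<longleftrightarrow> i = j" for i j using ab by (auto simp: Rg_def)
  have regs: "regions U = range Rg"
  proof
    show "regions U \<subseteq> range Rg" unfolding regions_def darts_def C by (auto simp: Ra Rb)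
    show "range Rg \<subseteq> regions U" unfolding regions_def using Ra in_darts(1) by (metis image_eqI image_subsetI)
  qed
  obtain i0 where out: "outer U = Rg i0" using U regs unfolding universe_def by auto
  define Bk where "Bk = Rg ` {i. odd4 i \<noteq> odd4 i0}"
  have mem: "Rg i \<in> Bk \<longleftrightarrow> odd4 i \<noteq> odd4 i0" for i unfolding Bk_def using Rg_inj by auto
  have odd_pred: "odd4 (i - 1) \<longleftrightarrow> \<not> odd4 i" for i by (simp add: four_shift odd4_add)
  have B: "checkerboard U Bk"
    unfolding checkerboard_def
  proof (intro conjI)
    show "Bk \<subseteq> regions U" unfolding Bk_def regs by auto
    show "outer U \<notin> Bk" unfolding out mem by simp
    have "region U (x, i) \<in> Bk \<longleftrightarrow> region U (x, i - 1) \<notin> Bk" if "x = a \<or> x = b" for x i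
    proof -
      have "k - (i - 1) - 1 = k - i" by simp
      then have "region U (b, i) \<in> Bk \<longleftrightarrow> region U (b, i - 1) \<notin> Bk"
        unfolding Rb mem odd_pred[of "k - i"] by argo
      moreover have "region U (a, i) \<in> Bk \<longleftrightarrow> region U (a, i - 1) \<notin> Bk"
        unfolding Ra mem odd_pred by argo
      ultimately show ?thesis using that by blast
    qed
    then show "\<forall>(x, i)\<in>darts U. region U (x, i) \<in> Bk \<longleftrightarrow> region U (x, i - 1) \<notin> Bk"
      unfolding darts_def C by blast
  qed
  obtain i where si: "s = {(a, i), (b, k - i)}"
  proof -
    obtain d where d: "d \<in> darts U" "s = {d, glue U d}" using s unfolding segments_def by auto
    then consider i where "d = (a, i)" | j where "d = (b, j)" unfolding darts_def C by auto
    then show thesis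
    proof cases
      case 1 then show thesis using that[of i] d G by simp
    next
      case 2 then show thesis using that[of "k - j"] d Gb by (simp add: insert_commute)
    qed
  qed
  \<comment> \<open>The segment at dart \<open>i\<close> borders the regions \<open>i\<close> and
    \<open>i - 1\<close>, which become \<open>p + 3\<close> and \<open>p + 2\<close>; left are
    \<open>p\<close> and \<open>p + 1\<close>, one of each colour.\<close>
  define p where "p = i + 1"
  have i: "i = p + 3" "i - 1 = p + 2" unfolding p_def by (simp_all add: four_shift add.assoc)
  have distinct: "distinct [Rg p, Rg (p + 2), Rg (p + 1), Rg (p + 3)]" by (simp add: Rg_inj)
  have UNIV: "UNIV = {p, p + 2, p + 1, p + 3}" using four_cases[of _ p] by blast
  have "range Rg = {Rg p, Rg (p + 2), Rg (p + 1), Rg (p + 3)}" unfolding UNIV by simp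
  then have N: "regions U = {Rg p, Rg (p + 2), Rg (p + 1), Rg (p + 3)}" using regs by simp
  have rs: "region U ` s = {Rg (p + 3), Rg (p + 2)}"
  proof -
    have "region U (b, k - i) = Rg (i - 1)" unfolding Rb by simp
    then have "region U ` s = {Rg i, Rg (i - 1)}" unfolding si by (simp add: Ra)
    also have "\<dots> = {Rg i, Rg (p + 2)}" by (simp only: i(2))
    finally show ?thesis by (simp only: i(1))
  qed
  have X: "round_vertices U s = {Rg p, Rg (p + 1)}"
    unfolding round_vertices_def N rs by (simp add: insert_Diff_if Rg_inj)
  have inc: "incident U x R" if x: "x \<in> {a, b}" and R': "R \<in> {Rg p, Rg (p + 2), Rg (p + 1), Rg (p + 3)}" for x R
  proof -
    obtain j where R: "R = Rg j" using R' by blast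
    have "R = region U (a, j)" "R = region U (b, k - j - 1)" unfolding R by (simp_all add: Ra Rb)
    then show ?thesis using x unfolding incident_def by blast
  qed
  have black: "is_black U (Rg j) \<longleftrightarrow> (black_odd U a \<longleftrightarrow> odd4 j)" for j
    using is_black_odd[OF U B, of a j] C by (simp add: Ra)
  let ?\<beta> = "is_black U (Rg p)"
  have q: "is_black U (Rg (p + 2)) = ?\<beta>" "is_black U (Rg (p + 1)) = (\<not> ?\<beta>)" "is_black U (Rg (p + 3)) = (\<not> ?\<beta>)"
    by (auto simp: black odd4_add)
  have lab: "l a \<noteq> l b" using inj ab C by (auto dest: inj_onD)
  note hc = hopf_coherent[where q = "is_black U" and I = "incident U", OF ab lab distinct refl q(1,2,3) inc]
  \<comment> \<open>The corners \<open>(b, k + 1)\<close> and \<open>(a, 2)\<close> lie in one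
    region, which relates the parity of the black corners at \<open>b\<close> to that at
    \<open>a\<close>.\<close>
  have "k - (k + 1) - 1 = 2" by simp
  then have "region U (b, k + 1) = Rg 2" unfolding Rb by (simp only:)
  then have b: "(black_odd U b \<longleftrightarrow> odd4 (k + 1)) \<longleftrightarrow> \<not> black_odd U a"
    using is_black_odd[OF U B, of b "k + 1"] C black[of 2] by (simp add: odd4_def)
  have "state_sum (crossings U) (glue U, 0) w =
      matching_sum (crossings U) (round_vertices U s) (incident U) (is_black U) l (colour_weight U w)" for w
  proof -
    let ?m = "colour_weight U w"
    have "odd4 (k + 1) \<longleftrightarrow> (\<not> black_odd U a \<longleftrightarrow> black_odd U b)" using b by argo
    then have "state_sum {a, b} (glue U, 0) w =
        ?m (black_odd U a) a * ?m (\<not> black_odd U a) b + ?m (\<not> black_odd U a) a * ?m (black_odd U a) b +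
        loop_value * (?m (\<not> black_odd U a) a * ?m (\<not> black_odd U a) b + ?m (black_odd U a) a * ?m (black_odd U a) b)"
      using hopf_state_sum[OF ab _ G, of w] universeD(7)[OF U] C by (auto simp: colour_weight_def)
    moreover have "matching_sum {a, b} {Rg p, Rg (p + 1)} (incident U) (is_black U) l ?m =
        ?m ?\<beta> a * ?m (\<not> ?\<beta>) b + ?m (\<not> ?\<beta>) a * ?m ?\<beta> b +
        loop_value * (?m ?\<beta> a * ?m ?\<beta> b + ?m (\<not> ?\<beta>) a * ?m (\<not> ?\<beta>) b)"
      by (rule hc(2))
    ultimately show ?thesis unfolding C X
      by (cases "?\<beta>"; cases "black_odd U a") (simp_all only: simp_thms ac_simps distrib_left)
  qed
  moreover have "s \<subseteq> darts U" unfolding si using in_darts by simp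
  ultimately show ?thesis
    unfolding expands_def using U inj B hc(1) N X C by auto
qed

lemma admissible_expands: "admissible U s l \<Longrightarrow> expands U s l"
  by (induction rule: admissible.induct) (auto intro: hopf_expands expands_admissible_extension)

section \<open>Specialisation to the Kauffman weights\<close>

text \<open>A half-edge is positive exactly if the A-smoothing at \<open>c\<close> merges the
  corners of the colour of \<open>R\<close>.\<close>

lemma half_edge_weight_eval:
  assumes U: "universe (universe_of K)" and B: "checkerboard (universe_of K) Bk" and c: "c \<in> crossings K"
  shows "half_edge_weight (crossings K) (incident (universe_of K)) (is_black (universe_of K)) l
      (colour_weight (universe_of K) (skein_weight (over K))) c R = eval_K (signed_letter K l (c, R))"
proof -
  let ?U = "universe_of K"
  have C: "crossings ?U = crossings K" by (simp add: universe_of_def link_universe.truncate_def)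
  define \<sigma> where "\<sigma> = is_black ?U (region ?U (c, over K c))"
  have \<sigma>: "\<sigma> \<longleftrightarrow> (black_odd ?U c \<longleftrightarrow> odd4 (over K c))"
    "is_black ?U (region ?U (c, over K c + 2)) = \<sigma>"
    using is_black_odd[OF U B, of c] c C unfolding \<sigma>_def by (simp_all add: odd4_add)
  have w: "colour_weight ?U (skein_weight (over K)) d c = (if d = \<sigma> then A_pow 1 else A_pow (- 1))" for d
    using \<sigma>(1) unfolding colour_weight_def skein_weight_def by auto
  have cs: "crossing_sign K c = (if \<sigma> then 1 else - 1)"
    using \<sigma>(2) unfolding crossing_sign_def \<sigma>_def is_black_def by simp
  have sign: "half_edge_sign K (c, R) = (if is_black ?U R = \<sigma> then 1 else - 1)"
    unfolding half_edge_sign_def region_sign_def using cs by (auto simp: is_black_def)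
  have act: "activity_letter ?U l (c, R) = (if lowest (crossings K) (incident ?U) l c R then L else D)"
    unfolding activity_letter_def lowest_def by (simp add: C)
  have A: "A_pow 1 + loop_value * A_pow (- 1) = - A_pow (- 3)" "A_pow (- 1) + loop_value * A_pow 1 = - A_pow 3"
    unfolding loop_value_def by (simp_all add: left_diff_distrib mult_single)
  show ?thesis
    unfolding half_edge_weight_def w signed_letter_def sign act
    by (cases "is_black ?U R = \<sigma>"; cases "lowest (crossings K) (incident ?U) l c R") (use A in \<open>auto simp: add.commute\<close>)
qed

theorem theoremA:
  fixes K :: "'c link_diagram" and s :: "'c dart set" and l :: "'c \<Rightarrow> nat"
  assumes "universe (universe_of K)"
    and "admissible (universe_of K) s l"
  shows "bracket K =
    (\<Sum>P \<in> {P. perfect_matching (universe_of K) s P}. \<Prod>h\<in>P. eval_K (signed_letter K l h))"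
proof -
  let ?U = "universe_of K"
  have C: "crossings ?U = crossings K" "glue ?U = glue K"
    by (simp_all add: universe_of_def link_universe.truncate_def)
  have "expands ?U s l" using assms(2) by (rule admissible_expands)
  then obtain Bk where B: "checkerboard ?U Bk"
    and sum: "\<And>w. state_sum (crossings K) (glue K, 0) w =
        matching_sum (crossings K) (round_vertices ?U s) (incident ?U) (is_black ?U) l (colour_weight ?U w)"
    unfolding expands_def C by blast
  \<comment> \<open>The outer region has a corner and so provides a crossing; without crossings and
    circles the recursion would assign no value to the bracket.\<close>
  have "outer ?U \<in> regions ?U" using assms(1) unfolding universe_def by blast
  then have "crossings K \<noteq> {}" unfolding regions_def darts_def C by auto
  then have "bracket K = state_sum (crossings K) (glue K, 0) (skein_weight (over K))"
    using universeD(1,7)[OF assms(1)] by (intro bracket_eq_state_sum) (simp_all add: C)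
  also have "\<dots> = (\<Sum>f\<in>universe_matchings ?U s. \<Prod>c\<in>crossings K. eval_K (signed_letter K l (c, f c)))"
    unfolding sum matching_sum_def C by (intro sum.cong prod.cong refl half_edge_weight_eval[OF assms(1) B])
  also have "\<dots> = (\<Sum>P \<in> {P. perfect_matching ?U s P}. \<Prod>h\<in>P. eval_K (signed_letter K l h))"
    unfolding sum_perfect_matchings C ..
  finally show ?thesis .
qed

end
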